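(* Let $\mathbf X=\sum_{j=1}^q\Psi_j\mathbf Z_j$, where $\mathbf Z_j$, $j=1,\ldots,q$, are i.i.d. $\mathbb R^d$-valued random vectors with generic element $\mathbf Z$ and $\Psi_j$, $j=1,\ldots,q$, are deterministic $d\times d$ matrices. Assume that $\mathbf X\in{\rm RV}(\alpha,\mu_{\mathbf X})$ for some $\alpha>0$. If all the matrices $\Psi_j$, $j=1,\ldots,q$, are invertible and $$(\gamma(\Psi_1))^{\alpha}>\sum_{j=2}^q\|\Psi_j\|^{\alpha},$$ where $\gamma(\Psi_1)=\min_{\mathbf z\in\mathbb S^{d-1}}|\Psi_1\mathbf z|$ and $\|\Psi_j\|$ is the operator norm of $\Psi_j$, then $\mathbf Z\in{\rm RV}(\alpha,\mu_{\mathbf Z})$ and $$\frac{P(s^{-1}\mathbf X\in\cdot)}{P(|\mathbf Z|>s)}\ \to\ \sum_{j=1}^q\mu_{\mathbf Z}\circ\Psi_j^{-1}\qquad\text{vaguely in }\overline{\mathbb R}_0^d\text{ as }s\to\infty .$$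
   Context: $|\cdot|$ is a fixed norm on $\mathbb R^d$, $\mathbb S^{d-1}$ its unit sphere, and the operator norm is the one induced by $|\cdot|$. $\overline{\mathbb R}=[-\infty,\infty]$, $\overline{\mathbb R}_0^d=\overline{\mathbb R}^d\setminus\{\mathbf 0\}$; a Borel measure on $\overline{\mathbb R}_0^d$ is Radon if it is finite outside every ball of positive radius centered at the origin; vague convergence is convergence of integrals of continuous functions with compact support in $\overline{\mathbb R}_0^d$ (supports bounded away from the origin). A random vector $\mathbf X$ in $\mathbb R^d$ is regularly varying if there is a non-null Radon measure $\mu_{\mathbf X}$ on $\overline{\mathbb R}_0^d$, not charging the set of infinite points, such that $P(s^{-1}\mathbf X\in\cdot)/P(|\mathbf X|>s)\to\mu_{\mathbf X}$ vaguely in $\overline{\mathbb R}_0^d$ as $s\to\infty$. Then $\mu_{\mathbf X}(tA)=t^{-\alpha}\mu_{\mathbf X}(A)$, $t>0$, $A$ Borel, for some $\alpha>0$, called the index; $\mu_{\mathbf X}$ is the tail measure and one writes $\mathbf X\in{\rm RV}(\alpha,\mu_{\mathbf X})$. Here $\mu_{\mathbf Z}\circ\Psi_j^{-1}(B)=\mu_{\mathbf Z}(\{\mathbf z:\Psi_j\mathbf z\in B\})$. *)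

theory Defs
  imports "HOL-Probability.Probability"
begin

text \<open>An arbitrary norm \<open>N\<close> on \<open>\<real>\<^sup>d\<close> (not only the Euclidean one
  of the type class), with the operator norm it induces and the minimal stretching of a matrix.\<close>

definition is_norm :: "(real ^ 'd \<Rightarrow> real) \<Rightarrow> bool" where
  "is_norm N \<longleftrightarrow>
     (\<forall>x. N x = 0 \<longleftrightarrow> x = 0) \<and>
     (\<forall>a x. N (a *\<^sub>R x) = \<bar>a\<bar> * N x) \<and>
     (\<forall>x y. N (x + y) \<le> N x + N y)"

definition op_norm :: "(real ^ 'd \<Rightarrow> real) \<Rightarrow> real ^ 'd ^ 'd \<Rightarrow> real" where
  "op_norm N A = (SUP z\<in>{z. N z = 1}. N (A *v z))"

text \<open>The infimum is a minimum, the unit sphere being compact and nonempty.\<close>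

definition min_stretch :: "(real ^ 'd \<Rightarrow> real) \<Rightarrow> real ^ 'd ^ 'd \<Rightarrow> real" where
  "min_stretch N A = (INF z\<in>{z. N z = 1}. N (A *v z))"

text \<open>\<open>[-\<infinity>, \<infinity>]\<^sup>d\<close> is the type \<open>ereal ^ 'd\<close> with its
  (compact) product topology.\<close>

definition ext :: "real ^ 'd \<Rightarrow> ereal ^ 'd" where
  "ext x = (\<chi> i. ereal (x $ i))"

definition fin_part :: "ereal ^ 'd \<Rightarrow> real ^ 'd" where
  "fin_part z = (\<chi> i. real_of_ereal (z $ i))"

definition ext_scale :: "real \<Rightarrow> ereal ^ 'd \<Rightarrow> ereal ^ 'd" where
  "ext_scale t z = (\<chi> i. ereal t * z $ i)"

definition punctured :: "(ereal ^ 'd) measure" where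
  "punctured = restrict_space borel (- {0})"

text \<open>The complement of a ball contains all points having an infinite coordinate.\<close>

definition Radon0 :: "(real ^ 'd \<Rightarrow> real) \<Rightarrow> (ereal ^ 'd) measure \<Rightarrow> bool" where
  "Radon0 N \<mu> \<longleftrightarrow> sets \<mu> = sets punctured \<and>
     (\<forall>r>0. emeasure \<mu> (- (ext ` {x. N x < r})) < \<infinity>)"

text \<open>Functions are only looked at on the punctured space; the support is the closure relative
  to that space.\<close>

definition Cc0 :: "(ereal ^ 'd \<Rightarrow> real) set" where
  "Cc0 = {f. continuous_on (- {0}) f \<and>
             compact (closure {z \<in> - {0}. f z \<noteq> 0} \<inter> - {0})}"

definition vague_conv0 :: "(real \<Rightarrow> (ereal ^ 'd) measure) \<Rightarrow> (ereal ^ 'd) measure \<Rightarrow> bool" where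
  "vague_conv0 \<nu> \<mu> \<longleftrightarrow>
     (\<forall>f\<in>Cc0. ((\<lambda>s. \<integral>z. f z \<partial>\<nu> s) \<longlongrightarrow> (\<integral>z. f z \<partial>\<mu>)) at_top)"

text \<open>The measure \<open>P(s\<^sup>-\<^sup>1 X \<in> \<cdot>) / P(|Y| > s)\<close> on the punctured space.
  Where the denominator is \<open>0\<close>, it is the null measure.\<close>

definition normalized_law ::
  "'w measure \<Rightarrow> (real ^ 'd \<Rightarrow> real) \<Rightarrow> ('w \<Rightarrow> real ^ 'd) \<Rightarrow> ('w \<Rightarrow> real ^ 'd)
     \<Rightarrow> real \<Rightarrow> (ereal ^ 'd) measure" where
  "normalized_law M N X Y s =
     scale_measure (ennreal (1 / measure M {\<omega> \<in> space M. N (Y \<omega>) > s}))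
       (restrict_space (distr M borel (\<lambda>\<omega>. ext (inverse s *\<^sub>R X \<omega>))) (- {0}))"

definition regularly_varying ::
  "'w measure \<Rightarrow> (real ^ 'd \<Rightarrow> real) \<Rightarrow> ('w \<Rightarrow> real ^ 'd) \<Rightarrow> (ereal ^ 'd) measure \<Rightarrow> bool" where
  "regularly_varying M N X \<mu> \<longleftrightarrow>
     X \<in> borel_measurable M \<and>
     Radon0 N \<mu> \<and>
     emeasure \<mu> (space \<mu>) \<noteq> 0 \<and>
     emeasure \<mu> (- range ext) = 0 \<and>
     vague_conv0 (normalized_law M N X X) \<mu>"

text \<open>Homogeneity of the tail measure is automatic for some \<open>\<alpha>\<close>; stating it here is what
  makes \<open>\<alpha>\<close> the index.\<close>

definition RV ::
  "'w measure \<Rightarrow> (real ^ 'd \<Rightarrow> real) \<Rightarrow> ('w \<Rightarrow> real ^ 'd) \<Rightarrow> real \<Rightarrow> (ereal ^ 'd) measure \<Rightarrow> bool" where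
  "RV M N X \<alpha> \<mu> \<longleftrightarrow>
     regularly_varying M N X \<mu> \<and> \<alpha> > 0 \<and>
     (\<forall>t>0. \<forall>A\<in>sets \<mu>.
        emeasure \<mu> (ext_scale t ` A) = ennreal (t powr (- \<alpha>)) * emeasure \<mu> A)"

text \<open>The measure \<open>B \<mapsto> \<mu> {z. A z \<in> B}\<close> on the punctured space. A matrix does not act on the
  points with an infinite coordinate, so these are left out: tail measures do not charge them.\<close>

definition pushforward :: "(ereal ^ 'd) measure \<Rightarrow> real ^ 'd ^ 'd \<Rightarrow> (ereal ^ 'd) measure" where
  "pushforward \<mu> A =
     restrict_space
       (distr (restrict_space \<mu> (range ext)) borel (\<lambda>z. ext (A *v fin_part z))) (- {0})"

definition sum_measures :: "'i set \<Rightarrow> ('i \<Rightarrow> (ereal ^ 'd) measure) \<Rightarrow> (ereal ^ 'd) measure" where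
  "sum_measures I \<nu> =
     measure_of (space punctured) (sets punctured) (\<lambda>B. \<Sum>j\<in>I. emeasure (\<nu> j) B)"

end

theory Submission
  imports Defs
begin

text \<open>Write \<open>\<gamma>\<close> for the minimal stretching of \<open>\<Psi>\<^sub>1\<close>. The event that \<open>\<Psi>\<^sub>1 Z\<^sub>1\<close> is large and the other
  summands are not gives \<open>P(|Z| > s) \<le> 2 P(|X| > \<gamma> s / 2)\<close> for large \<open>s\<close>, so the functionals
  \<open>L\<^sub>s f = E f(Z / s) / P(|X| > s)\<close> are eventually bounded by a multiple of \<open>sup |f| \<delta>\<^sup>-\<^sup>\<alpha>\<close> whenever \<open>f\<close> vanishes
  on the ball of radius \<open>\<delta>\<close>. Since only one summand can be large,
  \<open>\<Sum>\<^sub>j L\<^sub>s (f \<circ> \<Psi>\<^sub>j) \<rightarrow> \<integral> f d\<mu>\<^sub>X\<close>. Put \<open>\<Phi>\<^sub>j = \<Psi>\<^sub>1\<^sup>-\<^sup>1 \<Psi>\<^sub>j\<close>, \<open>T \<nu> = \<Sum>\<^sub>j\<^sub>\<ge>\<^sub>2 \<nu> \<circ> \<Phi>\<^sub>j\<^sup>-\<^sup>1\<close> and let \<open>\<mu>\<close> be the image of \<open>\<mu>\<^sub>X\<close>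
  under \<open>\<Psi>\<^sub>1\<^sup>-\<^sup>1\<close>; then \<open>L\<^sub>s\<close> asymptotically solves \<open>\<nu> + T \<nu> = \<mu>\<close>. As \<open>\<Phi>\<^sub>j\<close> has norm at most
  \<open>\<parallel>\<Psi>\<^sub>j\<parallel> / \<gamma>\<close>, the hypothesis makes \<open>T\<close> a contraction for the seminorms
  \<open>sup |f| \<delta>\<^sup>-\<^sup>\<alpha>\<close>, and \<open>L\<^sub>s\<close> converges to the Neumann series \<open>\<Sum>\<^sub>k (-T)\<^sup>k \<mu>\<close>. This is the difference of
  its even and its odd part, two positive measures; being a limit of positive functionals the difference is
  itself a positive measure \<open>\<nu>\<close>, and \<open>\<mu>\<^sub>Z\<close> is \<open>\<nu>\<close> normalised by \<open>lim P(|Z| > s) / P(|X| > s)\<close>.\<close>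

section \<open>The compactified space and a norm\<close>

text \<open>The obstacle is that nothing is known about the tail of Z at the start: limits are
  available only under the normalisation by P(|X| > s), and cancellation between the summands might
  make this much smaller than P(|Z| > s). The bound 2 P(|X| > \<gamma> s / 2) excludes that.
  Homogeneity then turns a norm bound r of a matrix into the factor \<open>r powr \<alpha>\<close>,
  because composing f with the matrix replaces \<delta> by \<delta> / r. Iterating the asymptotic
  equation n times leaves a remainder of order \<open>\<rho> ^ n\<close> for all s beyond a bound
  depending on n, so the limit exists without any choice of subsequences. The even and the odd part
  of the series are kept apart because both may have infinite mass near the origin, where a
  difference of measures is meaningless. They are compared on compact sets, and one minus a
  Radon-Nikodym density yields the difference. Matrices do not act on infinite points. The argument
  therefore runs on finite points, with functions of compact support; functions in
  \<open>Cc0\<close>, which may be nonzero at infinity, are reached at the end by a tightness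
  estimate.\<close>

text \<open>Tychonoff's theorem for the function space, carried over along the continuous surjection
  \<open>vec_lambda\<close>.\<close>

lemma compact_UNIV_ereal_vec: "compact (UNIV :: (ereal ^ 'd) set)"
proof -
  have "compact_space (product_topology (\<lambda>i::'d. euclidean :: ereal topology) UNIV)"
    unfolding compact_space_product_topology by (simp add: compact_space_def compact_UNIV)
  then have "compact (UNIV :: ('d \<Rightarrow> ereal) set)"
    by (simp add: euclidean_product_topology compact_space_def)
  moreover have "continuous_on UNIV (\<lambda>f::'d \<Rightarrow> ereal. vec_lambda f)"
    unfolding continuous_on_def
    by (auto intro!: tendsto_vec_lambda continuous_on_product_coordinates[unfolded continuous_on_def, rule_format])
  moreover have "range (\<lambda>f::'d \<Rightarrow> ereal. vec_lambda f) = UNIV"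
    by (metis surjI vec_lambda_eta)
  ultimately show ?thesis
    by (metis compact_continuous_image)
qed

text \<open>The Hausdorff property is pulled back from the product topology along the continuous
  injective map sending a vector to its coordinate function.\<close>

lemma compact_imp_closed_vec:
  fixes S :: "('a::t2_space ^ 'd) set"
  assumes "compact S"
  shows "closed S"
proof -
  let ?X = "euclidean :: ('a ^ 'd) topology"
  have "continuous_on UNIV (\<lambda>z::'a ^ 'd. (\<lambda>i. z $ i))"
    by (intro continuous_on_coordinatewise_then_product) (auto simp: continuous_on_def intro!: tendsto_intros)
  then have "continuous_map ?X (product_topology (\<lambda>i::'d. euclidean :: 'a topology) UNIV) (\<lambda>z. (\<lambda>i. z $ i))"
    by (simp add: euclidean_product_topology)
  moreover have "inj (\<lambda>z::'a ^ 'd. (\<lambda>i. z $ i))"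
    by (auto simp: inj_def vec_eq_iff fun_eq_iff)
  moreover have "Hausdorff_space (euclidean :: 'a topology)"
    unfolding Hausdorff_space_def by (simp add: disjnt_def separation_t2)
  then have "Hausdorff_space (product_topology (\<lambda>i::'d. euclidean :: 'a topology) UNIV)"
    by (simp only: Hausdorff_space_product_topology) blast
  ultimately have "Hausdorff_space ?X"
    by (metis Hausdorff_space_injective_preimage inj_on_subset subset_UNIV)
  then show ?thesis
    using compactin_imp_closedin[of ?X S] assms by simp
qed

lemma compact_eq_closed_ereal_vec:
  fixes S :: "(ereal ^ 'd) set"
  shows "compact S \<longleftrightarrow> closed S"
  using closed_Int_compact[of S, OF _ compact_UNIV_ereal_vec] compact_imp_closed_vec by auto

lemma fin_part_ext [simp]: "fin_part (ext x) = x"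
  by (simp add: fin_part_def ext_def)

lemma ext_0 [simp]: "ext 0 = 0"
  by (simp add: ext_def vec_eq_iff zero_ereal_def)

lemma ext_eq_iff [simp]: "ext x = ext y \<longleftrightarrow> x = y"
  by (rule inj_eq, rule inj_on_inverseI[of _ fin_part]) simp

lemma ext_eq_0_iff [simp]: "ext x = 0 \<longleftrightarrow> x = 0"
  using ext_eq_iff[of x 0] by simp

lemma range_ext: "range ext = {z. \<forall>i. z $ i \<in> - {\<infinity>, -\<infinity>}}"
proof (intro set_eqI iffI)
  fix z :: "ereal ^ 'd" assume "z \<in> {z. \<forall>i. z $ i \<in> - {\<infinity>, -\<infinity>}}"
  then have "z = ext (fin_part z)"
    by (auto simp: ext_def fin_part_def vec_eq_iff ereal_real)
  then show "z \<in> range ext" by blast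
qed (auto simp: ext_def)

lemma open_range_ext: "open (range ext)"
  unfolding range_ext by (intro open_vector_box allI open_Compl) auto

lemma continuous_on_ext: "continuous_on A ext"
  unfolding ext_def continuous_on_def by (auto intro!: tendsto_intros)

lemma continuous_on_fin_part: "continuous_on (range ext) fin_part"
proof -
  have "((\<lambda>z. real_of_ereal (z $ i)) \<longlongrightarrow> real_of_ereal (z $ i)) (at z within range ext)"
    if z: "z \<in> range ext" for z :: "ereal ^ 'd" and i
  proof -
    have "\<bar>z $ i\<bar> \<noteq> \<infinity>"
      using z by (auto simp: ext_def)
    then have "((\<lambda>z. real_of_ereal (z $ i)) \<longlongrightarrow> real_of_ereal (ereal (real_of_ereal (z $ i)))) (at z within range ext)"
      by (intro lim_real_of_ereal) (auto simp: ereal_real' intro!: tendsto_intros)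
    then show ?thesis by simp
  qed
  then show ?thesis
    unfolding fin_part_def continuous_on_def by (auto intro!: tendsto_vec_lambda)
qed

lemma borel_measurable_ext [measurable]: "ext \<in> borel_measurable borel"
  by (intro borel_measurable_continuous_onI continuous_on_ext)

lemma borel_measurable_fin_part [measurable]: "fin_part \<in> borel_measurable borel"
proof -
  have [measurable]: "(\<lambda>z::ereal ^ 'd. z $ i) \<in> borel_measurable borel" for i
    by (intro borel_measurable_continuous_onI) (auto simp: continuous_on_def intro!: tendsto_intros)
  have "(\<lambda>z::ereal ^ 'd. fin_part z \<bullet> axis i 1) \<in> borel_measurable borel" for i
    unfolding fin_part_def inner_axis by simp
  then show ?thesis
    by (subst borel_measurable_euclidean_space) (auto simp: Basis_vec_def)
qed

lemma sets_range_ext [measurable]: "range ext \<in> sets borel"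
  using open_range_ext by (rule borel_open)

section \<open>An arbitrary norm: comparison with the Euclidean norm and bounds for matrices\<close>

locale vector_norm =
  fixes N :: "real ^ 'd \<Rightarrow> real"
  assumes is_norm: "is_norm N"
begin

lemma N_eq_0_iff [simp]: "N x = 0 \<longleftrightarrow> x = 0"
  and N_scaleR: "N (a *\<^sub>R x) = \<bar>a\<bar> * N x"
  and N_triangle: "N (x + y) \<le> N x + N y"
  using is_norm by (auto simp: is_norm_def)

lemma N_0 [simp]: "N 0 = 0"
  by simp

lemma N_minus [simp]: "N (- x) = N x"
  using N_scaleR[of "-1" x] by (simp only: abs_minus abs_one scaleR_minus1_left mult_1)

lemma N_nonneg [simp]: "0 \<le> N x"
  using N_triangle[of x "- x"] by simp

lemma N_pos_iff: "0 < N x \<longleftrightarrow> x \<noteq> 0"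
  by (simp add: order_less_le)

lemma N_triangle_diff: "N x \<le> N y + N (x - y)"
  using N_triangle[of y "x - y"] by simp

lemma N_sum: "finite I \<Longrightarrow> N (\<Sum>i\<in>I. f i) \<le> (\<Sum>i\<in>I. N (f i))"
proof (induction rule: finite_induct)
  case (insert i I)
  then show ?case using N_triangle[of "f i" "sum f I"] by simp
qed simp

lemma N_le_norm: obtains K where "K > 0" "\<And>x. N x \<le> K * norm x"
proof
  let ?K = "1 + (\<Sum>b\<in>Basis. N b)"
  show "?K > 0"
    by (simp add: add_pos_nonneg sum_nonneg)
  fix x
  have "N x \<le> (\<Sum>b\<in>Basis. N ((x \<bullet> b) *\<^sub>R b))"
    using N_sum[of Basis "\<lambda>b. (x \<bullet> b) *\<^sub>R b"] by (simp add: euclidean_representation)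
  also have "\<dots> \<le> (\<Sum>b\<in>Basis. norm x * N b)"
    by (intro sum_mono) (auto simp: N_scaleR Basis_le_norm intro!: mult_right_mono)
  also have "\<dots> \<le> ?K * norm x"
    by (simp add: sum_distrib_left algebra_simps)
  finally show "N x \<le> ?K * norm x" .
qed

lemma continuous_on_N [continuous_intros]: "continuous_on A N"
proof -
  obtain K where K: "K > 0" "\<And>x. N x \<le> K * norm x"
    using N_le_norm by blast
  have "\<bar>N x - N y\<bar> \<le> K * dist x y" for x y
    using N_triangle_diff[of x y] N_triangle_diff[of y x] K(2)[of "x - y"] N_minus[of "x - y"]
    by (simp add: dist_norm)
  then have "K-lipschitz_on A N"
    using K(1) by (intro lipschitz_onI) (auto simp: dist_real_def)
  then show ?thesis
    by (rule lipschitz_on_continuous_on)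
qed

lemma borel_measurable_N [measurable]: "N \<in> borel_measurable borel"
  by (intro borel_measurable_continuous_onI continuous_on_N)

text \<open>The constant is the minimum of \<open>N\<close> on the Euclidean unit sphere. With the
  opposite comparison above, it transfers compactness and neighbourhoods of 0 from the Euclidean
  norm to \<open>N\<close>.\<close>

lemma norm_le_N: obtains m where "m > 0" "\<And>x. m * norm x \<le> N x"
proof -
  have "sphere (0::real ^ 'd) 1 \<noteq> {}"
    by simp
  then obtain z where z: "z \<in> sphere 0 1" "\<And>y. y \<in> sphere 0 1 \<Longrightarrow> N z \<le> N y"
    using continuous_attains_inf[OF compact_sphere, of 0 1 N] continuous_on_N by blast
  show ?thesis
  proof
    show "N z > 0"
      using z(1) by (auto simp: N_pos_iff)
    fix x
    show "N z * norm x \<le> N x"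
    proof (cases "x = 0")
      case False
      then have "N z \<le> N (inverse (norm x) *\<^sub>R x)"
        by (intro z(2)) simp
      then show ?thesis
        using False by (simp add: N_scaleR field_simps)
    qed simp
  qed
qed

lemma compact_N_le: "compact {x. N x \<le> R}"
proof -
  obtain m where m: "m > 0" "\<And>x. m * norm x \<le> N x"
    using norm_le_N by blast
  have "bounded {x. N x \<le> R}"
    unfolding bounded_iff using m
    by (intro exI[of _ "R / m"]) (auto simp: field_simps intro: order_trans)
  moreover have "closed {x. N x \<le> R}"
    by (intro closed_Collect_le continuous_intros)
  ultimately show ?thesis
    by (simp add: compact_eq_bounded_closed)
qed

lemma nhds_0_N_ball:
  assumes "open U" "0 \<in> U"
  obtains r where "r > 0" "{x. N x < r} \<subseteq> U"
proof -
  obtain e where e: "e > 0" "ball 0 e \<subseteq> U"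
    using assms openE by blast
  obtain m where m: "m > 0" "\<And>x. m * norm x \<le> N x"
    using norm_le_N by blast
  show ?thesis
  proof
    show "m * e > 0" using m e by simp
    have "norm x < e" if "N x < m * e" for x
      using that m(1) m(2)[of x] by (smt (verit) mult_less_cancel_left_pos)
    then show "{x. N x < m * e} \<subseteq> U"
      using e(2) by auto
  qed
qed

text \<open>A supremum of reals bounds the elements of the set only if the set is bounded above;
  this makes \<open>op_norm\<close> usable.\<close>

lemma bdd_above_matrix_image:
  fixes A :: "real ^ 'd ^ 'd"
  shows "bdd_above ((\<lambda>z. N (A *v z)) ` {z. N z = 1})"
proof -
  obtain K where K: "K > 0" "\<And>x. N x \<le> K * norm x"
    using N_le_norm by blast
  obtain m where m: "m > 0" "\<And>x. m * norm x \<le> N x"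
    using norm_le_N by blast
  show ?thesis
  proof (rule bdd_aboveI2)
    fix z assume z: "z \<in> {z. N z = 1}"
    have "norm (A *v z) \<le> onorm ((*v) A) * norm z"
      by (rule onorm) (rule matrix_vector_mul_bounded_linear)
    also have "\<dots> \<le> onorm ((*v) A) * (1 / m)"
      using m(1) m(2)[of z] z
      by (intro mult_left_mono onorm_pos_le matrix_vector_mul_bounded_linear) (simp add: field_simps)
    finally show "N (A *v z) \<le> K * (onorm ((*v) A) * (1 / m))"
      using K by (meson mult_left_mono order_less_imp_le order_trans)
  qed
qed

lemma N_normalise: "x \<noteq> 0 \<Longrightarrow> N (inverse (N x) *\<^sub>R x) = 1"
  by (simp add: N_scaleR)

lemma N_matrix_le: "N (A *v x) \<le> op_norm N A * N x"
proof (cases "x = 0")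
  case False
  have "N (A *v (inverse (N x) *\<^sub>R x)) \<le> op_norm N A"
    unfolding op_norm_def using N_normalise[OF False] by (intro cSUP_upper bdd_above_matrix_image) simp
  then have "inverse (N x) * N (A *v x) \<le> op_norm N A"
    by (simp add: N_scaleR matrix_vector_mult_scaleR)
  moreover have "N x > 0"
    using False by (simp add: N_pos_iff)
  ultimately show ?thesis
    by (simp add: field_simps)
qed simp

lemma N_matrix_ge: "min_stretch N A * N x \<le> N (A *v x)"
proof (cases "x = 0")
  case False
  have "min_stretch N A \<le> N (A *v (inverse (N x) *\<^sub>R x))"
    unfolding min_stretch_def using N_normalise[OF False]
    by (intro cINF_lower) (auto intro!: bdd_belowI2[where m = 0])
  then have "min_stretch N A \<le> inverse (N x) * N (A *v x)"
    by (simp add: N_scaleR matrix_vector_mult_scaleR)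
  moreover have "N x > 0"
    using False by (simp add: N_pos_iff)
  ultimately show ?thesis
    by (simp add: field_simps)
qed simp

lemma min_stretch_nonneg: "min_stretch N A \<ge> 0"
proof -
  \<comment> \<open>An infimum over the empty set would carry no information, so a nonzero vector is
    needed to see that the unit sphere is inhabited. Any coordinate serves.\<close>
  have "axis undefined (1::real) \<noteq> (0 :: real ^ 'd)"
    by (simp add: axis_eq_0_iff)
  then show ?thesis
    unfolding min_stretch_def using N_normalise by (intro cINF_greatest) auto
qed

lemma op_norm_pos:
  assumes "invertible A"
  shows "op_norm N A > 0"
proof -
  have "axis undefined (1::real) \<noteq> (0 :: real ^ 'd)"
    by (simp add: axis_eq_0_iff)
  moreover from this have "A *v axis undefined 1 \<noteq> 0"
    using assms by (metis invertible_def matrix_vector_mul_assoc matrix_vector_mul_lid matrix_vector_mult_0_right)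
  ultimately show ?thesis
    using N_matrix_le[of A "axis undefined 1"] N_pos_iff by (smt (verit) mult_nonneg_nonneg mult_nonpos_nonneg)
qed

end

section \<open>Tail measures on Euclidean space\<close>

text \<open>Countable sums are needed for the two halves of the Neumann series. Finite sums are
  obtained from the same construction by padding with null measures.\<close>

definition series_measure :: "(nat \<Rightarrow> 'a measure) \<Rightarrow> 'a measure" where
  "series_measure \<nu> = measure_of (space (\<nu> 0)) (sets (\<nu> 0)) (\<lambda>A. \<Sum>n. emeasure (\<nu> n) A)"

lemma sets_series_measure [simp]: "sets (series_measure \<nu>) = sets (\<nu> 0)"
  by (simp add: series_measure_def)

lemma emeasure_series_measure:
  assumes sets: "\<And>n. sets (\<nu> n) = sets (\<nu> 0)" and A: "A \<in> sets (\<nu> 0)"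
  shows "emeasure (series_measure \<nu>) A = (\<Sum>n. emeasure (\<nu> n) A)"
  unfolding series_measure_def
proof (rule emeasure_measure_of_sigma[OF sets.sigma_algebra_axioms _ _ A])
  show "positive (sets (\<nu> 0)) (\<lambda>A. \<Sum>n. emeasure (\<nu> n) A)"
    by (simp add: positive_def)
  show "countably_additive (sets (\<nu> 0)) (\<lambda>A. \<Sum>n. emeasure (\<nu> n) A)"
  proof (rule countably_additiveI)
    fix A :: "nat \<Rightarrow> 'a set"
    assume A: "range A \<subseteq> sets (\<nu> 0)" "disjoint_family A"
    \<comment> \<open>Exchanging the two nonnegative series is Tonelli's theorem; one of them is
      written as an integral over the counting measure so that monotone convergence does it.\<close>
    have "(\<Sum>i. \<Sum>n. emeasure (\<nu> n) (A i)) = (\<Sum>i. \<integral>\<^sup>+n. emeasure (\<nu> n) (A i) \<partial>count_space UNIV)"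
      by (simp add: nn_integral_count_space_nat)
    also have "\<dots> = (\<integral>\<^sup>+n. (\<Sum>i. emeasure (\<nu> n) (A i)) \<partial>count_space UNIV)"
      by (intro nn_integral_suminf[symmetric]) simp
    also have "\<dots> = (\<integral>\<^sup>+n. emeasure (\<nu> n) (\<Union>i. A i) \<partial>count_space UNIV)"
      using A sets by (intro nn_integral_cong suminf_emeasure) auto
    finally show "(\<Sum>i. \<Sum>n. emeasure (\<nu> n) (A i)) = (\<Sum>n. emeasure (\<nu> n) (\<Union>i. A i))"
      by (simp add: nn_integral_count_space_nat)
  qed
qed

lemma nn_integral_series_measure:
  assumes sets: "\<And>n. sets (\<nu> n) = sets (\<nu> 0)" and f: "f \<in> borel_measurable (\<nu> 0)"
  shows "(\<integral>\<^sup>+x. f x \<partial>series_measure \<nu>) = (\<Sum>n. \<integral>\<^sup>+x. f x \<partial>\<nu> n)"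
proof -
  have meas: "h \<in> borel_measurable (\<nu> n)" and meas_series: "h \<in> borel_measurable (series_measure \<nu>)"
    if "h \<in> borel_measurable (\<nu> 0)" for h :: "'a \<Rightarrow> ennreal" and n
    using that
    by (subst measurable_cong_sets[OF sets[of n] refl] measurable_cong_sets[OF sets_series_measure[of \<nu>] refl], assumption)+
  have space: "space (\<nu> n) = space (\<nu> 0)" "space (series_measure \<nu>) = space (\<nu> 0)" for n
    by (rule sets_eq_imp_space_eq[OF sets], rule sets_eq_imp_space_eq[OF sets_series_measure])
  show ?thesis
    using f
  proof induct
    case (cong f g)
    have eq: "integral\<^sup>N M f = integral\<^sup>N M g" if "space M = space (\<nu> 0)" for M
      using cong(3) that by (intro nn_integral_cong) simp
    then show ?case
      using cong(4) eq[OF space(2)] eq[OF space(1)] by simp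
  next
    case (set A)
    then have "A \<in> sets (\<nu> n)" for n
      using sets[of n] by simp
    then show ?case
      using emeasure_series_measure[of \<nu> A, OF sets] set by simp
  next
    case (mult u c)
    have "(\<integral>\<^sup>+x. c * u x \<partial>\<nu> n) = c * integral\<^sup>N (\<nu> n) u" for n
      by (rule nn_integral_cmult[OF meas[OF mult(2)]])
    then show ?case
      using mult(4) by (simp add: nn_integral_cmult[OF meas_series[OF mult(2)]])
  next
    case (add u v)
    have "(\<integral>\<^sup>+x. v x + u x \<partial>\<nu> n) = integral\<^sup>N (\<nu> n) v + integral\<^sup>N (\<nu> n) u" for n
      by (rule nn_integral_add[OF meas[OF add(4)] meas[OF add(1)]])
    then show ?case
      using add(3,7) by (simp add: nn_integral_add[OF meas_series[OF add(4)] meas_series[OF add(1)]] suminf_add)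
  next
    case (seq U)
    have "(\<integral>\<^sup>+x. (SUP i. U i x) \<partial>series_measure \<nu>) = (SUP i. \<integral>\<^sup>+x. U i x \<partial>series_measure \<nu>)"
      by (intro nn_integral_monotone_convergence_SUP seq(4) meas_series[OF seq(1)])
    also have "\<dots> = (SUP i. \<Sum>n. \<integral>\<^sup>+x. U i x \<partial>\<nu> n)"
      by (simp only: seq(3))
    also have "\<dots> = (\<Sum>n. SUP i. \<integral>\<^sup>+x. U i x \<partial>\<nu> n)"
      by (intro ennreal_suminf_SUP_eq[symmetric] incseq_nn_integral seq(4))
    also have "\<dots> = (\<Sum>n. \<integral>\<^sup>+x. (SUP i. U i x) \<partial>\<nu> n)"
      by (intro suminf_cong nn_integral_monotone_convergence_SUP[symmetric] seq(4) meas[OF seq(1)])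
    finally show ?case
      by (simp add: image_comp)
  qed
qed

text \<open>An additive identity for nonnegative integrals passes to real integrals through positive
  and negative parts, all of whose integrals are finite by integrability. The shape covers both
  uses: the recursion between the two halves of the Neumann series, with \<open>g\<close> the matrix
  action, and the splitting off of a difference measure, with a one-element index set.\<close>

lemma integral_eq_integral_plus_sum:
  fixes f :: "'a \<Rightarrow> real"
  assumes "finite I" and "integrable \<nu> f" "integrable \<mu> f" "\<And>i. i \<in> I \<Longrightarrow> integrable \<kappa> (\<lambda>x. f (g i x))"
    and "\<And>h. h \<in> {\<lambda>x. ennreal (f x), \<lambda>x. ennreal (- f x)} \<Longrightarrow>
      (\<integral>\<^sup>+x. h x \<partial>\<nu>) = (\<integral>\<^sup>+x. h x \<partial>\<mu>) + (\<Sum>i\<in>I. \<integral>\<^sup>+x. h (g i x) \<partial>\<kappa>)"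
  shows "(\<integral>x. f x \<partial>\<nu>) = (\<integral>x. f x \<partial>\<mu>) + (\<Sum>i\<in>I. \<integral>x. f (g i x) \<partial>\<kappa>)"
proof -
  have "enn2real (\<integral>\<^sup>+x. h x \<partial>\<nu>) = enn2real (\<integral>\<^sup>+x. h x \<partial>\<mu>) + (\<Sum>i\<in>I. enn2real (\<integral>\<^sup>+x. h (g i x) \<partial>\<kappa>))"
    if h: "h \<in> {\<lambda>x. ennreal (f x), \<lambda>x. ennreal (- f x)}" for h
  proof -
    have fin_\<mu>: "(\<integral>\<^sup>+x. h x \<partial>\<mu>) < top"
      using h assms(3) unfolding real_integrable_def less_top[symmetric] by auto
    have fin: "(\<integral>\<^sup>+x. h (g i x) \<partial>\<kappa>) < top" if "i \<in> I" for i
      using h assms(4)[OF that] unfolding real_integrable_def less_top[symmetric] by auto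
    then have "(\<Sum>i\<in>I. \<integral>\<^sup>+x. h (g i x) \<partial>\<kappa>) < top"
      using assms(1) by simp
    then show ?thesis
      unfolding assms(5)[OF h] using fin_\<mu> fin by (simp only: enn2real_plus enn2real_sum o_def)
  qed
  from this[of "\<lambda>x. ennreal (f x)"] this[of "\<lambda>x. ennreal (- f x)"] show ?thesis
    by (simp add: real_lebesgue_integral_def[OF assms(2)] real_lebesgue_integral_def[OF assms(3)]
        real_lebesgue_integral_def[OF assms(4)] sum_subtractf)
qed

section \<open>Homogeneous measures and test functions on finite points\<close>

context vector_norm
begin

text \<open>The Euclidean counterpart of a tail measure. The origin is kept in the space and made a
  null set, so that the Borel sets of the whole space can be used. Scaling is expressed by
  preimages, whence the exponent \<open>\<alpha>\<close> rather than \<open>- \<alpha>\<close>.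
  Finiteness is required at radius 1 only; homogeneity gives it at every positive radius.\<close>

definition tail_measure :: "real \<Rightarrow> (real ^ 'd) measure \<Rightarrow> bool" where
  "tail_measure \<alpha> \<nu> \<longleftrightarrow> sets \<nu> = sets borel \<and> emeasure \<nu> {0} = 0 \<and> emeasure \<nu> {x. 1 \<le> N x} < \<infinity> \<and>
     (\<forall>t>0. \<forall>A\<in>sets borel. emeasure \<nu> ((\<lambda>x. t *\<^sub>R x) -` A) = ennreal (t powr \<alpha>) * emeasure \<nu> A)"

lemma tail_measureD:
  assumes "tail_measure \<alpha> \<nu>"
  shows "sets \<nu> = sets borel" "emeasure \<nu> {0} = 0" "emeasure \<nu> {x. 1 \<le> N x} < \<infinity>"
    "\<And>t A. t > 0 \<Longrightarrow> A \<in> sets borel \<Longrightarrow> emeasure \<nu> ((\<lambda>x. t *\<^sub>R x) -` A) = ennreal (t powr \<alpha>) * emeasure \<nu> A"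
    "space \<nu> = UNIV"
  using assms sets_eq_imp_space_eq[of \<nu> borel] by (auto simp: tail_measure_def)

lemma sets_tail [measurable]: "{x. r \<le> N x} \<in> sets borel" "{x. r < N x} \<in> sets borel"
  by measurable

lemma emeasure_tail:
  assumes "tail_measure \<alpha> \<nu>" "r > 0"
  shows "emeasure \<nu> {x. r \<le> N x} = ennreal (r powr - \<alpha>) * emeasure \<nu> {x. 1 \<le> N x}"
proof -
  have "{x. r \<le> N x} = (\<lambda>x. (1 / r) *\<^sub>R x) -` {x. 1 \<le> N x}"
    using assms(2) by (auto simp: N_scaleR field_simps)
  moreover have "(1 / r) powr \<alpha> = r powr - \<alpha>"
    using assms(2) by (simp add: powr_divide powr_minus_divide)
  ultimately show ?thesis
    using tail_measureD(4)[OF assms(1), of "1 / r" "{x. 1 \<le> N x}"] assms(2) by simp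
qed

lemma emeasure_tail_finite:
  assumes "tail_measure \<alpha> \<nu>" "r > 0"
  shows "emeasure \<nu> {x. r \<le> N x} < \<infinity>"
  using emeasure_tail[OF assms] tail_measureD(3)[OF assms(1)] by (simp add: ennreal_mult_less_top)

lemma emeasure_away_from_0_finite:
  assumes "tail_measure \<alpha> \<nu>" "r > 0" "A \<subseteq> {x. r \<le> N x}"
  shows "emeasure \<nu> A < \<infinity>"
  using emeasure_mono[OF assms(3), of \<nu>] emeasure_tail_finite[OF assms(1,2)] tail_measureD(1)[OF assms(1)]
    sets_tail(1)[of r] by (auto simp: order_le_less_trans)

text \<open>Continuity from below along \<open>{x. 1 / Suc n \<le> N x}\<close>, which exhausts
  everything but the null point 0. It reduces questions about measures of infinite total mass to
  sets of finite mass.\<close>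

lemma emeasure_SUP_away_from_0:
  assumes "sets \<nu> = sets borel" "emeasure \<nu> {0} = 0" "A \<in> sets borel"
  shows "emeasure \<nu> A = (SUP n. emeasure \<nu> (A \<inter> {x. 1 / Suc n \<le> N x}))"
proof -
  have "(SUP n. emeasure \<nu> (A \<inter> {x. 1 / Suc n \<le> N x})) = emeasure \<nu> (\<Union>n. A \<inter> {x. 1 / Suc n \<le> N x})"
  proof (rule SUP_emeasure_incseq)
    show "range (\<lambda>n. A \<inter> {x. 1 / Suc n \<le> N x}) \<subseteq> sets \<nu>"
      unfolding assms(1) by (intro image_subsetI sets.Int assms(3) sets_tail(1))
    show "incseq (\<lambda>n. A \<inter> {x. 1 / Suc n \<le> N x})"
    proof (rule incseq_SucI, safe)
      fix n x assume "1 / real (Suc n) \<le> N x"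
      moreover have "1 / real (Suc (Suc n)) \<le> 1 / real (Suc n)"
        by (intro divide_left_mono) auto
      ultimately show "1 / real (Suc (Suc n)) \<le> N x"
        by linarith
    qed
  qed
  also have "(\<Union>n. A \<inter> {x. 1 / Suc n \<le> N x}) = A - {0}"
  proof -
    have "\<exists>n. 1 / Suc n \<le> N x" if "x \<noteq> 0" for x
      using that N_pos_iff[of x] nat_approx_posE[of "N x"] less_imp_le by blast
    then show ?thesis by (force simp: not_le)
  qed
  also have "emeasure \<nu> (A - {0}) = emeasure \<nu> A"
    using assms by (intro emeasure_Diff_null_set) auto
  finally show ?thesis ..
qed

text \<open>On the sets tested here tail measures are finite, so equalities can be obtained by
  cancelling.\<close>

lemma measure_eqI_away_from_0:
  assumes "sets \<mu> = sets borel" "emeasure \<mu> {0} = 0" "sets \<nu> = sets borel" "emeasure \<nu> {0} = 0"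
    and "\<And>A r. A \<in> sets borel \<Longrightarrow> r > 0 \<Longrightarrow> A \<subseteq> {x. r \<le> N x} \<Longrightarrow> emeasure \<mu> A = emeasure \<nu> A"
  shows "\<mu> = \<nu>"
proof (rule measure_eqI)
  fix A assume "A \<in> sets \<mu>"
  then have A: "A \<in> sets borel" using assms by simp
  then have "emeasure \<mu> (A \<inter> {x. 1 / Suc n \<le> N x}) = emeasure \<nu> (A \<inter> {x. 1 / Suc n \<le> N x})" for n
    using sets_tail by (intro assms(5)[of _ "1 / Suc n"]) auto
  then show "emeasure \<mu> A = emeasure \<nu> A"
    using emeasure_SUP_away_from_0[of _ A] assms(1-4) A by simp
qed (use assms in simp)

text \<open>A continuous function with compact support in the space without the origin.
  \<open>B\<close> and \<open>\<delta>\<close> are recorded because the whole contraction argument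
  is run with the quantity \<open>B * \<delta> powr - \<alpha>\<close>. The bounded support lets the
  function be extended by 0 to the infinite points.\<close>

definition test_function :: "real \<Rightarrow> real \<Rightarrow> (real ^ 'd \<Rightarrow> real) \<Rightarrow> bool" where
  "test_function B \<delta> f \<longleftrightarrow> continuous_on UNIV f \<and> (\<forall>x. \<bar>f x\<bar> \<le> B) \<and> \<delta> > 0 \<and> (\<forall>x. N x < \<delta> \<longrightarrow> f x = 0) \<and>
     (\<exists>R. \<forall>x. N x > R \<longrightarrow> f x = 0)"

lemma test_functionD:
  assumes "test_function B \<delta> f"
  shows "f \<in> borel_measurable borel" "\<bar>f x\<bar> \<le> B" "\<delta> > 0" "N x < \<delta> \<Longrightarrow> f x = 0" "B \<ge> 0"
proof -
  show "f \<in> borel_measurable borel"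
    using assms by (auto simp: test_function_def borel_measurable_continuous_onI)
  show "B \<ge> 0"
    using assms abs_ge_zero[of "f 0"] unfolding test_function_def by (metis order_trans)
qed (use assms in \<open>auto simp: test_function_def\<close>)

text \<open>Domination by \<open>B\<close> times the indicator of the complement of the ball of
  radius \<open>\<delta>\<close>. It is stated for functions of arbitrary support, since it is also
  applied to the part of a function lying near infinity.\<close>

lemma
  assumes "tail_measure \<alpha> \<nu>" "f \<in> borel_measurable borel" "\<And>x. \<bar>f x\<bar> \<le> B" "\<delta> > 0" "\<And>x. N x < \<delta> \<Longrightarrow> f x = 0"
  shows integrable_away_from_0: "integrable \<nu> f"
    and integral_away_from_0_le: "\<bar>\<integral>x. f x \<partial>\<nu>\<bar> \<le> B * measure \<nu> {x. \<delta> \<le> N x}"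
proof -
  have meas: "f \<in> borel_measurable \<nu>" "{x. \<delta> \<le> N x} \<in> sets \<nu>"
    using assms(2) tail_measureD(1)[OF assms(1)] sets_tail by (auto cong: measurable_cong_sets)
  have le: "norm (f x) \<le> B * indicator {x. \<delta> \<le> N x} x" for x
    using assms(3)[of x] assms(5)[of x] by (auto simp: indicator_def)
  have int: "integrable \<nu> (\<lambda>x. B * indicator {x. \<delta> \<le> N x} x)"
    using emeasure_tail_finite[OF assms(1,4)] meas by (intro integrable_mult_right integrable_real_indicator) auto
  show "integrable \<nu> f"
    by (rule Bochner_Integration.integrable_bound[OF int meas(1)]) (rule AE_I2, rule order_trans[OF le], simp)
  then have "\<bar>\<integral>x. f x \<partial>\<nu>\<bar> \<le> (\<integral>x. B * indicator {x. \<delta> \<le> N x} x \<partial>\<nu>)"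
    using le int by (intro order_trans[OF integral_abs_bound] integral_mono) auto
  also have "\<dots> = B * measure \<nu> {x. \<delta> \<le> N x}"
    using meas by (simp add: tail_measureD(5)[OF assms(1)])
  finally show "\<bar>\<integral>x. f x \<partial>\<nu>\<bar> \<le> B * measure \<nu> {x. \<delta> \<le> N x}" .
qed

lemma measure_tail:
  assumes "tail_measure \<alpha> \<nu>" "r > 0"
  shows "measure \<nu> {x. r \<le> N x} = r powr - \<alpha> * measure \<nu> {x. 1 \<le> N x}"
  using emeasure_tail[OF assms] by (simp add: measure_def enn2real_mult)

end

section \<open>Comparison and difference of tail measures\<close>

context vector_norm
begin

lemma test_function_integrable:
  assumes "tail_measure \<alpha> \<nu>" "test_function B \<delta> f"
  shows "integrable \<nu> f" "\<bar>\<integral>x. f x \<partial>\<nu>\<bar> \<le> B * \<delta> powr - \<alpha> * measure \<nu> {x. 1 \<le> N x}"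
proof -
  note f = test_functionD[OF assms(2)]
  show "integrable \<nu> f"
    by (rule integrable_away_from_0[OF assms(1) f(1,2,3,4)])
  have "\<bar>\<integral>x. f x \<partial>\<nu>\<bar> \<le> B * measure \<nu> {x. \<delta> \<le> N x}"
    by (rule integral_away_from_0_le[OF assms(1) f(1,2,3,4)])
  then show "\<bar>\<integral>x. f x \<partial>\<nu>\<bar> \<le> B * \<delta> powr - \<alpha> * measure \<nu> {x. 1 \<le> N x}"
    by (simp add: measure_tail[OF assms(1) f(3)])
qed

text \<open>The indicator of \<open>C\<close> is the pointwise limit from above of test functions
  decaying with the distance to \<open>C\<close>. They vanish on a common ball around 0, so
  dominated convergence applies to both measures.\<close>

lemma compact_le_of_test_functions:
  assumes \<mu>: "tail_measure \<alpha> \<mu>" and \<nu>: "tail_measure \<alpha> \<nu>"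
    and le: "\<And>B \<delta> f. test_function B \<delta> f \<Longrightarrow> (\<And>x. 0 \<le> f x) \<Longrightarrow> (\<integral>x. f x \<partial>\<mu>) \<le> (\<integral>x. f x \<partial>\<nu>)"
    and C: "compact C" "r > 0" "C \<subseteq> {x. r \<le> N x}"
  shows "measure \<mu> C \<le> measure \<nu> C"
proof (cases "C = {}")
  case False
  obtain K where K: "K > 0" "\<And>x. N x \<le> K * norm x"
    using N_le_norm by blast
  \<comment> \<open>The factor \<open>2 * K / r\<close> makes \<open>f n\<close> vanish at Euclidean
    distance at least \<open>r / (2 * K)\<close> from \<open>C\<close>, so its support lies within
    \<open>N\<close>-distance \<open>r / 2\<close> of \<open>C\<close>. As \<open>N\<close> is at
    least \<open>r\<close> on \<open>C\<close>, every \<open>f n\<close> vanishes on the ball of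
    radius \<open>r / 2\<close>.\<close>
  define f where "f n x = max 0 (1 - real (Suc n) * (2 * K / r) * infdist x C)" for n x
  have closed: "closed C" using C(1) by (rule compact_imp_closed)
  have f_cont: "continuous_on UNIV (f n)" for n
    unfolding f_def by (intro continuous_intros)
  have f_nonneg: "0 \<le> f n x" and f_le: "f n x \<le> 1" for n x
    using K C(2) by (auto simp: f_def infdist_nonneg)
  have near: "infdist x C < r / (2 * K)" if "f n x \<noteq> 0" for n x
  proof (rule ccontr)
    assume "\<not> infdist x C < r / (2 * K)"
    then have "1 \<le> 2 * K / r * infdist x C"
      using K C(2) by (simp add: field_simps)
    also have "\<dots> \<le> real (Suc n) * (2 * K / r * infdist x C)"
      using mult_right_mono[of 1 "real (Suc n)" "2 * K / r * infdist x C"] K(1) C(2) by (simp add: infdist_nonneg)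
    finally show False
      using that by (simp add: f_def mult.assoc)
  qed
  have close: "\<exists>y\<in>C. N (x - y) < r / 2" if "f n x \<noteq> 0" for n x
  proof -
    obtain y where y: "y \<in> C" "infdist x C = dist x y"
      using infdist_attains_inf[OF closed False] by blast
    have "N (x - y) \<le> K * dist x y"
      using K(2)[of "x - y"] by (simp add: dist_norm)
    also have "\<dots> < K * (r / (2 * K))"
      using near[OF that] K(1) y(2) by (intro mult_strict_left_mono) auto
    finally show ?thesis
      using y(1) K(1) by (intro bexI[of _ y]) auto
  qed
  obtain R where R: "\<And>y. y \<in> C \<Longrightarrow> N y \<le> R"
  proof -
    have "bounded (N ` C)"
      using C(1) by (intro compact_imp_bounded compact_continuous_image continuous_on_N)
    then show ?thesis
      using that by (auto simp: bounded_iff)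
  qed
  have f_zero: "f n x = 0" if "N x < r / 2" for n x
  proof (rule ccontr)
    assume "f n x \<noteq> 0"
    then obtain y where y: "y \<in> C" "N (x - y) < r / 2" using close by blast
    moreover have "N y \<le> N x + N (x - y)"
      using N_triangle_diff[of y x] N_minus[of "x - y"] by simp
    ultimately show False using C(3) that by fastforce
  qed
  have "f n x = 0" if "N x > R + r / 2" for n x
  proof (rule ccontr)
    assume "f n x \<noteq> 0"
    then obtain y where y: "y \<in> C" "N (x - y) < r / 2" using close by blast
    then show False using N_triangle_diff[of x y] R[OF y(1)] that by simp
  qed
  then have test: "test_function 1 (r / 2) (f n)" for n
    unfolding test_function_def using f_cont f_nonneg f_le f_zero C(2) by (auto simp: abs_le_iff intro: order_trans)
  have lim: "(\<lambda>n. f n x) \<longlonglongrightarrow> indicator C x" for x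
  proof (cases "x \<in> C")
    case True
    then show ?thesis by (simp add: f_def)
  next
    case False
    then have pos: "2 * K / r * infdist x C > 0"
      using K C(2) infdist_pos_not_in_closed[OF closed \<open>C \<noteq> {}\<close> False] by simp
    obtain n0 where n0: "1 < real n0 * (2 * K / r * infdist x C)"
      using reals_Archimedean3[OF pos] by blast
    have "f n x = 0" if "n \<ge> n0" for n
    proof -
      have "real n0 * (2 * K / r * infdist x C) \<le> real (Suc n) * (2 * K / r * infdist x C)"
        using that pos by (intro mult_right_mono) auto
      then show ?thesis using n0 by (simp add: f_def mult.assoc)
    qed
    then have "eventually (\<lambda>n. f n x = indicator C x) sequentially"
      using False by (auto simp: eventually_sequentially)
    then show ?thesis by (rule tendsto_eventually)
  qed
  have conv: "(\<lambda>n. \<integral>x. f n x \<partial>\<kappa>) \<longlonglongrightarrow> measure \<kappa> C" if \<kappa>: "tail_measure \<alpha> \<kappa>" for \<kappa>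
  proof -
    have sets: "C \<in> sets \<kappa>" "{x. r / 2 \<le> N x} \<in> sets \<kappa>"
      using tail_measureD(1)[OF \<kappa>] closed by auto
    have "(\<lambda>n. \<integral>x. f n x \<partial>\<kappa>) \<longlonglongrightarrow> (\<integral>x. indicator C x \<partial>\<kappa>)"
    proof (rule integral_dominated_convergence[where w = "indicator {x. r / 2 \<le> N x}"])
      show "integrable \<kappa> (indicator {x. r / 2 \<le> N x} :: _ \<Rightarrow> real)"
        using emeasure_tail_finite[OF \<kappa>, of "r / 2"] C(2) sets by (intro integrable_real_indicator) auto
      show "f n \<in> borel_measurable \<kappa>" for n
        using test_function_integrable(1)[OF \<kappa> test] by (rule borel_measurable_integrable)
      show "AE x in \<kappa>. norm (f n x) \<le> indicator {x. r / 2 \<le> N x} x" for n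
        using f_nonneg f_le f_zero by (auto simp: indicator_def not_le)
    qed (use sets lim in auto)
    then show ?thesis using sets by (simp add: tail_measureD(5)[OF \<kappa>])
  qed
  show ?thesis
    by (rule LIMSEQ_le[OF conv[OF \<mu>] conv[OF \<nu>]]) (use le[OF test f_nonneg] in blast)
qed simp

text \<open>Inner regularity reduces a Borel set bounded away from 0 to its compact subsets, where
  test functions decide; sets reaching 0 are exhausted from outside the origin.\<close>

lemma emeasure_le_of_test_functions:
  assumes \<mu>: "tail_measure \<alpha> \<mu>" and \<nu>: "tail_measure \<alpha> \<nu>"
    and le: "\<And>B \<delta> f. test_function B \<delta> f \<Longrightarrow> (\<And>x. 0 \<le> f x) \<Longrightarrow> (\<integral>x. f x \<partial>\<mu>) \<le> (\<integral>x. f x \<partial>\<nu>)"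
    and A: "A \<in> sets borel"
  shows "emeasure \<mu> A \<le> emeasure \<nu> A"
proof -
  have away: "emeasure \<mu> D \<le> emeasure \<nu> D" if D: "D \<in> sets borel" "r > 0" "D \<subseteq> {x. r \<le> N x}" for D r
  proof -
    let ?S = "{x. r \<le> N x}"
    \<comment> \<open>Inner regularity is applied to finite measures, so \<open>\<mu>\<close> is
      first cut off near the origin.\<close>
    define \<mu>' where "\<mu>' = density \<mu> (indicator ?S)"
    have S: "?S \<in> sets \<mu>" using tail_measureD(1)[OF \<mu>] by simp
    have \<mu>': "emeasure \<mu>' B = emeasure \<mu> (?S \<inter> B)" if "B \<in> sets borel" for B
      using emeasure_restricted[OF S, of B] that tail_measureD(1)[OF \<mu>] by (simp add: \<mu>'_def)
    have "emeasure \<mu>' D = (SUP K\<in>{K. K \<subseteq> D \<and> compact K}. emeasure \<mu>' K)"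
    proof (rule inner_regular)
      show sets: "sets \<mu>' = sets borel"
        using tail_measureD(1)[OF \<mu>] by (simp add: \<mu>'_def)
      show "emeasure \<mu>' (space \<mu>') \<noteq> \<infinity>"
        using \<mu>'[of UNIV] emeasure_tail_finite[OF \<mu> D(2)] sets_eq_imp_space_eq[OF sets] by simp
    qed (rule D)
    also have "\<dots> \<le> emeasure \<nu> D"
    proof (rule SUP_least)
      fix K assume "K \<in> {K. K \<subseteq> D \<and> compact K}"
      then have K: "K \<subseteq> D" "compact K" by auto
      then have "K \<subseteq> ?S" using D(3) by blast
      then have "emeasure \<mu>' K = emeasure \<mu> K"
        using \<mu>'[of K] K(2) by (simp add: borel_compact Int_absorb1)
      also have "\<dots> \<le> emeasure \<nu> K"
      proof -
        have "measure \<mu> K \<le> measure \<nu> K"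
          by (rule compact_le_of_test_functions[OF \<mu> \<nu> le K(2) D(2) \<open>K \<subseteq> ?S\<close>])
        moreover have "emeasure \<mu> K \<noteq> top" "emeasure \<nu> K \<noteq> top"
          using emeasure_away_from_0_finite[OF \<mu> D(2) \<open>K \<subseteq> ?S\<close>] emeasure_away_from_0_finite[OF \<nu> D(2) \<open>K \<subseteq> ?S\<close>]
          by auto
        ultimately show ?thesis
          by (simp add: emeasure_eq_ennreal_measure ennreal_leI)
      qed
      also have "\<dots> \<le> emeasure \<nu> D"
        using K(1) D(1) tail_measureD(1)[OF \<nu>] by (intro emeasure_mono) auto
      finally show "emeasure \<mu>' K \<le> emeasure \<nu> D" .
    qed
    finally show ?thesis
      using \<mu>'[OF D(1)] D(3) by (simp add: Int_absorb1)
  qed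
  have "emeasure \<mu> (A \<inter> {x. 1 / Suc n \<le> N x}) \<le> emeasure \<nu> (A \<inter> {x. 1 / Suc n \<le> N x})" for n
    by (rule away[of _ "1 / Suc n"]) (use A sets_tail(1) in auto)
  then show ?thesis
    unfolding emeasure_SUP_away_from_0[OF tail_measureD(1,2)[OF \<mu>] A] emeasure_SUP_away_from_0[OF tail_measureD(1,2)[OF \<nu>] A]
    by (intro SUP_mono) blast
qed

lemma sigma_finite_tail_measure:
  assumes "tail_measure \<alpha> \<nu>"
  shows "sigma_finite_measure \<nu>"
proof
  note \<nu> = tail_measureD[OF assms]
  let ?A = "insert {0} (range (\<lambda>n. {x. 1 / Suc n \<le> N x}))"
  have "\<exists>n. 1 / Suc n \<le> N x" if "x \<noteq> 0" for x
    using that N_pos_iff[of x] nat_approx_posE[of "N x"] less_imp_le by blast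
  then have "\<Union>?A = space \<nu>"
    using \<nu>(5) by fastforce
  moreover have "emeasure \<nu> {x. 1 / Suc n \<le> N x} \<noteq> \<infinity>" for n
    using emeasure_tail_finite[OF assms, of "1 / Suc n"] by simp
  ultimately show "\<exists>A. countable A \<and> A \<subseteq> sets \<nu> \<and> \<Union>A = space \<nu> \<and> (\<forall>a\<in>A. emeasure \<nu> a \<noteq> \<infinity>)"
    using \<nu>(1,2) sets_tail(1) by (intro exI[of _ ?A]) auto
qed

text \<open>Setwise subtraction fails where both masses are infinite. Radon-Nikodym gives a density
  \<open>h\<close> of \<open>\<mu>\<close> with respect to the sigma-finite measure
  \<open>\<nu>\<close>, and \<open>1 - h\<close> is the density of the difference.\<close>

lemma ex_difference_measure:
  assumes \<mu>: "tail_measure \<alpha> \<mu>" and \<nu>: "tail_measure \<alpha> \<nu>"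
    and le: "\<And>A. A \<in> sets borel \<Longrightarrow> emeasure \<mu> A \<le> emeasure \<nu> A"
  obtains \<kappa> where "tail_measure \<alpha> \<kappa>" "\<And>A. A \<in> sets borel \<Longrightarrow> emeasure \<nu> A = emeasure \<kappa> A + emeasure \<mu> A"
proof -
  interpret \<nu>: sigma_finite_measure \<nu>
    by (rule sigma_finite_tail_measure[OF \<nu>])
  note D\<mu> = tail_measureD[OF \<mu>] and D\<nu> = tail_measureD[OF \<nu>]
  have "absolutely_continuous \<nu> \<mu>"
    unfolding absolutely_continuous_def using le D\<nu>(1) D\<mu>(1) by (auto simp: null_sets_def) (metis le_zero_eq)
  then obtain h where h: "h \<in> borel_measurable \<nu>" "density \<nu> h = \<mu>"
    using \<nu>.Radon_Nikodym[of \<mu>] D\<mu>(1) D\<nu>(1) by auto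
  \<comment> \<open>Were \<open>h > 1\<close> on a set of positive mass bounded away from 0, that
    mass would be finite, and integrating \<open>h\<close> over the set would give strictly more
    than \<open>\<nu>\<close>, against \<open>le\<close>.\<close>
  have h_le: "AE x in \<nu>. h x \<le> 1"
  proof -
    have "{x. 1 < h x} \<in> sets borel"
      using h(1) D\<nu>(1,5) measurable_sets[OF h(1), of "{1<..}"] by (auto simp: vimage_def)
    have "emeasure \<nu> ({x. 1 < h x} \<inter> {x. 1 / Suc n \<le> N x}) = 0" for n
    proof (rule ccontr)
      let ?A = "{x. 1 < h x} \<inter> {x. 1 / Suc n \<le> N x}"
      assume ne: "emeasure \<nu> ?A \<noteq> 0"
      have A: "?A \<in> sets borel" "?A \<in> sets \<nu>" using \<open>{x. 1 < h x} \<in> sets borel\<close> sets_tail(1) D\<nu>(1) by auto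
      have fin: "emeasure \<nu> ?A < top"
        using emeasure_away_from_0_finite[OF \<nu>, of "1 / Suc n" ?A] by auto
      have "emeasure \<nu> ?A = (\<integral>\<^sup>+x. indicator ?A x \<partial>\<nu>)"
        using A by simp
      also have "\<dots> < (\<integral>\<^sup>+x. h x * indicator ?A x \<partial>\<nu>)"
      proof (rule nn_integral_less)
        show "(\<lambda>x. indicator ?A x :: ennreal) \<in> borel_measurable \<nu>" "(\<lambda>x. h x * indicator ?A x) \<in> borel_measurable \<nu>"
          using A(2) h(1) by auto
        show "(\<integral>\<^sup>+x. indicator ?A x \<partial>\<nu>) \<noteq> \<infinity>"
          using fin A by simp
        show "AE x in \<nu>. indicator ?A x \<le> h x * indicator ?A x"
          by (auto simp: indicator_def)
        show "\<not> (AE x in \<nu>. h x * indicator ?A x \<le> indicator ?A x)"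
        proof
          assume "AE x in \<nu>. h x * indicator ?A x \<le> indicator ?A x"
          then have "AE x in \<nu>. x \<notin> ?A"
            by eventually_elim (auto simp: indicator_def split: if_splits)
          then have "emeasure \<nu> ?A = 0"
            using A by (subst (asm) AE_iff_measurable[of ?A]) (auto simp: D\<nu>(5))
          then show False using ne by simp
        qed
      qed
      also have "\<dots> = emeasure \<mu> ?A"
        using emeasure_density[OF h(1) A(2)] h(2) by simp
      also have "\<dots> \<le> emeasure \<nu> ?A" by (rule le[OF A(1)])
      finally show False by simp
    qed
    then have "emeasure \<nu> {x. 1 < h x} = 0"
      using emeasure_SUP_away_from_0[OF D\<nu>(1,2) \<open>{x. 1 < h x} \<in> sets borel\<close>] by simp
    then show ?thesis
      using \<open>{x. 1 < h x} \<in> sets borel\<close> D\<nu>(1,5) by (intro AE_I[of _ _ "{x. 1 < h x}"]) (auto simp: not_le)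
  qed
  \<comment> \<open>Subtraction in \<open>ennreal\<close> truncates at 0; \<open>h_le\<close>
    guarantees that \<open>1 - h x\<close> and \<open>h x\<close> add up to 1 almost
    everywhere.\<close>
  define \<kappa> where "\<kappa> = density \<nu> (\<lambda>x. 1 - h x)"
  have sets_\<kappa>: "sets \<kappa> = sets borel"
    using D\<nu>(1) by (simp add: \<kappa>_def)
  have add: "emeasure \<nu> A = emeasure \<kappa> A + emeasure \<mu> A" if "A \<in> sets borel" for A
  proof -
    have A: "A \<in> sets \<nu>" using that D\<nu>(1) by simp
    have "emeasure \<kappa> A + emeasure \<mu> A = (\<integral>\<^sup>+x. (1 - h x) * indicator A x \<partial>\<nu>) + (\<integral>\<^sup>+x. h x * indicator A x \<partial>\<nu>)"
      unfolding \<kappa>_def using h A by (simp add: emeasure_density flip: h(2))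
    also have "\<dots> = (\<integral>\<^sup>+x. (1 - h x) * indicator A x + h x * indicator A x \<partial>\<nu>)"
      using h(1) A by (intro nn_integral_add[symmetric]) auto
    also have "\<dots> = (\<integral>\<^sup>+x. indicator A x \<partial>\<nu>)"
      using h_le by (intro nn_integral_cong_AE, eventually_elim) (auto simp: indicator_def diff_add_cancel_ennreal)
    finally show ?thesis using A by simp
  qed
  have fin: "emeasure \<kappa> A < top" if "A \<in> sets borel" "emeasure \<nu> A < top" for A
    using add[OF that(1)] that(2) by (simp add: less_top)
  have "tail_measure \<alpha> \<kappa>"
    unfolding tail_measure_def
  proof (intro conjI allI impI ballI)
    show "sets \<kappa> = sets borel" by (rule sets_\<kappa>)
    show zero: "emeasure \<kappa> {0} = 0" using add[of "{0}"] D\<nu>(2) by simp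
    show "emeasure \<kappa> {x. 1 \<le> N x} < \<infinity>" using fin[of "{x. 1 \<le> N x}"] D\<nu>(3) by simp
    fix t :: real and A :: "(real ^ 'd) set"
    assume t: "t > 0" and A: "A \<in> sets borel"
    let ?g = "\<lambda>x::real ^ 'd. t *\<^sub>R x"
    have g: "?g \<in> borel_measurable borel" by simp
    \<comment> \<open>Homogeneity of \<open>\<kappa>\<close> comes from that of \<open>\<nu>\<close>
      and \<open>\<mu>\<close> by cancelling the contribution of \<open>\<mu>\<close>. This is
      legitimate only where it is finite, hence the detour through an equality of measures tested
      away from 0.\<close>
    have "distr \<kappa> borel ?g = scale_measure (ennreal (t powr \<alpha>)) \<kappa>"
    proof (rule measure_eqI_away_from_0)
      have e: "emeasure (distr \<kappa> borel ?g) D = emeasure \<kappa> (?g -` D)" if "D \<in> sets borel" for D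
        using that g sets_eq_imp_space_eq[OF sets_\<kappa>] by (subst emeasure_distr) (auto cong: measurable_cong_sets simp: sets_\<kappa>)
      have "?g -` {0} = {0}" using t by auto
      then show "emeasure (distr \<kappa> borel ?g) {0} = 0" using e[of "{0}"] zero by simp
      show "emeasure (scale_measure (ennreal (t powr \<alpha>)) \<kappa>) {0} = 0" using zero by simp
      fix D r assume D: "D \<in> sets borel" "r > 0" "D \<subseteq> {x. r \<le> N x}"
      have gD: "?g -` D \<in> sets borel" using measurable_sets[OF g D(1)] by simp
      have "emeasure \<nu> (?g -` D) = emeasure \<kappa> (?g -` D) + emeasure \<mu> (?g -` D)"
        by (rule add[OF gD])
      then have "ennreal (t powr \<alpha>) * emeasure \<kappa> D + ennreal (t powr \<alpha>) * emeasure \<mu> D =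
          emeasure \<kappa> (?g -` D) + ennreal (t powr \<alpha>) * emeasure \<mu> D"
        unfolding D\<nu>(4)[OF t D(1)] D\<mu>(4)[OF t D(1)] add[OF D(1)] by (simp add: distrib_left)
      moreover have "ennreal (t powr \<alpha>) * emeasure \<mu> D \<noteq> top"
        using emeasure_away_from_0_finite[OF \<mu> D(2,3)] by (simp add: ennreal_mult_eq_top_iff)
      ultimately have "ennreal (t powr \<alpha>) * emeasure \<kappa> D = emeasure \<kappa> (?g -` D)"
        by (auto simp: ennreal_add_left_cancel add.commute[of _ "ennreal (t powr \<alpha>) * emeasure \<mu> D"])
      then show "emeasure (distr \<kappa> borel ?g) D = emeasure (scale_measure (ennreal (t powr \<alpha>)) \<kappa>) D"
        using e[OF D(1)] by simp
    qed (simp_all add: sets_\<kappa>)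
    then have "emeasure (distr \<kappa> borel ?g) A = ennreal (t powr \<alpha>) * emeasure \<kappa> A"
      by simp
    then show "emeasure \<kappa> (?g -` A) = ennreal (t powr \<alpha>) * emeasure \<kappa> A"
      using A g sets_eq_imp_space_eq[OF sets_\<kappa>] by (subst (asm) emeasure_distr) (auto cong: measurable_cong_sets simp: sets_\<kappa>)
  qed
  with add show thesis using that by blast
qed

end

section \<open>Sums of images under matrices\<close>

lemma continuous_on_matrix: "continuous_on S ((*v) (A :: real ^ 'n ^ 'm))"
  by (rule linear_continuous_on[OF matrix_vector_mul_bounded_linear])

lemma borel_measurable_matrix [measurable]: "(*v) (A :: real ^ 'n ^ 'm) \<in> borel_measurable borel"
  by (rule borel_measurable_continuous_onI[OF continuous_on_matrix])

text \<open>The sum of the images of \<open>\<nu>\<close> under the matrices \<open>A j\<close>,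
  \<open>j \<in> I\<close>. It serves both as the contraction, with the first matrix left out, and
  as the full limit with all matrices.\<close>

definition matrix_sum :: "nat set \<Rightarrow> (nat \<Rightarrow> real ^ 'n ^ 'm) \<Rightarrow> (real ^ 'n) measure \<Rightarrow> (real ^ 'm) measure" where
  "matrix_sum I A \<nu> = series_measure (\<lambda>j. if j \<in> I then distr \<nu> borel ((*v) (A j)) else null_measure borel)"

lemma sets_matrix_sum [simp]: "sets (matrix_sum I A \<nu>) = sets borel"
  by (simp add: matrix_sum_def)

lemma nn_integral_matrix_sum:
  assumes "finite I" and sets: "sets \<nu> = sets borel" and f: "f \<in> borel_measurable borel"
  shows "(\<integral>\<^sup>+x. f x \<partial>matrix_sum I A \<nu>) = (\<Sum>j\<in>I. \<integral>\<^sup>+x. f (A j *v x) \<partial>\<nu>)"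
proof -
  let ?D = "\<lambda>j. if j \<in> I then distr \<nu> borel ((*v) (A j)) else null_measure borel"
  have A: "(*v) (A j) \<in> measurable \<nu> borel" for j
    by (subst measurable_cong_sets[OF sets refl]) simp
  have "(\<integral>\<^sup>+x. f x \<partial>matrix_sum I A \<nu>) = (\<Sum>j. \<integral>\<^sup>+x. f x \<partial>?D j)"
    unfolding matrix_sum_def
  proof (rule nn_integral_series_measure)
    show "f \<in> borel_measurable (?D 0)"
      using f by (auto cong: measurable_cong_sets)
  qed simp
  also have "\<dots> = (\<Sum>j\<in>I. \<integral>\<^sup>+x. f x \<partial>?D j)"
    using assms(1) by (rule suminf_finite) simp
  also have "\<dots> = (\<Sum>j\<in>I. \<integral>\<^sup>+x. f (A j *v x) \<partial>\<nu>)"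
    using f by (intro sum.cong refl) (simp add: nn_integral_distr[OF A])
  finally show ?thesis .
qed

lemma emeasure_matrix_sum:
  assumes "finite I" and sets: "sets \<nu> = sets borel" and B: "B \<in> sets borel"
  shows "emeasure (matrix_sum I A \<nu>) B = (\<Sum>j\<in>I. emeasure \<nu> ((*v) (A j) -` B))"
proof -
  have "(*v) (A j) -` B \<in> sets \<nu>" for j
    using measurable_sets[OF borel_measurable_matrix B, of "A j"] sets by simp
  then have "emeasure \<nu> ((*v) (A j) -` B) = (\<integral>\<^sup>+x. indicator B (A j *v x) \<partial>\<nu>)" for j
    by (simp only: nn_integral_indicator flip: indicator_vimage)
  moreover have "emeasure (matrix_sum I A \<nu>) B = (\<integral>\<^sup>+x. indicator B x \<partial>matrix_sum I A \<nu>)"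
    using B by simp
  ultimately show ?thesis
    using nn_integral_matrix_sum[OF assms(1,2), of "indicator B" A] B by simp
qed

context vector_norm
begin

text \<open>The constant is the reciprocal of the operator norm of the inverse. A lower bound of
  this kind keeps supports bounded when a test function is composed with the matrix, and keeps the
  origin the only preimage of the origin.\<close>

lemma invertible_expands:
  assumes "invertible (A :: real ^ 'd ^ 'd)"
  obtains c where "c > 0" "\<And>x. c * N x \<le> N (A *v x)"
proof -
  obtain A' where A': "A ** A' = mat 1" "A' ** A = mat 1"
    using assms by (auto simp: invertible_def)
  then have pos: "op_norm N A' > 0"
    by (intro op_norm_pos) (auto simp: invertible_def)
  have "N x \<le> op_norm N A' * N (A *v x)" for x
    using N_matrix_le[of A' "A *v x"] A'(2) by (simp add: matrix_vector_mul_assoc)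
  then show thesis
    using pos by (intro that[of "1 / op_norm N A'"]) (simp_all add: field_simps)
qed

text \<open>This is where the contraction factor originates: the bound \<open>B\<close> is unchanged
  while \<open>\<delta>\<close> becomes \<open>\<delta> / r\<close>, which multiplies
  \<open>B * \<delta> powr - \<alpha>\<close> by \<open>r powr \<alpha>\<close>.\<close>

lemma test_function_compose:
  assumes f: "test_function B \<delta> f" and r: "r > 0" "\<And>x. N (A *v x) \<le> r * N x"
    and c: "c > 0" "\<And>x. c * N x \<le> N (A *v x)"
  shows "test_function B (\<delta> / r) (\<lambda>x. f (A *v x))"
proof -
  obtain R where R: "\<And>x. N x > R \<Longrightarrow> f x = 0"
    using f by (auto simp: test_function_def)
  have "continuous_on UNIV f"
    using f by (simp add: test_function_def)
  then have "continuous_on UNIV (\<lambda>x. f (A *v x))"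
    by (rule continuous_on_compose2[OF _ continuous_on_matrix]) simp
  moreover have "f (A *v x) = 0" if "N x < \<delta> / r" for x
  proof (rule test_functionD(4)[OF f])
    have "r * N x < \<delta>" using that r(1) by (simp add: field_simps)
    then show "N (A *v x) < \<delta>" using r(2)[of x] by simp
  qed
  moreover have "f (A *v x) = 0" if "N x > R / c" for x
  proof (rule R)
    have "R < c * N x" using that c(1) by (simp add: field_simps)
    then show "R < N (A *v x)" using c(2)[of x] by simp
  qed
  ultimately show ?thesis
    unfolding test_function_def using test_functionD(2,3)[OF f] r(1) by (intro conjI allI impI exI[of _ "R / c"]) auto
qed

end

text \<open>The upper bounds \<open>r\<close> carry the contraction. The lower bounds
  \<open>c\<close> enter through invertibility alone: they may be arbitrarily small and only
  preserve test functions and null origins.\<close>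

locale contraction = vector_norm N for N :: "real ^ 'd \<Rightarrow> real" +
  fixes \<Phi> :: "nat \<Rightarrow> real ^ 'd ^ 'd" and J :: "nat set" and r c :: "nat \<Rightarrow> real" and \<alpha> :: real
  assumes finite_J: "finite J"
    and r_pos: "j \<in> J \<Longrightarrow> r j > 0" and \<Phi>_le: "j \<in> J \<Longrightarrow> N (\<Phi> j *v x) \<le> r j * N x"
    and c_pos: "j \<in> J \<Longrightarrow> c j > 0" and \<Phi>_ge: "j \<in> J \<Longrightarrow> c j * N x \<le> N (\<Phi> j *v x)"
    and sum_less_1: "(\<Sum>j\<in>J. r j powr \<alpha>) < 1"
begin

abbreviation "T \<equiv> matrix_sum J \<Phi>"

abbreviation "\<rho> \<equiv> (\<Sum>j\<in>J. r j powr \<alpha>)"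

lemma \<rho>_nonneg: "\<rho> \<ge> 0"
  by (intro sum_nonneg) simp

lemma \<Phi>_test:
  assumes "test_function B \<delta> f" "j \<in> J"
  shows "test_function B (\<delta> / r j) (\<lambda>x. f (\<Phi> j *v x))"
  by (rule test_function_compose[OF assms(1) r_pos \<Phi>_le c_pos \<Phi>_ge]) (rule assms(2))+

text \<open>A point mapped by \<open>\<Phi> j\<close> outside the unit ball has norm at least
  \<open>1 / r j\<close>, and by homogeneity the mass there is \<open>r j powr \<alpha>\<close>
  times that of the complement of the unit ball. Scalar multiplication commutes with matrices, so
  homogeneity survives.\<close>

lemma
  assumes \<nu>: "tail_measure \<alpha> \<nu>"
  shows tail_measure_T: "tail_measure \<alpha> (T \<nu>)"
    and T_tail_le: "emeasure (T \<nu>) {x. 1 \<le> N x} \<le> ennreal \<rho> * emeasure \<nu> {x. 1 \<le> N x}"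
proof -
  note D = tail_measureD[OF \<nu>]
  note T = emeasure_matrix_sum[OF finite_J D(1), where A = \<Phi>]
  show le: "emeasure (T \<nu>) {x. 1 \<le> N x} \<le> ennreal \<rho> * emeasure \<nu> {x. 1 \<le> N x}"
  proof -
    have "emeasure (T \<nu>) {x. 1 \<le> N x} = (\<Sum>j\<in>J. emeasure \<nu> ((*v) (\<Phi> j) -` {x. 1 \<le> N x}))"
      by (rule T[OF sets_tail(1)])
    also have "\<dots> \<le> (\<Sum>j\<in>J. ennreal (r j powr \<alpha>) * emeasure \<nu> {x. 1 \<le> N x})"
    proof (rule sum_mono)
      fix j assume j: "j \<in> J"
      have "(*v) (\<Phi> j) -` {x. 1 \<le> N x} \<subseteq> {x. 1 / r j \<le> N x}"
        using order_trans[OF _ \<Phi>_le[OF j]] r_pos[OF j] by (auto simp: field_simps)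
      then have "emeasure \<nu> ((*v) (\<Phi> j) -` {x. 1 \<le> N x}) \<le> emeasure \<nu> {x. 1 / r j \<le> N x}"
        using sets_tail(1) D(1) by (intro emeasure_mono) auto
      also have "\<dots> = ennreal ((1 / r j) powr - \<alpha>) * emeasure \<nu> {x. 1 \<le> N x}"
        using r_pos[OF j] by (intro emeasure_tail[OF \<nu>]) simp
      also have "(1 / r j) powr - \<alpha> = r j powr \<alpha>"
        using r_pos[OF j] by (simp add: powr_divide powr_minus_divide)
      finally show "emeasure \<nu> ((*v) (\<Phi> j) -` {x. 1 \<le> N x}) \<le> ennreal (r j powr \<alpha>) * emeasure \<nu> {x. 1 \<le> N x}" .
    qed
    also have "\<dots> = ennreal \<rho> * emeasure \<nu> {x. 1 \<le> N x}"
      by (simp add: sum_distrib_right[symmetric] sum_ennreal)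
    finally show ?thesis .
  qed
  show "tail_measure \<alpha> (T \<nu>)"
    unfolding tail_measure_def
  proof (intro conjI allI impI ballI)
    have "(*v) (\<Phi> j) -` {0} = {0}" if j: "j \<in> J" for j
    proof -
      have "x = 0" if "\<Phi> j *v x = 0" for x
        using \<Phi>_ge[OF j, of x] c_pos[OF j] that N_pos_iff[of x] by (simp add: mult_le_0_iff)
      then show ?thesis by auto
    qed
    then show "emeasure (T \<nu>) {0} = 0"
      using T[of "{0}"] D(2) by simp
    have "ennreal \<rho> * emeasure \<nu> {x. 1 \<le> N x} < top"
      using D(3) by (simp add: ennreal_mult_less_top)
    then show "emeasure (T \<nu>) {x. 1 \<le> N x} < \<infinity>"
      using le by (simp add: order_le_less_trans)
    fix t :: real and A :: "(real ^ 'd) set"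
    assume t: "t > 0" and A: "A \<in> sets borel"
    let ?g = "\<lambda>x::real ^ 'd. t *\<^sub>R x"
    have gA: "?g -` A \<in> sets borel" using measurable_sets[of ?g borel borel A] A by simp
    have "emeasure \<nu> ((*v) (\<Phi> j) -` (?g -` A)) = ennreal (t powr \<alpha>) * emeasure \<nu> ((*v) (\<Phi> j) -` A)" for j
    proof -
      have "(*v) (\<Phi> j) -` (?g -` A) = ?g -` ((*v) (\<Phi> j) -` A)"
        by (auto simp: matrix_vector_mult_scaleR)
      then show ?thesis
        using D(4)[OF t, of "(*v) (\<Phi> j) -` A"] measurable_sets[OF borel_measurable_matrix A, of "\<Phi> j"] by simp
    qed
    then show "emeasure (T \<nu>) (?g -` A) = ennreal (t powr \<alpha>) * emeasure (T \<nu>) A"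
      unfolding T[OF A] T[OF gA] by (simp add: sum_distrib_left)
  qed simp
qed

lemma
  assumes \<mu>: "tail_measure \<alpha> \<mu>"
  shows tail_measure_iterate: "tail_measure \<alpha> ((T ^^ k) \<mu>)"
    and iterate_tail_le: "emeasure ((T ^^ k) \<mu>) {x. 1 \<le> N x} \<le> ennreal (\<rho> ^ k) * emeasure \<mu> {x. 1 \<le> N x}"
proof (induction k)
  case (Suc k)
  {
    case 1
    show ?case using tail_measure_T[OF Suc(1)] by simp
  next
    case 2
    have "emeasure ((T ^^ Suc k) \<mu>) {x. 1 \<le> N x} \<le> ennreal \<rho> * emeasure ((T ^^ k) \<mu>) {x. 1 \<le> N x}"
      using T_tail_le[OF Suc(1)] by simp
    also have "\<dots> \<le> ennreal \<rho> * (ennreal (\<rho> ^ k) * emeasure \<mu> {x. 1 \<le> N x})"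
      using Suc(2) by (rule mult_left_mono) simp
    also have "\<dots> = ennreal (\<rho> ^ Suc k) * emeasure \<mu> {x. 1 \<le> N x}"
      using \<rho>_nonneg by (simp add: ennreal_mult mult.assoc)
    finally show ?case .
  }
qed (use \<mu> in auto)

text \<open>The even (\<open>i = 0\<close>) and the odd (\<open>i = 1\<close>) part of the Neumann series, without its signs.\<close>

definition every_second :: "nat \<Rightarrow> (real ^ 'd) measure \<Rightarrow> (real ^ 'd) measure" where
  "every_second i \<mu> = series_measure (\<lambda>k. (T ^^ (2 * k + i)) \<mu>)"

lemma sets_iterate: "tail_measure \<alpha> \<mu> \<Longrightarrow> sets ((T ^^ k) \<mu>) = sets borel"
  using tail_measureD(1)[OF tail_measure_iterate] .

lemma tail_measure_every_second:
  assumes \<mu>: "tail_measure \<alpha> \<mu>"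
  shows "tail_measure \<alpha> (every_second i \<mu>)"
proof -
  let ?\<nu> = "\<lambda>k. (T ^^ (2 * k + i)) \<mu>"
  note D = tail_measureD[OF tail_measure_iterate[OF \<mu>]]
  have e: "emeasure (every_second i \<mu>) A = (\<Sum>k. emeasure (?\<nu> k) A)" if "A \<in> sets borel" for A
    unfolding every_second_def by (rule emeasure_series_measure) (simp_all only: sets_iterate[OF \<mu>] that)
  show ?thesis
    unfolding tail_measure_def
  proof (intro conjI allI impI ballI)
    show "sets (every_second i \<mu>) = sets borel"
      by (simp only: every_second_def sets_series_measure sets_iterate[OF \<mu>])
    show "emeasure (every_second i \<mu>) {0} = 0"
      using e[of "{0}"] D(2) by simp
    let ?m = "emeasure \<mu> {x. 1 \<le> N x}"
    have "emeasure (every_second i \<mu>) {x. 1 \<le> N x} = (\<Sum>k. emeasure (?\<nu> k) {x. 1 \<le> N x})"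
      by (rule e[OF sets_tail(1)])
    also have "\<dots> \<le> (\<Sum>k. ennreal (\<rho> ^ k) * ?m)"
    proof (intro suminf_le summableI)
      fix k
      \<comment> \<open>A crude comparison with the full geometric series, which suffices for
        finiteness.\<close>
      have "\<rho> ^ (2 * k + i) \<le> \<rho> ^ k"
        using \<rho>_nonneg sum_less_1 by (intro power_decreasing) auto
      then show "emeasure (?\<nu> k) {x. 1 \<le> N x} \<le> ennreal (\<rho> ^ k) * ?m"
        by (intro order_trans[OF iterate_tail_le[OF \<mu>]] mult_right_mono ennreal_leI) auto
    qed
    also have "\<dots> = ennreal (\<Sum>k. \<rho> ^ k) * ?m"
      using \<rho>_nonneg sum_less_1 by (simp add: suminf_ennreal2 summable_geometric)
    also have "\<dots> < \<infinity>"
      using tail_measureD(3)[OF \<mu>] by (simp add: ennreal_mult_less_top)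
    finally show "emeasure (every_second i \<mu>) {x. 1 \<le> N x} < \<infinity>" .
    fix t :: real and A :: "(real ^ 'd) set"
    assume t: "t > 0" and A: "A \<in> sets borel"
    let ?g = "\<lambda>x::real ^ 'd. t *\<^sub>R x"
    have gA: "?g -` A \<in> sets borel" using measurable_sets[of ?g borel borel A] A by simp
    show "emeasure (every_second i \<mu>) (?g -` A) = ennreal (t powr \<alpha>) * emeasure (every_second i \<mu>) A"
      unfolding e[OF A] e[OF gA] D(4)[OF t A] by simp
  qed
qed

text \<open>With E the even and O the odd part, these are E = \<open>\<mu>\<close> + T O and O = T
  E, obtained by shifting the series by one index. No subtraction occurs, so they hold for all
  nonnegative functions, infinite values included.\<close>

lemma
  assumes \<mu>: "tail_measure \<alpha> \<mu>" and f: "f \<in> borel_measurable borel"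
  shows nn_integral_every_second_0: "(\<integral>\<^sup>+x. f x \<partial>every_second 0 \<mu>) =
      (\<integral>\<^sup>+x. f x \<partial>\<mu>) + (\<Sum>j\<in>J. \<integral>\<^sup>+x. f (\<Phi> j *v x) \<partial>every_second 1 \<mu>)" (is ?even)
    and nn_integral_every_second_1: "(\<integral>\<^sup>+x. f x \<partial>every_second 1 \<mu>) =
      (\<Sum>j\<in>J. \<integral>\<^sup>+x. f (\<Phi> j *v x) \<partial>every_second 0 \<mu>)" (is ?odd)
proof -
  have e: "(\<integral>\<^sup>+x. g x \<partial>every_second i \<mu>) = (\<Sum>k. \<integral>\<^sup>+x. g x \<partial>(T ^^ (2 * k + i)) \<mu>)"
    if "g \<in> borel_measurable borel" for g i
    unfolding every_second_def
  proof (rule nn_integral_series_measure)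
    show "g \<in> borel_measurable ((T ^^ (2 * 0 + i)) \<mu>)"
      by (subst measurable_cong_sets[OF sets_iterate[OF \<mu>] refl]) (rule that)
  qed (simp only: sets_iterate[OF \<mu>])
  have step: "(\<integral>\<^sup>+x. f x \<partial>(T ^^ Suc k) \<mu>) = (\<Sum>j\<in>J. \<integral>\<^sup>+x. f (\<Phi> j *v x) \<partial>(T ^^ k) \<mu>)" for k
    using nn_integral_matrix_sum[OF finite_J sets_iterate[OF \<mu>] f] by simp
  have f\<Phi>: "(\<lambda>x. f (\<Phi> j *v x)) \<in> borel_measurable borel" for j
    using f by simp
  have sum: "(\<Sum>k. \<integral>\<^sup>+x. f x \<partial>(T ^^ Suc (2 * k + i)) \<mu>) = (\<Sum>j\<in>J. \<integral>\<^sup>+x. f (\<Phi> j *v x) \<partial>every_second i \<mu>)" for i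
    unfolding step e[OF f\<Phi>] by (rule suminf_sum) simp
  \<comment> \<open>Splitting off the term \<open>k = 0\<close> of the even series, which is
    \<open>\<mu>\<close> itself; the others are images under \<open>T\<close> of the odd
    iterates.\<close>
  have "(\<Sum>k. \<integral>\<^sup>+x. f x \<partial>(T ^^ (2 * k + 0)) \<mu>) =
      (\<Sum>k. \<integral>\<^sup>+x. f x \<partial>(T ^^ (2 * (k + 1) + 0)) \<mu>) + (\<Sum>k<1. \<integral>\<^sup>+x. f x \<partial>(T ^^ (2 * k + 0)) \<mu>)"
    by (rule suminf_offset) simp
  then show ?even
    using sum[of 1] e[OF f, of 0] by (simp add: add.commute)
  show ?odd
    using sum[of 0] e[OF f, of 1] by simp
qed

text \<open>Subtracting O = T E from E = \<open>\<mu>\<close> + T O: the signed functional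
  \<open>\<Lambda>\<close> solves the limiting equation exactly. On test functions all integrals are
  finite, so the subtraction is harmless.\<close>

lemma integral_every_second_diff:
  assumes \<mu>: "tail_measure \<alpha> \<mu>" and f: "test_function B \<delta> f"
  defines "\<Lambda> \<equiv> \<lambda>f. (\<integral>x. f x \<partial>every_second 0 \<mu>) - (\<integral>x. f x \<partial>every_second 1 \<mu>)"
  shows "\<Lambda> f + (\<Sum>j\<in>J. \<Lambda> (\<lambda>x. f (\<Phi> j *v x))) = (\<integral>x. f x \<partial>\<mu>)"
proof -
  note tm = tail_measure_every_second[OF \<mu>]
  have "(\<integral>x. f x \<partial>every_second 0 \<mu>) = (\<integral>x. f x \<partial>\<mu>) + (\<Sum>j\<in>J. \<integral>x. f (\<Phi> j *v x) \<partial>every_second 1 \<mu>)"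
    using test_functionD(1)[OF f]
    by (intro integral_eq_integral_plus_sum finite_J nn_integral_every_second_0[OF \<mu>]
        test_function_integrable(1)[OF tm f] test_function_integrable(1)[OF \<mu> f] test_function_integrable(1)[OF tm \<Phi>_test[OF f]])
       auto
  \<comment> \<open>The odd part has no initial term, so the null measure takes the place of
    \<open>\<mu>\<close>.\<close>
  moreover have "(\<integral>x. f x \<partial>every_second 1 \<mu>) =
      (\<integral>x. f x \<partial>null_measure borel) + (\<Sum>j\<in>J. \<integral>x. f (\<Phi> j *v x) \<partial>every_second 0 \<mu>)"
  proof (intro integral_eq_integral_plus_sum finite_J
        test_function_integrable(1)[OF tm f] test_function_integrable(1)[OF tm \<Phi>_test[OF f]])
    show "integrable (null_measure borel) f"
      using test_functionD(1)[OF f] by (simp add: real_integrable_def cong: measurable_cong_sets)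
    fix h assume "h \<in> {\<lambda>x. ennreal (f x), \<lambda>x. ennreal (- f x)}"
    then have "h \<in> borel_measurable borel"
      using test_functionD(1)[OF f] by auto
    then show "integral\<^sup>N (every_second 1 \<mu>) h =
        integral\<^sup>N (null_measure borel) h + (\<Sum>j\<in>J. \<integral>\<^sup>+x. h (\<Phi> j *v x) \<partial>every_second 0 \<mu>)"
      using nn_integral_every_second_1[OF \<mu>] by simp
  qed
  moreover have "(\<integral>x. f x \<partial>null_measure borel) = 0"
    by (simp add: integral_null_measure)
  ultimately show ?thesis
    by (simp add: \<Lambda>_def sum_subtractf)
qed

end

section \<open>The contraction argument\<close>

context contraction
begin

text \<open>The recursion expresses \<open>D s f\<close>, up to a vanishing error, through the
  values at \<open>f\<close> composed with the \<open>\<Phi> j\<close>. Applying the a priori bound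
  to these multiplies it by the sum of the \<open>r j powr \<alpha>\<close>, that is by
  \<open>\<rho> < 1\<close>; repeating this n times gives the factor
  \<open>\<rho> ^ n\<close>.\<close>

lemma tendsto_0_of_contraction:
  fixes D :: "real \<Rightarrow> (real ^ 'd \<Rightarrow> real) \<Rightarrow> real"
  assumes bound: "\<And>B \<delta> f \<eta>. test_function B \<delta> f \<Longrightarrow> \<eta> > 0 \<Longrightarrow>
      \<forall>\<^sub>F s in at_top. \<bar>D s f\<bar> \<le> K * B * \<delta> powr - \<alpha> + \<eta>"
    and rec: "\<And>B \<delta> f. test_function B \<delta> f \<Longrightarrow>
      ((\<lambda>s. D s f + (\<Sum>j\<in>J. D s (\<lambda>x. f (\<Phi> j *v x)))) \<longlongrightarrow> 0) at_top"
    and f: "test_function B \<delta> f"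
  shows "((\<lambda>s. D s f) \<longlongrightarrow> 0) at_top"
proof -
  have iter: "\<forall>\<^sub>F s in at_top. \<bar>D s f\<bar> \<le> K * B * \<delta> powr - \<alpha> * \<rho> ^ n + \<eta>"
    if "test_function B \<delta> f" "\<eta> > 0" for n B \<delta> f \<eta>
    using that
  proof (induction n arbitrary: f \<delta> \<eta>)
    case 0
    then show ?case using bound by simp
  next
    case (Suc n)
    \<comment> \<open>The error \<open>\<eta>\<close> is shared by \<open>card J\<close> uses of the
      induction hypothesis and one use of the recursion.\<close>
    let ?m = "1 + real (card J)"
    have \<eta>: "\<eta> / ?m > 0" using Suc.prems(2) by simp
    have "\<forall>\<^sub>F s in at_top. \<bar>D s f + (\<Sum>j\<in>J. D s (\<lambda>x. f (\<Phi> j *v x)))\<bar> < \<eta> / ?m"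
      using tendstoD[OF rec[OF Suc.prems(1)] \<eta>] by (simp add: dist_real_def)
    moreover have "\<forall>\<^sub>F s in at_top. \<forall>j\<in>J. \<bar>D s (\<lambda>x. f (\<Phi> j *v x))\<bar> \<le> K * B * (\<delta> / r j) powr - \<alpha> * \<rho> ^ n + \<eta> / ?m"
      using finite_J Suc.IH[OF \<Phi>_test[OF Suc.prems(1)] \<eta>] by (intro eventually_ball_finite) auto
    ultimately show ?case
    proof eventually_elim
      case (elim s)
      let ?S = "\<Sum>j\<in>J. D s (\<lambda>x. f (\<Phi> j *v x))"
      have "\<bar>?S\<bar> \<le> (\<Sum>j\<in>J. \<bar>D s (\<lambda>x. f (\<Phi> j *v x))\<bar>)"
        by (rule sum_abs)
      also have "\<dots> \<le> (\<Sum>j\<in>J. K * B * \<delta> powr - \<alpha> * \<rho> ^ n * r j powr \<alpha> + \<eta> / ?m)"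
      proof (rule sum_mono)
        fix j assume j: "j \<in> J"
        have "(\<delta> / r j) powr - \<alpha> = \<delta> powr - \<alpha> * r j powr \<alpha>"
          using r_pos[OF j] test_functionD(3)[OF Suc.prems(1)] by (simp add: powr_divide powr_minus field_simps)
        then show "\<bar>D s (\<lambda>x. f (\<Phi> j *v x))\<bar> \<le> K * B * \<delta> powr - \<alpha> * \<rho> ^ n * r j powr \<alpha> + \<eta> / ?m"
          using bspec[OF elim(2) j] by (simp add: mult_ac)
      qed
      also have "\<dots> = K * B * \<delta> powr - \<alpha> * \<rho> ^ n * \<rho> + real (card J) * (\<eta> / ?m)"
        by (simp add: sum.distrib sum_distrib_left)
      finally have "\<bar>D s f\<bar> \<le> K * B * \<delta> powr - \<alpha> * \<rho> ^ n * \<rho> + (real (card J) * (\<eta> / ?m) + \<eta> / ?m)"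
        using elim(1) by linarith
      also have "real (card J) * (\<eta> / ?m) + \<eta> / ?m = ?m * (\<eta> / ?m)"
        by (simp only: distrib_right mult_1 add.commute)
      also have "\<dots> = \<eta>"
        by simp
      finally show ?case by (simp add: mult_ac)
    qed
  qed
  show ?thesis
  proof (rule tendstoI)
    fix e :: real assume e: "e > 0"
    \<comment> \<open>The number of iterations is fixed by \<open>e\<close> before s grows: the
      range of s in which \<open>iter\<close> holds depends on \<open>n\<close>.\<close>
    have "(\<lambda>n. K * B * \<delta> powr - \<alpha> * \<rho> ^ n) \<longlonglongrightarrow> K * B * \<delta> powr - \<alpha> * 0"
      using \<rho>_nonneg sum_less_1 by (intro tendsto_mult_left LIMSEQ_realpow_zero)
    then have "\<forall>\<^sub>F n in sequentially. K * B * \<delta> powr - \<alpha> * \<rho> ^ n < e / 2"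
      using e by (intro order_tendstoD(2)) auto
    then obtain n where n: "K * B * \<delta> powr - \<alpha> * \<rho> ^ n < e / 2"
      unfolding eventually_sequentially by blast
    have "\<forall>\<^sub>F s in at_top. \<bar>D s f\<bar> \<le> K * B * \<delta> powr - \<alpha> * \<rho> ^ n + e / 2"
      by (rule iter[OF f]) (use e in simp)
    then show "\<forall>\<^sub>F s in at_top. dist (D s f) 0 < e"
      by eventually_elim (use n in auto)
  qed
qed

text \<open>The index \<open>i0\<close> stands for the dominant summand, which has been normalised
  to the identity matrix. The last conclusion is an equation between measures rather than a
  statement on test functions, so that it can later be evaluated on arbitrary Borel sets.\<close>

lemma ex_limit_measure:
  fixes L :: "real \<Rightarrow> (real ^ 'd \<Rightarrow> real) \<Rightarrow> real"
  assumes \<mu>: "tail_measure \<alpha> \<mu>" and i0: "i0 \<notin> J" "\<Phi> i0 = mat 1"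
    and bound: "\<And>B \<delta> f \<eta>. test_function B \<delta> f \<Longrightarrow> \<eta> > 0 \<Longrightarrow>
      \<forall>\<^sub>F s in at_top. \<bar>L s f\<bar> \<le> K * B * \<delta> powr - \<alpha> + \<eta>"
    and rec: "\<And>B \<delta> f. test_function B \<delta> f \<Longrightarrow>
      ((\<lambda>s. \<Sum>j\<in>insert i0 J. L s (\<lambda>x. f (\<Phi> j *v x))) \<longlongrightarrow> (\<integral>x. f x \<partial>\<mu>)) at_top"
    and nonneg: "\<And>B \<delta> f s. test_function B \<delta> f \<Longrightarrow> (\<And>x. 0 \<le> f x) \<Longrightarrow> 0 \<le> L s f"
  obtains \<nu> where "tail_measure \<alpha> \<nu>"
    "\<And>B \<delta> f. test_function B \<delta> f \<Longrightarrow> ((\<lambda>s. L s f) \<longlongrightarrow> (\<integral>x. f x \<partial>\<nu>)) at_top"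
    "\<mu> = matrix_sum (insert i0 J) \<Phi> \<nu>"
proof -
  let ?E = "every_second 0 \<mu>" and ?O = "every_second 1 \<mu>"
  note tm = tail_measure_every_second[OF \<mu>]
  define \<Lambda> where "\<Lambda> f = (\<integral>x. f x \<partial>?E) - (\<integral>x. f x \<partial>?O)" for f :: "real ^ 'd \<Rightarrow> real"
  define K' where "K' = measure ?E {x. 1 \<le> N x} + measure ?O {x. 1 \<le> N x}"
  have \<Lambda>_le: "\<bar>\<Lambda> f\<bar> \<le> K' * B * \<delta> powr - \<alpha>" if f: "test_function B \<delta> f" for B \<delta> f
    using test_function_integrable(2)[OF tm[of 0] f] test_function_integrable(2)[OF tm[of 1] f]
    by (simp add: \<Lambda>_def K'_def algebra_simps)
  have lim: "((\<lambda>s. L s f) \<longlongrightarrow> \<Lambda> f) at_top" if f: "test_function B \<delta> f" for B \<delta> f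
  proof -
    have "((\<lambda>s. L s f - \<Lambda> f) \<longlongrightarrow> 0) at_top"
    \<comment> \<open>Since \<open>\<Lambda>\<close> solves the equation exactly and
      \<open>L s\<close> solves it in the limit, their difference solves it with right-hand side 0
      in the limit. Its a priori bound is the sum of those of \<open>L s\<close> and
      \<open>\<Lambda>\<close>.\<close>
    proof (rule tendsto_0_of_contraction[where D = "\<lambda>s f. L s f - \<Lambda> f", OF _ _ f])
      fix B \<delta> f assume f: "test_function B \<delta> f"
      have "((\<lambda>s. (\<Sum>j\<in>insert i0 J. L s (\<lambda>x. f (\<Phi> j *v x))) - (\<integral>x. f x \<partial>\<mu>)) \<longlongrightarrow> 0) at_top"
        using rec[OF f] by (simp add: LIM_zero_iff)
      moreover have "(\<Sum>j\<in>insert i0 J. L s (\<lambda>x. f (\<Phi> j *v x))) - (\<integral>x. f x \<partial>\<mu>) =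
          L s f - \<Lambda> f + (\<Sum>j\<in>J. L s (\<lambda>x. f (\<Phi> j *v x)) - \<Lambda> (\<lambda>x. f (\<Phi> j *v x)))" for s
        using integral_every_second_diff[OF \<mu> f] i0 finite_J by (simp add: \<Lambda>_def sum_subtractf)
      ultimately show "((\<lambda>s. L s f - \<Lambda> f + (\<Sum>j\<in>J. L s (\<lambda>x. f (\<Phi> j *v x)) - \<Lambda> (\<lambda>x. f (\<Phi> j *v x)))) \<longlongrightarrow> 0) at_top"
        by simp
      fix \<eta> :: real assume "\<eta> > 0"
      then have "\<forall>\<^sub>F s in at_top. \<bar>L s f\<bar> \<le> K * B * \<delta> powr - \<alpha> + \<eta>"
        by (rule bound[OF f])
      then show "\<forall>\<^sub>F s in at_top. \<bar>L s f - \<Lambda> f\<bar> \<le> (K + K') * B * \<delta> powr - \<alpha> + \<eta>"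
        by eventually_elim (use \<Lambda>_le[OF f] in \<open>simp add: algebra_simps\<close>)
    qed
    then show ?thesis by (simp add: LIM_zero_iff)
  qed
  have "emeasure ?O A \<le> emeasure ?E A" if "A \<in> sets borel" for A
  proof (rule emeasure_le_of_test_functions[OF tm tm _ that])
    fix B \<delta> f assume "test_function B \<delta> f" "\<And>x. 0 \<le> f x"
    then have "0 \<le> \<Lambda> f"
      by (intro tendsto_lowerbound[OF lim] always_eventually allI nonneg) auto
    then show "(\<integral>x. f x \<partial>?O) \<le> (\<integral>x. f x \<partial>?E)"
      by (simp add: \<Lambda>_def)
  qed
  then obtain \<nu> where \<nu>: "tail_measure \<alpha> \<nu>" "\<And>A. A \<in> sets borel \<Longrightarrow> emeasure ?E A = emeasure \<nu> A + emeasure ?O A"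
    using ex_difference_measure[OF tm tm] by blast
  note D\<nu> = tail_measureD[OF \<nu>(1)]
  have integral: "\<Lambda> f = (\<integral>x. f x \<partial>\<nu>)" if f: "test_function B \<delta> f" for B \<delta> f
  proof -
    have "(\<integral>x. f x \<partial>?E) = (\<integral>x. f x \<partial>\<nu>) + (\<Sum>j\<in>{0::nat}. \<integral>x. f x \<partial>?O)"
    proof (rule integral_eq_integral_plus_sum)
      fix h assume "h \<in> {\<lambda>x. ennreal (f x), \<lambda>x. ennreal (- f x)}"
      then have h: "h \<in> borel_measurable borel"
        using test_functionD(1)[OF f] by auto
      \<comment> \<open>Writing the even part as the series \<open>\<nu>\<close>, odd part, 0, 0,
        ... upgrades additivity on sets to additivity of integrals.\<close>
      define s where "s = (\<lambda>n::nat. if n = 0 then \<nu> else if n = 1 then ?O else null_measure borel)"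
      have sets_s: "sets (s n) = sets borel" for n
        using D\<nu>(1) tail_measureD(1)[OF tm] by (simp add: s_def)
      have two: "(\<Sum>n. g (s n)) = g \<nu> + g ?O" if "g (null_measure borel) = 0" for g :: "(real ^ 'd) measure \<Rightarrow> ennreal"
        using that suminf_finite[of "{0, 1::nat}" "\<lambda>n. g (s n)"] by (simp add: s_def)
      have "?E = series_measure s"
      proof (rule measure_eqI)
        show "sets ?E = sets (series_measure s)"
          using tail_measureD(1)[OF tm] sets_s[of 0] by simp
        fix A assume "A \<in> sets ?E"
        then have A: "A \<in> sets borel" using tail_measureD(1)[OF tm] by simp
        have "emeasure (series_measure s) A = (\<Sum>n. emeasure (s n) A)"
          by (rule emeasure_series_measure) (simp_all only: sets_s A)
        then show "emeasure ?E A = emeasure (series_measure s) A"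
          using \<nu>(2)[OF A] two[of "\<lambda>m. emeasure m A"] by simp
      qed
      also have "(\<integral>\<^sup>+x. h x \<partial>series_measure s) = (\<Sum>n. \<integral>\<^sup>+x. h x \<partial>s n)"
        by (rule nn_integral_series_measure) (simp_all only: sets_s measurable_cong_sets[OF sets_s refl] h)
      finally show "integral\<^sup>N ?E h = integral\<^sup>N \<nu> h + (\<Sum>j\<in>{0::nat}. integral\<^sup>N ?O h)"
        using two[of "\<lambda>m. integral\<^sup>N m h"] by simp
    qed (use test_function_integrable(1)[OF tm f] test_function_integrable(1)[OF \<nu>(1) f] in auto)
    then show ?thesis by (simp add: \<Lambda>_def)
  qed
  have vimage: "(*v) (\<Phi> j) -` A \<in> sets borel" if "A \<in> sets borel" for A j
    using measurable_sets[OF borel_measurable_matrix that, of "\<Phi> j"] by simp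
  have e: "emeasure (every_second i \<mu>) A = (\<integral>\<^sup>+x. indicator A x \<partial>every_second i \<mu>)"
    "(\<integral>\<^sup>+x. indicator A (\<Phi> j *v x) \<partial>every_second i \<mu>) = emeasure (every_second i \<mu>) ((*v) (\<Phi> j) -` A)"
    if "A \<in> sets borel" for A i j
    using that vimage[OF that, of j] tail_measureD(1)[OF tm, of i] by (simp_all flip: indicator_vimage)
  have finite: "finite (insert i0 J)" using finite_J by simp
  have "\<mu> = matrix_sum (insert i0 J) \<Phi> \<nu>"
  proof (rule measure_eqI_away_from_0)
    note D\<mu> = tail_measureD[OF \<mu>]
    show "sets \<mu> = sets borel" "emeasure \<mu> {0} = 0" by (rule D\<mu>)+
    have "emeasure \<nu> ((*v) (\<Phi> j) -` {0}) = 0" if "j \<in> insert i0 J" for j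
    proof -
      have "x = 0" if "\<Phi> j *v x = 0" for x
      proof (cases "j = i0")
        case False
        then show ?thesis
          using \<open>j \<in> insert i0 J\<close> \<Phi>_ge[of j x] c_pos[of j] that N_pos_iff[of x] by (simp add: mult_le_0_iff)
      qed (use that i0 in simp)
      then have "(*v) (\<Phi> j) -` {0} = {0}" by auto
      then show ?thesis using D\<nu>(2) by simp
    qed
    then show "emeasure (matrix_sum (insert i0 J) \<Phi> \<nu>) {0} = 0"
      by (subst emeasure_matrix_sum[OF finite D\<nu>(1)]) (auto intro: sum.neutral)
    fix A :: "(real ^ 'd) set" and r assume A: "A \<in> sets borel" "r > 0" "A \<subseteq> {x. r \<le> N x}"
    let ?P = "\<lambda>m. \<Sum>j\<in>J. emeasure m ((*v) (\<Phi> j) -` A)"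
    have even: "emeasure ?E A = emeasure \<mu> A + ?P ?O" and odd: "emeasure ?O A = ?P ?E"
      using nn_integral_every_second_0[OF \<mu>, of "indicator A"] nn_integral_every_second_1[OF \<mu>, of "indicator A"] A(1) D\<mu>(1)
      by (simp_all add: e[OF A(1)])
    have "emeasure ?E A < \<infinity>"
      by (rule emeasure_away_from_0_finite[OF tm A(2,3)])
    \<comment> \<open>The image of the odd part is dominated by the even part, hence finite away
      from 0, and may be cancelled from E = \<open>\<mu>\<close> + T O with E = \<open>\<nu>\<close>
      + O, O = T E.\<close>
    then have fin: "?P ?O \<noteq> top"
      using even by (auto simp: less_top)
    have "?P ?E = ?P \<nu> + ?P ?O"
      by (simp add: \<nu>(2)[OF vimage[OF A(1)]] sum.distrib)
    then have "?P ?O + emeasure \<mu> A = ?P ?O + (emeasure \<nu> A + ?P \<nu>)"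
      using even odd \<nu>(2)[OF A(1)] by (simp only: add_ac)
    then have "emeasure \<mu> A = emeasure \<nu> A + ?P \<nu>"
      using fin unfolding ennreal_add_left_cancel infinity_ennreal_def by blast
    also have "\<dots> = emeasure (matrix_sum (insert i0 J) \<Phi> \<nu>) A"
      using i0 finite_J by (simp add: emeasure_matrix_sum[OF finite D\<nu>(1) A(1)] vimage_def)
    finally show "emeasure \<mu> A = emeasure (matrix_sum (insert i0 J) \<Phi> \<nu>) A" .
  qed simp
  with \<nu>(1) lim integral show thesis
    by (intro that[of \<nu>]) auto
qed

end

section \<open>Vague convergence and the finite part\<close>

lemma integral_scale_measure:
  fixes f :: "'a \<Rightarrow> real"
  assumes "0 \<le> a" "f \<in> borel_measurable \<mu>"
  shows "(\<integral>x. f x \<partial>scale_measure (ennreal a) \<mu>) = a * (\<integral>x. f x \<partial>\<mu>)"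
proof -
  have "scale_measure (ennreal a) \<mu> = density \<mu> (\<lambda>x. ennreal a)"
    by (rule measure_eqI) (simp_all add: emeasure_density_const)
  then show ?thesis
    using assms by (simp add: integral_density)
qed

lemma open_ext_image: "open U \<Longrightarrow> open (ext ` U)"
proof -
  assume "open U"
  then have "open (fin_part -` U \<inter> range ext)"
    using continuous_on_open_vimage[OF open_range_ext] continuous_on_fin_part by blast
  moreover have "fin_part -` U \<inter> range ext = ext ` U"
    by auto
  ultimately show ?thesis by simp
qed

lemma ext_image_borel: "A \<in> sets borel \<Longrightarrow> ext ` A \<in> sets borel"
proof -
  assume "A \<in> sets borel"
  then have "fin_part -` A \<inter> range ext \<in> sets borel"
    using measurable_sets[OF borel_measurable_fin_part] by auto
  moreover have "fin_part -` A \<inter> range ext = ext ` A"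
    by auto
  ultimately show ?thesis by simp
qed

lemma sets_Compl_0: "- {0} \<in> sets (borel :: (ereal ^ 'd) measure)"
  by (intro borel_open open_Compl compact_imp_closed_vec) simp

lemma sets_punctured: "A \<in> sets (punctured :: (ereal ^ 'd) measure) \<longleftrightarrow> A \<in> sets borel \<and> 0 \<notin> A"
  unfolding punctured_def using sets_Compl_0 by (subst sets_restrict_space_iff) auto

lemma space_punctured: "space punctured = - {0}"
  by (simp add: punctured_def space_restrict_space)

text \<open>The case distinction removes the outcomes sent to the origin, which the punctured space
  omits; for \<open>s = 0\<close> these are all outcomes, because \<open>inverse 0 = 0\<close>.
  Where the denominator is 0 both sides are 0.\<close>

lemma integral_normalized_law:
  assumes X: "X \<in> borel_measurable M" and f: "continuous_on (- {0}) f"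
  shows "(\<integral>z. f z \<partial>normalized_law M N X Y s) =
    (\<integral>\<omega>. (if X \<omega> = 0 \<or> s = 0 then 0 else f (ext (inverse s *\<^sub>R X \<omega>))) \<partial>M) / measure M {\<omega> \<in> space M. N (Y \<omega>) > s}"
proof -
  let ?e = "\<lambda>\<omega>. ext (inverse s *\<^sub>R X \<omega>)"
  have e: "?e \<in> borel_measurable M"
    using X by measurable
  have meas: "f \<in> borel_measurable (restrict_space (distr M borel ?e) (- {0}))"
    using borel_measurable_continuous_on_restrict[OF f]
    by (subst measurable_cong_sets[OF sets_restrict_space_cong[of "distr M borel ?e" borel] refl]) simp_all
  have "(\<integral>z. f z \<partial>restrict_space (distr M borel ?e) (- {0})) = (\<integral>z. indicator (- {0}) z *\<^sub>R f z \<partial>distr M borel ?e)"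
    using sets_Compl_0 by (intro integral_restrict_space) simp
  also have "\<dots> = (\<integral>\<omega>. indicator (- {0}) (?e \<omega>) *\<^sub>R f (?e \<omega>) \<partial>M)"
    using borel_measurable_continuous_on_indicator[OF sets_Compl_0 f] by (rule integral_distr[OF e])
  also have "\<dots> = (\<integral>\<omega>. (if X \<omega> = 0 \<or> s = 0 then 0 else f (?e \<omega>)) \<partial>M)"
    by (rule Bochner_Integration.integral_cong) auto
  finally show ?thesis
    unfolding normalized_law_def using meas by (simp add: integral_scale_measure)
qed

context vector_norm
begin

text \<open>In the compactified space closed sets are compact, so support compact in the punctured
  space just means support away from the origin. Such functions need not vanish at infinite
  points.\<close>

lemma Cc0_I:
  assumes "continuous_on (- {0}) f" "r > 0" "\<And>x. x \<noteq> 0 \<Longrightarrow> N x < r \<Longrightarrow> f (ext x) = 0"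
  shows "f \<in> Cc0"
proof -
  have "open {x. N x < r}"
    by (intro open_Collect_less continuous_intros)
  then have "closed (- ext ` {x. N x < r})"
    by (rule closed_Compl[OF open_ext_image])
  moreover have "{z \<in> - {0}. f z \<noteq> 0} \<subseteq> - ext ` {x. N x < r}"
    using assms(3) by auto
  ultimately have sub: "closure {z \<in> - {0}. f z \<noteq> 0} \<subseteq> - ext ` {x. N x < r}"
    by (intro closure_minimal)
  have "0 \<in> ext ` {x. N x < r}"
    using assms(2) by (intro image_eqI[of _ _ 0]) auto
  then have "closure {z \<in> - {0}. f z \<noteq> 0} \<inter> - {0} = closure {z \<in> - {0}. f z \<noteq> 0}"
    using sub by auto
  then show ?thesis
    using assms(1) by (simp add: Cc0_def compact_eq_closed_ereal_vec)
qed

text \<open>The complement of the compact support is an open neighbourhood of 0, which contains a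
  ball of the norm; continuity on the support gives the bound.\<close>

lemma Cc0_D:
  assumes "f \<in> Cc0"
  obtains B \<delta> where "\<And>z. z \<noteq> 0 \<Longrightarrow> \<bar>f z\<bar> \<le> B" "\<delta> > 0" "\<And>x. x \<noteq> 0 \<Longrightarrow> N x < \<delta> \<Longrightarrow> f (ext x) = 0" "B \<ge> 0"
proof -
  let ?K = "closure {z \<in> - {0}. f z \<noteq> 0} \<inter> - {0}"
  have K: "compact ?K" "continuous_on (- {0}) f"
    using assms by (auto simp: Cc0_def)
  have zero: "f z = 0" if "z \<noteq> 0" "z \<notin> ?K" for z
    using that closure_subset[of "{z \<in> - {0}. f z \<noteq> 0}"] by auto
  have "open (ext -` (- ?K))"
    by (rule open_vimage[OF open_Compl[OF compact_imp_closed_vec[OF K(1)]] continuous_on_ext])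
  then obtain \<delta> where \<delta>: "\<delta> > 0" "{x. N x < \<delta>} \<subseteq> ext -` (- ?K)"
    by (rule nhds_0_N_ball) simp
  have "compact (f ` ?K)"
    using K by (intro compact_continuous_image continuous_on_subset[OF K(2)]) auto
  then obtain B where B: "\<And>z. z \<in> ?K \<Longrightarrow> \<bar>f z\<bar> \<le> B"
    using compact_imp_bounded[of "f ` ?K"] by (auto simp: bounded_iff)
  show thesis
  proof (rule that)
    show "\<bar>f z\<bar> \<le> max 0 B" if "z \<noteq> 0" for z
      using B[of z] zero[OF that] by (cases "z \<in> ?K") auto
    show "f (ext x) = 0" if "x \<noteq> 0" "N x < \<delta>" for x
      using that \<delta>(2) by (intro zero) auto
  qed (use \<delta> in auto)
qed

text \<open>The set of finite points and the complement of the image of a closed ball are open and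
  cover the space. The extension is continuous on the former, and identically 0 on the
  latter.\<close>

lemma continuous_extension_by_0:
  assumes "continuous_on UNIV f" "\<And>x. N x > R \<Longrightarrow> f x = (0 :: real)"
  shows "continuous_on UNIV (\<lambda>z. if z \<in> range ext then f (fin_part z) else 0)" (is "continuous_on UNIV ?F")
proof -
  let ?V = "- ext ` {x. N x \<le> R}"
  have "compact (ext ` {x. N x \<le> R})"
    by (intro compact_continuous_image continuous_on_ext compact_N_le)
  then have "open ?V"
    by (rule open_Compl[OF compact_imp_closed_vec])
  have "continuous_on (range ext) (\<lambda>z. f (fin_part z))"
    using assms(1) continuous_on_fin_part by (rule continuous_on_compose2) simp
  then have 1: "continuous_on (range ext) ?F"
    by (rule continuous_on_eq) simp
  have "?F z = 0" if "z \<in> ?V" for z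
    using that assms(2) by (force simp: not_le)
  then have 2: "continuous_on ?V ?F"
    by (intro continuous_on_eq[OF continuous_on_const[of _ 0]]) simp
  have "range ext \<union> ?V = UNIV" by auto
  then show ?thesis
    using continuous_on_open_Un[OF open_range_ext \<open>open ?V\<close> 1 2] by simp
qed

text \<open>The restriction to finite points, read on Euclidean space. The original measure lives on
  the punctured space, so the origin receives mass 0.\<close>

definition finite_part :: "(ereal ^ 'd) measure \<Rightarrow> (real ^ 'd) measure" where
  "finite_part \<mu> = distr (restrict_space \<mu> (range ext)) borel fin_part"

context
  fixes \<mu> :: "(ereal ^ 'd) measure"
  assumes sets_\<mu>: "sets \<mu> = sets punctured"
begin

lemma space_eq_Compl_0: "space \<mu> = - {0}"
  using sets_eq_imp_space_eq[OF sets_\<mu>] space_punctured by simp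

lemma range_ext_Int_space: "range ext \<inter> space \<mu> \<in> sets \<mu>"
  unfolding sets_\<mu> sets_punctured
  using sets.Int[OF sets_range_ext sets_Compl_0] by (simp add: space_eq_Compl_0)

lemma measurable_fin_part: "fin_part \<in> measurable (restrict_space \<mu> (range ext)) borel"
proof -
  have "fin_part \<in> measurable (restrict_space (restrict_space borel (- {0})) (range ext)) borel"
    by (intro measurable_restrict_space1 borel_measurable_fin_part)
  then show ?thesis
    by (subst measurable_cong_sets[OF sets_restrict_space_cong[OF sets_\<mu>] refl]) (simp add: punctured_def)
qed

lemma emeasure_finite_part:
  assumes A: "A \<in> sets borel"
  shows "emeasure (finite_part \<mu>) A = emeasure \<mu> (ext ` (A - {0}))"
proof -
  have "emeasure (finite_part \<mu>) A =
      emeasure (restrict_space \<mu> (range ext)) (fin_part -` A \<inter> space (restrict_space \<mu> (range ext)))"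
    unfolding finite_part_def by (rule emeasure_distr[OF measurable_fin_part A])
  also have "fin_part -` A \<inter> space (restrict_space \<mu> (range ext)) = ext ` (A - {0})"
    by (auto simp: space_restrict_space space_eq_Compl_0)
  also have "emeasure (restrict_space \<mu> (range ext)) (ext ` (A - {0})) = emeasure \<mu> (ext ` (A - {0}))"
    by (rule emeasure_restrict_space[OF range_ext_Int_space]) auto
  finally show ?thesis .
qed

lemma integral_finite_part:
  fixes f :: "real ^ 'd \<Rightarrow> real"
  assumes "f \<in> borel_measurable borel"
  shows "(\<integral>x. f x \<partial>finite_part \<mu>) = (\<integral>z. (if z \<in> range ext then f (fin_part z) else 0) \<partial>\<mu>)"
proof -
  have "(\<integral>x. f x \<partial>finite_part \<mu>) = (\<integral>z. f (fin_part z) \<partial>restrict_space \<mu> (range ext))"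
    unfolding finite_part_def by (rule integral_distr[OF measurable_fin_part assms])
  also have "\<dots> = (\<integral>z. indicator (range ext) z *\<^sub>R f (fin_part z) \<partial>\<mu>)"
    by (rule integral_restrict_space[OF range_ext_Int_space])
  also have "\<dots> = (\<integral>z. (if z \<in> range ext then f (fin_part z) else 0) \<partial>\<mu>)"
    by (rule Bochner_Integration.integral_cong) auto
  finally show ?thesis .
qed

end

lemma tail_measure_finite_part:
  assumes Radon: "Radon0 N \<mu>"
    and scale: "\<And>t A. t > 0 \<Longrightarrow> A \<in> sets \<mu> \<Longrightarrow> emeasure \<mu> (ext_scale t ` A) = ennreal (t powr - \<alpha>) * emeasure \<mu> A"
  shows "tail_measure \<alpha> (finite_part \<mu>)"
  unfolding tail_measure_def
proof (intro conjI allI impI ballI)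
  have sets: "sets \<mu> = sets punctured"
    using Radon by (simp add: Radon0_def)
  note e = emeasure_finite_part[OF sets]
  have meas: "ext ` (A - {0}) \<in> sets \<mu>" if "A \<in> sets borel" for A
    using that ext_image_borel[of "A - {0}"] by (auto simp: sets sets_punctured)
  show "sets (finite_part \<mu>) = sets borel"
    by (simp add: finite_part_def)
  show "emeasure (finite_part \<mu>) {0} = 0"
    using e[of "{0}"] by simp
  have "- ext ` {x. N x < 1} \<in> sets \<mu>"
  proof -
    have "open {x. N x < 1}"
      by (intro open_Collect_less continuous_intros)
    then have "ext ` {x. N x < 1} \<in> sets borel"
      by (intro borel_open open_ext_image)
    then show ?thesis
      by (auto simp: sets sets_punctured image_iff borel_comp intro!: exI[of _ 0])
  qed
  then have "emeasure \<mu> (ext ` ({x. 1 \<le> N x} - {0})) \<le> emeasure \<mu> (- ext ` {x. N x < 1})"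
    by (intro emeasure_mono) (auto simp: not_le[symmetric])
  also have "\<dots> < \<infinity>"
    using Radon by (simp add: Radon0_def)
  finally show "emeasure (finite_part \<mu>) {x. 1 \<le> N x} < \<infinity>"
    using e[OF sets_tail(1)] by simp
  fix t :: real and A :: "(real ^ 'd) set"
  assume t: "t > 0" and A: "A \<in> sets borel"
  let ?g = "\<lambda>x::real ^ 'd. t *\<^sub>R x"
  have gA: "?g -` A \<in> sets borel"
    using measurable_sets[of ?g borel borel A] A by simp
  \<comment> \<open>Preimages under multiplication by \<open>t\<close> are images under
    multiplication by \<open>1 / t\<close>; this accounts for the sign of the exponent in
    \<open>tail_measure\<close>.\<close>
  have "ext_scale (1 / t) ` ext ` (A - {0}) = ext ` (?g -` A - {0})"
  proof (intro set_eqI iffI)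
    have s: "ext_scale a (ext x) = ext (a *\<^sub>R x)" for a x
      by (simp add: ext_scale_def ext_def vec_eq_iff)
    fix z
    show "z \<in> ext ` (?g -` A - {0})" if z: "z \<in> ext_scale (1 / t) ` ext ` (A - {0})"
      using z t by (auto simp: s intro!: imageI)
    show "z \<in> ext_scale (1 / t) ` ext ` (A - {0})" if z: "z \<in> ext ` (?g -` A - {0})"
    proof -
      from z obtain x where x: "z = ext x" "t *\<^sub>R x \<in> A" "x \<noteq> 0" by auto
      then have "z = ext_scale (1 / t) (ext (t *\<^sub>R x))" "t *\<^sub>R x \<in> A - {0}"
        using t by (auto simp: s)
      then show ?thesis by blast
    qed
  qed
  then show "emeasure (finite_part \<mu>) (?g -` A) = ennreal (t powr \<alpha>) * emeasure (finite_part \<mu>) A"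
    unfolding e[OF A] e[OF gA] using scale[of "1 / t", OF _ meas[OF A]] t
    by (simp add: powr_divide powr_minus_divide)
qed

end

section \<open>Consequences of regular variation\<close>

abbreviation survival :: "'w measure \<Rightarrow> (real ^ 'd \<Rightarrow> real) \<Rightarrow> ('w \<Rightarrow> real ^ 'd) \<Rightarrow> real \<Rightarrow> real" where
  "survival M N X s \<equiv> measure M {\<omega> \<in> space M. N (X \<omega>) > s}"

context vector_norm
begin

lemma tail_measure_null: "tail_measure \<alpha> (null_measure borel)"
  by (simp add: tail_measure_def)

lemma ramp:
  assumes "0 < a" "a < b"
  defines "g \<equiv> \<lambda>x::real ^ 'd. max 0 (min 1 ((N x - a) / (b - a)))"
  shows "continuous_on UNIV g" "0 \<le> g x" "g x \<le> 1" "N x \<le> a \<Longrightarrow> g x = 0" "b \<le> N x \<Longrightarrow> g x = 1"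
  using assms(1,2) unfolding g_def
  by (auto intro!: continuous_intros simp: divide_nonpos_pos field_simps)

context
  fixes M :: "'w measure" and X :: "'w \<Rightarrow> real ^ 'd" and \<alpha> :: real and \<mu> :: "(ereal ^ 'd) measure"
  assumes prob: "prob_space M" and RV: "RV M N X \<alpha> \<mu>"
begin

interpretation prob_space M by (rule prob)

lemma RV_measurable [measurable]: "X \<in> borel_measurable M"
  and RV_sets: "sets \<mu> = sets punctured"
  and RV_vague: "vague_conv0 (normalized_law M N X X) \<mu>"
  and RV_index: "\<alpha> > 0"
  using RV by (auto simp: RV_def regularly_varying_def Radon0_def)

lemma RV_tail_measure: "tail_measure \<alpha> (finite_part \<mu>)"
  using RV by (intro tail_measure_finite_part) (auto simp: RV_def regularly_varying_def)

lemma RV_infinite_null: "- range ext \<in> null_sets \<mu>"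
proof -
  have "- range ext \<in> sets \<mu>"
    unfolding RV_sets sets_punctured using sets_range_ext rangeI[of ext 0] by simp
  then show ?thesis
    using RV by (auto simp: RV_def regularly_varying_def)
qed

lemma RV_finite_part_nonzero: "emeasure (finite_part \<mu>) UNIV \<noteq> 0"
proof -
  have "ext ` (UNIV - {0}) \<in> sets \<mu>"
    using ext_image_borel[of "UNIV - {0}"] by (auto simp: RV_sets sets_punctured)
  then have "emeasure \<mu> (ext ` (UNIV - {0}) \<union> - range ext) = emeasure \<mu> (ext ` (UNIV - {0}))"
    using RV_infinite_null by (intro emeasure_Un_null_set)
  moreover have "ext ` (UNIV - {0}) \<union> - range ext = space \<mu>"
  proof -
    have "(0 :: ereal ^ 'd) \<in> range ext"
      using rangeI[of ext 0] by simp
    moreover have "ext ` (UNIV - {0}) = range ext - {0}"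
      by auto
    ultimately show ?thesis
      unfolding sets_eq_imp_space_eq[OF RV_sets] space_punctured by blast
  qed
  ultimately show ?thesis
    using RV emeasure_finite_part[OF RV_sets, of UNIV] by (auto simp: RV_def regularly_varying_def)
qed

lemma RV_test_limit:
  assumes f: "test_function B \<delta> f"
  shows "((\<lambda>s. (\<integral>\<omega>. f (inverse s *\<^sub>R X \<omega>) \<partial>M) / survival M N X s) \<longlongrightarrow> (\<integral>x. f x \<partial>finite_part \<mu>)) at_top"
proof -
  let ?F = "\<lambda>z. if z \<in> range ext then f (fin_part z) else 0"
  obtain R where R: "\<And>x. N x > R \<Longrightarrow> f x = 0"
    using f by (auto simp: test_function_def)
  have cont: "continuous_on UNIV ?F"
    using f by (intro continuous_extension_by_0[OF _ R]) (auto simp: test_function_def)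
  then have cont0: "continuous_on (- {0}) ?F"
    by (rule continuous_on_subset) simp
  have "?F \<in> Cc0"
    by (rule Cc0_I[OF cont0 test_functionD(3)[OF f]]) (simp add: test_functionD(4)[OF f])
  then have "((\<lambda>s. \<integral>z. ?F z \<partial>normalized_law M N X X s) \<longlongrightarrow> (\<integral>z. ?F z \<partial>\<mu>)) at_top"
    using RV_vague by (auto simp: vague_conv0_def)
  moreover have "(\<integral>z. ?F z \<partial>normalized_law M N X X s) = (\<integral>\<omega>. f (inverse s *\<^sub>R X \<omega>) \<partial>M) / survival M N X s" for s
  proof -
    have "f 0 = 0" using test_functionD(3)[OF f] test_functionD(4)[OF f, of 0] by simp
    then have "(if X \<omega> = 0 \<or> s = 0 then 0 else ?F (ext (inverse s *\<^sub>R X \<omega>))) = f (inverse s *\<^sub>R X \<omega>)" for \<omega>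
      by auto
    then show ?thesis
      by (simp only: integral_normalized_law[OF RV_measurable cont0])
  qed
  ultimately show ?thesis
    unfolding integral_finite_part[OF RV_sets test_functionD(1)[OF f]] by simp
qed

lemma survival_antimono: "s \<le> t \<Longrightarrow> survival M N X t \<le> survival M N X s"
  by (intro finite_measure_mono) auto

text \<open>If the survival function vanished at some \<open>s\<close>, it would vanish from there
  on, the normalised laws would be null by the convention for division by 0, and so would their
  limit, against \<open>RV_finite_part_nonzero\<close>.\<close>

lemma RV_survival_pos: "survival M N X s > 0"
proof (rule ccontr)
  assume "\<not> survival M N X s > 0"
  then have 0: "survival M N X t = 0" if "t \<ge> s" for t
    using survival_antimono[OF that] measure_nonneg[of M "{\<omega> \<in> space M. N (X \<omega>) > t}"] by linarith
  have int0: "(\<integral>x. f x \<partial>finite_part \<mu>) = 0" if f: "test_function B \<delta> f" for B \<delta> f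
  proof -
    have "((\<lambda>s. (\<integral>\<omega>. f (inverse s *\<^sub>R X \<omega>) \<partial>M) / survival M N X s) \<longlongrightarrow> 0) at_top"
      using eventually_ge_at_top[of s] by (rule tendsto_eventually[OF eventually_mono]) (simp add: 0)
    then show ?thesis
      using RV_test_limit[OF f] tendsto_unique trivial_limit_at_top_linorder by blast
  qed
  have "emeasure (finite_part \<mu>) UNIV \<le> emeasure (null_measure borel) (UNIV :: (real ^ 'd) set)"
    by (rule emeasure_le_of_test_functions[OF RV_tail_measure tail_measure_null])
       (simp_all add: int0 integral_null_measure)
  then show False
    using RV_finite_part_nonzero by simp
qed

text \<open>An upper bound is enough for the contraction. A continuous cutoff rising between radii
  \<open>t / 2\<close> and \<open>t\<close> dominates the indicator of the exterior of the latter;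
  its limiting integral is at most the mass outside radius \<open>t / 2\<close>, which explains the
  factor \<open>2 powr \<alpha>\<close>.\<close>

lemma RV_survival_ratio:
  assumes t: "t > 0" and \<eta>: "\<eta> > 0"
  shows "\<forall>\<^sub>F s in at_top. survival M N X (t * s) / survival M N X s \<le>
    2 powr \<alpha> * measure (finite_part \<mu>) {x. 1 \<le> N x} * t powr - \<alpha> + \<eta>"
proof -
  \<comment> \<open>The complementary cutoff has bounded support and so can be extended continuously
    by 0.\<close>
  define \<phi> where "\<phi> x = 1 - max 0 (min 1 ((N x - t / 2) / (t - t / 2)))" for x
  have \<phi>: "continuous_on UNIV \<phi>" "0 \<le> \<phi> x" "\<phi> x \<le> 1" "N x \<le> t / 2 \<Longrightarrow> \<phi> x = 1" "t \<le> N x \<Longrightarrow> \<phi> x = 0" for x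
    using ramp[of "t / 2" t] t by (auto simp: \<phi>_def intro!: continuous_intros)
  \<comment> \<open>Equal to 1 at the infinite points as well: this is where no mass is lost at infinity.\<close>
  define F where "F z = 1 - (if z \<in> range ext then \<phi> (fin_part z) else 0)" for z
  have cont: "continuous_on UNIV F"
    unfolding F_def using \<phi>(1,5) by (intro continuous_intros continuous_extension_by_0[of \<phi> t]) auto
  have F: "0 \<le> F z" "F z \<le> 1" for z
    using \<phi>(2,3) by (auto simp: F_def)
  have F_ext: "F (ext x) = 1 - \<phi> x" for x
    by (simp add: F_def)
  have cont0: "continuous_on (- {0}) F"
    using cont by (rule continuous_on_subset) simp
  have "F \<in> Cc0"
    by (rule Cc0_I[OF cont0, of "t / 2"]) (use t \<phi>(4) in \<open>auto simp: F_ext\<close>)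
  then have lim: "((\<lambda>s. \<integral>z. F z \<partial>normalized_law M N X X s) \<longlongrightarrow> (\<integral>z. F z \<partial>\<mu>)) at_top"
    using RV_vague by (auto simp: vague_conv0_def)
  let ?S = "- ext ` {x. N x < t / 2}"
  have S: "?S = ext ` ({x. t / 2 \<le> N x} - {0}) \<union> - range ext"
    using t by (auto simp: not_less image_iff)
  have tail: "ext ` ({x. t / 2 \<le> N x} - {0}) \<in> sets \<mu>"
    using ext_image_borel[of "{x. t / 2 \<le> N x} - {0}"] by (auto simp: RV_sets sets_punctured)
  then have S_sets: "?S \<in> sets \<mu>"
    unfolding S using RV_infinite_null by auto
  have S_emeasure: "emeasure \<mu> ?S = emeasure (finite_part \<mu>) {x. t / 2 \<le> N x}"
    unfolding S emeasure_finite_part[OF RV_sets sets_tail(1)] by (rule emeasure_Un_null_set[OF tail RV_infinite_null])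
  have S_fin: "emeasure \<mu> ?S < \<infinity>"
    unfolding S_emeasure by (rule emeasure_tail_finite[OF RV_tail_measure]) (use t in simp)
  have "(\<integral>z. F z \<partial>\<mu>) \<le> (\<integral>z. indicator ?S z \<partial>\<mu>)"
  proof (rule integral_mono')
    show "integrable \<mu> (indicator ?S :: _ \<Rightarrow> real)"
      by (rule integrable_real_indicator[OF S_sets S_fin])
    show "F z \<le> indicator ?S z" for z
      using F(2)[of z] \<phi>(4) by (auto simp: indicator_def F_ext)
  qed simp
  also have "\<dots> = measure \<mu> ?S"
    using S_sets sets.sets_into_space[OF S_sets] by (simp add: Int_absorb2)
  also have "\<dots> = (t / 2) powr - \<alpha> * measure (finite_part \<mu>) {x. 1 \<le> N x}"
    using measure_tail[OF RV_tail_measure, of "t / 2"] S_emeasure t by (simp add: measure_def)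
  also have "(t / 2) powr - \<alpha> = 2 powr \<alpha> * t powr - \<alpha>"
    using t by (simp add: powr_divide powr_minus field_simps)
  finally have "(\<integral>z. F z \<partial>\<mu>) < 2 powr \<alpha> * measure (finite_part \<mu>) {x. 1 \<le> N x} * t powr - \<alpha> + \<eta>"
    using \<eta> by (simp add: mult_ac)
  then have "\<forall>\<^sub>F s in at_top. (\<integral>z. F z \<partial>normalized_law M N X X s) < 2 powr \<alpha> * measure (finite_part \<mu>) {x. 1 \<le> N x} * t powr - \<alpha> + \<eta>"
    by (rule order_tendstoD(2)[OF lim])
  then show ?thesis
    using eventually_gt_at_top[of 0]
  proof eventually_elim
    case (elim s)
    let ?h = "\<lambda>\<omega>. if X \<omega> = 0 \<or> s = 0 then 0 else F (ext (inverse s *\<^sub>R X \<omega>))"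
    have [measurable]: "F \<in> borel_measurable borel"
      using cont by (rule borel_measurable_continuous_onI)
    have "survival M N X (t * s) = (\<integral>\<omega>. indicator {\<omega> \<in> space M. N (X \<omega>) > t * s} \<omega> \<partial>M)"
      by simp
    also have "\<dots> \<le> (\<integral>\<omega>. ?h \<omega> \<partial>M)"
    proof (rule integral_mono)
      show "integrable M (indicator {\<omega> \<in> space M. N (X \<omega>) > t * s} :: _ \<Rightarrow> real)"
        by (intro integrable_real_indicator) (auto simp: emeasure_eq_measure)
      show "integrable M ?h"
        by (rule integrable_const_bound[of _ 1]) (use F in auto)
      fix \<omega> assume "\<omega> \<in> space M"
      have "t \<le> N (inverse s *\<^sub>R X \<omega>)" "X \<omega> \<noteq> 0" if "t * s < N (X \<omega>)"
        using that elim(2) t by (auto simp: N_scaleR field_simps mult_less_0_iff)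
      then show "indicator {\<omega> \<in> space M. N (X \<omega>) > t * s} \<omega> \<le> ?h \<omega>"
        using F(1) elim(2) \<phi>(3,5) by (auto simp: indicator_def F_ext)
    qed
    finally have "survival M N X (t * s) / survival M N X s \<le> (\<integral>z. F z \<partial>normalized_law M N X X s)"
      unfolding integral_normalized_law[OF RV_measurable cont0] by (intro divide_right_mono) auto
    then show ?case
      using elim(1) by linarith
  qed
qed

end

end

section \<open>The single big jump\<close>

context vector_norm
begin

lemma test_function_uniformly_continuous:
  assumes f: "test_function B \<delta> f" and \<eta>: "\<eta> > 0"
  obtains \<epsilon> where "\<epsilon> > 0" "\<And>x y. N (x - y) \<le> \<epsilon> \<Longrightarrow> \<bar>f x - f y\<bar> \<le> \<eta>"
proof -
  obtain R where R: "\<And>x. N x > R \<Longrightarrow> f x = 0"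
    using f by (auto simp: test_function_def)
  obtain m where m: "m > 0" "\<And>x. m * norm x \<le> N x"
    using norm_le_N by blast
  have "continuous_on {x. N x \<le> R + 1} f"
    using f by (auto simp: test_function_def intro: continuous_on_subset)
  then have "uniformly_continuous_on {x. N x \<le> R + 1} f"
    by (rule compact_uniformly_continuous[OF _ compact_N_le])
  then obtain d where d: "d > 0"
    "\<And>x y. N x \<le> R + 1 \<Longrightarrow> N y \<le> R + 1 \<Longrightarrow> dist y x < d \<Longrightarrow> dist (f y) (f x) < \<eta>"
    using \<eta> unfolding uniformly_continuous_on_def by (metis mem_Collect_eq)
  show thesis
  proof
    \<comment> \<open>With distance at most 1, either both points lie in the compact ball of radius
      \<open>R + 1\<close>, or both lie outside radius \<open>R\<close>, where \<open>f\<close> is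
      0.\<close>
    show "min 1 (m * d / 2) > 0" using m(1) d(1) by simp
    fix x y assume xy: "N (x - y) \<le> min 1 (m * d / 2)"
    show "\<bar>f x - f y\<bar> \<le> \<eta>"
    proof (cases "N x \<le> R + 1 \<and> N y \<le> R + 1")
      case True
      have "m * norm (x - y) \<le> m * (d / 2)"
        using m(2)[of "x - y"] xy by simp
      then have "dist x y < d"
        using m(1) d(1) by (simp add: dist_norm)
      then show ?thesis
        using d(2)[of y x] True by (simp add: dist_real_def)
    next
      case False
      have "N x \<le> N y + N (x - y)" "N y \<le> N x + N (x - y)"
        using N_triangle_diff[of x y] N_triangle_diff[of y x] N_minus[of "x - y"] by simp_all
      then have "N x > R" "N y > R"
        using False xy by auto
      then show ?thesis using R \<eta> by simp
    qed
  qed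
qed

text \<open>A pointwise inequality with three cases. If two summands exceed
  \<open>\<epsilon>\<close>, the left side is bounded trivially by \<open>(card I + 1) * B\<close>.
  If none does, every term is 0. If exactly one does, the sum differs from it by at most
  \<open>card I * \<epsilon>\<close> and uniform continuity applies.\<close>

lemma one_big_jump:
  fixes y :: "nat \<Rightarrow> real ^ 'd" and B \<delta> \<eta> \<epsilon> :: real
  assumes f: "test_function B \<delta> f" and I: "finite I" and \<eta>: "\<eta> \<ge> 0"
    and \<epsilon>: "\<epsilon> > 0" "card I * \<epsilon> \<le> \<delta> / 2"
    and uc: "\<And>x x'. N (x - x') \<le> card I * \<epsilon> \<Longrightarrow> \<bar>f x - f x'\<bar> \<le> \<eta>"
  shows "\<bar>f (\<Sum>j\<in>I. y j) - (\<Sum>j\<in>I. f (y j))\<bar> \<le> \<eta> * (\<Sum>j\<in>I. of_bool (\<delta> / 4 < N (y j))) +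
    (card I + 1) * B * (\<Sum>i\<in>I. \<Sum>j\<in>I - {i}. of_bool (\<epsilon> < N (y i) \<and> \<epsilon> < N (y j)))"
proof -
  note fD = test_functionD[OF f]
  let ?A = "\<Sum>j\<in>I. of_bool (\<delta> / 4 < N (y j)) :: real"
  let ?D = "\<Sum>i\<in>I. \<Sum>j\<in>I - {i}. of_bool (\<epsilon> < N (y i) \<and> \<epsilon> < N (y j)) :: real"
  have A: "?A \<ge> 0" and D: "?D \<ge> 0" by (auto intro!: sum_nonneg)
  have nonneg: "0 \<le> \<eta> * ?A" "0 \<le> (card I + 1) * B * ?D"
    using A D \<eta> fD(5) by auto
  have zero: "f x = 0" if "N x \<le> \<delta> / 2" for x
    using fD(4)[of x] that fD(3) by simp
  show ?thesis
  proof (cases "\<exists>i\<in>I. \<exists>j\<in>I - {i}. \<epsilon> < N (y i) \<and> \<epsilon> < N (y j)")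
    case True
    then obtain i j where ij: "i \<in> I" "j \<in> I - {i}" "\<epsilon> < N (y i)" "\<epsilon> < N (y j)" by blast
    have "1 \<le> (\<Sum>j\<in>I - {i}. of_bool (\<epsilon> < N (y i) \<and> \<epsilon> < N (y j)) :: real)"
      using member_le_sum[of j "I - {i}" "\<lambda>j. of_bool (\<epsilon> < N (y i) \<and> \<epsilon> < N (y j)) :: real"] ij I by simp
    also have "\<dots> \<le> ?D"
      by (rule member_le_sum[of i I]) (use ij I in \<open>auto intro: sum_nonneg\<close>)
    finally have "(card I + 1) * B * 1 \<le> (card I + 1) * B * ?D"
      using fD(5) by (intro mult_left_mono) auto
    moreover have "\<bar>\<Sum>j\<in>I. f (y j)\<bar> \<le> card I * B"
      by (rule order_trans[OF sum_abs]) (rule sum_bounded_above[OF fD(2)])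
    ultimately show ?thesis
      using nonneg(1) fD(2)[of "\<Sum>j\<in>I. y j"] by (simp add: algebra_simps)
  next
    case False
    show ?thesis
    proof (cases "\<exists>k\<in>I. \<epsilon> < N (y k)")
      case none: False
      have "\<epsilon> \<le> card I * \<epsilon>" if "j \<in> I" for j
      proof -
        have "1 \<le> card I" using that I card_gt_0_iff[of I] by force
        then show ?thesis using \<epsilon>(1) by simp
      qed
      then have "f (y j) = 0" if "j \<in> I" for j
        using none that \<epsilon>(2) by (intro zero) (meson not_le order_trans)
      moreover have "f (\<Sum>j\<in>I. y j) = 0"
      proof (rule zero)
        have "N (\<Sum>j\<in>I. y j) \<le> (\<Sum>j\<in>I. N (y j))"
          by (rule N_sum[OF I])
        also have "\<dots> \<le> card I * \<epsilon>"
          using none by (intro sum_bounded_above) (auto simp: not_less)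
        finally show "N (\<Sum>j\<in>I. y j) \<le> \<delta> / 2" using \<epsilon>(2) by simp
      qed
      ultimately show ?thesis using nonneg by simp
    next
      case True
      then obtain k where k: "k \<in> I" "\<epsilon> < N (y k)" by blast
      have small: "N (y j) \<le> \<epsilon>" if "j \<in> I - {k}" for j
        using False k that by (meson not_less)
      have "1 \<le> card I" using k(1) I card_gt_0_iff[of I] by force
      then have "\<epsilon> \<le> card I * \<epsilon>" using \<epsilon>(1) by simp
      then have "f (y j) = 0" if "j \<in> I - {k}" for j
        using small[OF that] \<epsilon>(2) by (intro zero) linarith
      then have sum: "(\<Sum>j\<in>I. f (y j)) = f (y k)"
        using I k(1) by (simp add: sum.remove)
      have "(\<Sum>j\<in>I. y j) - y k = (\<Sum>j\<in>I - {k}. y j)"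
        using I k(1) by (simp add: sum.remove)
      then have "N ((\<Sum>j\<in>I. y j) - y k) \<le> (\<Sum>j\<in>I - {k}. N (y j))"
        using N_sum[of "I - {k}" y] I by simp
      also have "\<dots> \<le> card (I - {k}) * \<epsilon>"
        using small by (intro sum_bounded_above) auto
      also have "\<dots> \<le> card I * \<epsilon>"
        using \<epsilon>(1) I by (intro mult_right_mono) (auto intro: card_mono)
      finally have near: "N ((\<Sum>j\<in>I. y j) - y k) \<le> card I * \<epsilon>" .
      show ?thesis
      proof (cases "\<delta> / 4 < N (y k)")
        case True
        have "1 \<le> ?A"
          using member_le_sum[of k I "\<lambda>j. of_bool (\<delta> / 4 < N (y j)) :: real"] I k(1) True by simp
        then have "\<eta> * 1 \<le> \<eta> * ?A"
          using \<eta> by (rule mult_left_mono)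
        then show ?thesis
          using uc[OF near] nonneg(2) unfolding sum by simp
      next
        \<comment> \<open>The other summands add at most \<open>\<delta> / 2\<close>, so the sum
          stays inside the ball of radius \<open>\<delta>\<close>. Hence \<open>\<eta>\<close> is
          charged only when a summand exceeds \<open>\<delta> / 4\<close>, an event whose
          probability is comparable with \<open>P(|X| > s)\<close>.\<close>
        case False
        have "f (\<Sum>j\<in>I. y j) = 0" "f (y k) = 0"
          using N_triangle_diff[of "\<Sum>j\<in>I. y j" "y k"] near \<epsilon>(2) False fD(3) by (intro fD(4), linarith)+
        then show ?thesis unfolding sum using nonneg by simp
      qed
    qed
  qed
qed

lemma tail_measure_distr:
  assumes \<nu>: "tail_measure \<alpha> \<nu>" and A: "invertible (A :: real ^ 'd ^ 'd)"
  shows "tail_measure \<alpha> (distr \<nu> borel ((*v) A))"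
proof -
  note D = tail_measureD[OF \<nu>]
  obtain c where c: "c > 0" "\<And>x. c * N x \<le> N (A *v x)"
    using invertible_expands[OF A] by blast
  have meas: "(*v) A \<in> measurable \<nu> borel"
    by (subst measurable_cong_sets[OF D(1) refl]) simp
  have e: "emeasure (distr \<nu> borel ((*v) A)) B = emeasure \<nu> ((*v) A -` B)" if "B \<in> sets borel" for B
    using emeasure_distr[OF meas that] D(5) by simp
  show ?thesis
    unfolding tail_measure_def
  proof (intro conjI allI impI ballI)
    have "x = 0" if "A *v x = 0" for x
      using c(2)[of x] c(1) that N_pos_iff[of x] by (simp add: mult_le_0_iff)
    then have "(*v) A -` {0} = {0}" by auto
    then show "emeasure (distr \<nu> borel ((*v) A)) {0} = 0"
      using e[of "{0}"] D(2) by simp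
    have "(*v) A -` {x. 1 \<le> N x} \<subseteq> {x. 1 / op_norm N A \<le> N x}"
      using order_trans[OF _ N_matrix_le] op_norm_pos[OF A] by (auto simp: field_simps)
    then have "emeasure \<nu> ((*v) A -` {x. 1 \<le> N x}) < \<infinity>"
      using op_norm_pos[OF A] by (intro emeasure_away_from_0_finite[OF \<nu>]) auto
    then show "emeasure (distr \<nu> borel ((*v) A)) {x. 1 \<le> N x} < \<infinity>"
      using e[OF sets_tail(1)] by simp
    fix t :: real and B :: "(real ^ 'd) set"
    assume t: "t > 0" and B: "B \<in> sets borel"
    let ?g = "\<lambda>x::real ^ 'd. t *\<^sub>R x"
    have gB: "?g -` B \<in> sets borel" using measurable_sets[of ?g borel borel B] B by simp
    have "(*v) A -` (?g -` B) = ?g -` ((*v) A -` B)"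
      by (auto simp: matrix_vector_mult_scaleR)
    then show "emeasure (distr \<nu> borel ((*v) A)) (?g -` B) = ennreal (t powr \<alpha>) * emeasure (distr \<nu> borel ((*v) A)) B"
      unfolding e[OF B] e[OF gB] using D(4)[OF t, of "(*v) A -` B"] measurable_sets[OF borel_measurable_matrix B, of A] by simp
  qed simp
qed

end

text \<open>The survival function is one minus the distribution function of the real variable
  \<open>N (Y \<omega>)\<close>.\<close>

lemma (in prob_space) survival_tendsto_0:
  assumes "(\<lambda>\<omega>. N (Y \<omega>)) \<in> borel_measurable M"
  shows "(survival M N Y \<longlongrightarrow> 0) at_top"
proof -
  interpret D: real_distribution "distr M borel (\<lambda>\<omega>. N (Y \<omega>))"
    using assms by (rule real_distribution_distr)
  have "survival M N Y s = 1 - cdf (distr M borel (\<lambda>\<omega>. N (Y \<omega>))) s" for s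
  proof -
    have "cdf (distr M borel (\<lambda>\<omega>. N (Y \<omega>))) s = measure M {\<omega> \<in> space M. N (Y \<omega>) \<le> s}"
      unfolding cdf_def using assms by (subst measure_distr) (auto intro!: arg_cong[of _ _ "measure M"])
    moreover have "{\<omega> \<in> space M. N (Y \<omega>) > s} = space M - {\<omega> \<in> space M. N (Y \<omega>) \<le> s}"
      by auto
    moreover have "{\<omega> \<in> space M. N (Y \<omega>) \<le> s} \<in> sets M"
      using assms by measurable
    ultimately show ?thesis
      by (simp add: prob_compl)
  qed
  moreover have "((\<lambda>s. 1 - cdf (distr M borel (\<lambda>\<omega>. N (Y \<omega>))) s) \<longlongrightarrow> 1 - 1) at_top"
    by (intro tendsto_intros D.cdf_lim_at_top_prob)
  ultimately show ?thesis by simp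
qed

section \<open>The filter: tail bounds for the noise and the expectation of one big jump\<close>

locale linear_filter = vector_norm N + prob_space M
  for N :: "real ^ 'd \<Rightarrow> real" and M :: "'w measure" +
  fixes q :: nat and \<Psi> :: "nat \<Rightarrow> real ^ 'd ^ 'd" and Zs :: "nat \<Rightarrow> 'w \<Rightarrow> real ^ 'd" and Z X :: "'w \<Rightarrow> real ^ 'd"
    and \<alpha> :: real and \<mu>X :: "(ereal ^ 'd) measure"
  assumes q: "q \<ge> 1" and indep: "indep_vars (\<lambda>_. borel) Zs {1..q}"
    and Z [measurable]: "Z \<in> borel_measurable M"
    and identical: "\<And>j. j \<in> {1..q} \<Longrightarrow> distr M borel (Zs j) = distr M borel Z"
    and X_eq: "X = (\<lambda>\<omega>. \<Sum>j=1..q. \<Psi> j *v Zs j \<omega>)"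
    and RV: "RV M N X \<alpha> \<mu>X"
    and invertible: "\<And>j. j \<in> {1..q} \<Longrightarrow> invertible (\<Psi> j)"
    and dominant: "(min_stretch N (\<Psi> 1)) powr \<alpha> > (\<Sum>j=2..q. (op_norm N (\<Psi> j)) powr \<alpha>)"
begin

abbreviation "G \<equiv> survival M N X"
abbreviation "H \<equiv> survival M N Z"
abbreviation "S j \<equiv> survival M N (\<lambda>\<omega>. \<Psi> j *v Z \<omega>)"
abbreviation "\<gamma> \<equiv> min_stretch N (\<Psi> 1)"

lemma Zs [measurable]: "j \<in> {1..q} \<Longrightarrow> Zs j \<in> borel_measurable M"
  using indep by (simp add: indep_vars_def)

lemmas X [measurable] = RV_measurable[OF prob_space_axioms RV]
lemmas G_pos = RV_survival_pos[OF prob_space_axioms RV]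
lemmas G_ratio = RV_survival_ratio[OF prob_space_axioms RV]

text \<open>The dominance inequality is strict and its right side is nonnegative, while
  \<open>0 powr \<alpha> = 0\<close>.\<close>

lemma \<gamma>_pos: "\<gamma> > 0"
proof -
  have "\<gamma> powr \<alpha> > 0"
    by (rule le_less_trans[OF _ dominant]) (simp add: sum_nonneg)
  then show ?thesis
    using min_stretch_nonneg[of "\<Psi> 1"] by (cases "\<gamma> = 0") auto
qed

lemma prob_Zs:
  assumes "j \<in> {1..q}" "A \<in> sets borel"
  shows "prob (Zs j -` A \<inter> space M) = prob (Z -` A \<inter> space M)"
  using measure_distr[OF Zs[OF assms(1)] assms(2)] measure_distr[OF Z assms(2)] identical[OF assms(1)] by simp

lemma expectation_Zs:
  fixes f :: "real ^ 'd \<Rightarrow> real"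
  assumes "j \<in> {1..q}" "f \<in> borel_measurable borel"
  shows "(\<integral>\<omega>. f (Zs j \<omega>) \<partial>M) = (\<integral>\<omega>. f (Z \<omega>) \<partial>M)"
  using integral_distr[OF Zs[OF assms(1)] assms(2)] integral_distr[OF Z assms(2)] identical[OF assms(1)] by simp

lemma prob_pair:
  assumes "i \<in> {1..q}" "j \<in> {1..q}" "i \<noteq> j" "A \<in> sets borel" "B \<in> sets borel"
  shows "prob {\<omega> \<in> space M. Zs i \<omega> \<in> A \<and> Zs j \<omega> \<in> B} = prob {\<omega> \<in> space M. Z \<omega> \<in> A} * prob {\<omega> \<in> space M. Z \<omega> \<in> B}"
proof -
  let ?C = "\<lambda>k. if k = i then A else B"
  have "prob (\<Inter>k\<in>{i, j}. Zs k -` ?C k \<inter> space M) = (\<Prod>k\<in>{i, j}. prob (Zs k -` ?C k \<inter> space M))"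
    by (rule indep_varsD[OF indep]) (use assms in auto)
  also have "\<dots> = prob (Z -` A \<inter> space M) * prob (Z -` B \<inter> space M)"
    using assms prob_Zs[of i A] prob_Zs[of j B] by simp
  also have "(\<Inter>k\<in>{i, j}. Zs k -` ?C k \<inter> space M) = {\<omega> \<in> space M. Zs i \<omega> \<in> A \<and> Zs j \<omega> \<in> B}"
    using assms(3) by auto
  also have "Z -` A \<inter> space M = {\<omega> \<in> space M. Z \<omega> \<in> A}" by auto
  also have "Z -` B \<inter> space M = {\<omega> \<in> space M. Z \<omega> \<in> B}" by auto
  finally show ?thesis .
qed

lemma S_tendsto_0: "a > 0 \<Longrightarrow> ((\<lambda>s. S j (a * s)) \<longlongrightarrow> 0) at_top"
  by (rule filterlim_compose[OF survival_tendsto_0])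
     (auto intro!: filterlim_tendsto_pos_mult_at_top[OF tendsto_const] filterlim_ident)

lemma sets_matrix_tail: "{z. a < N (A *v z)} \<in> sets borel"
  by measurable

text \<open>The factor 2 comes from absorption. The exceptional event, where the first noise vector
  and some other summand are both large, has by independence a probability at most
  \<open>H s\<close> times a quantity tending to 0, so eventually at most \<open>H s / 2\<close>;
  this is moved to the left side.\<close>

lemma H_le_G: "\<forall>\<^sub>F s in at_top. H s \<le> 2 * G (\<gamma> / 2 * s)"
proof -
  \<comment> \<open>At most \<open>q\<close> summands below \<open>\<gamma> / (2 * q) * s\<close>
    can cancel only half of the \<open>\<gamma> * s\<close> guaranteed by the first one.\<close>
  let ?a = "\<gamma> / (2 * q)"
  have a: "?a > 0" using \<gamma>_pos q by simp
  have "((\<lambda>s. \<Sum>j=2..q. S j (?a * s)) \<longlongrightarrow> (\<Sum>j=2..q. 0)) at_top"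
    by (intro tendsto_sum S_tendsto_0 a)
  then have "\<forall>\<^sub>F s in at_top. (\<Sum>j=2..q. S j (?a * s)) < 1 / 2"
    by (intro order_tendstoD(2)) auto
  then show ?thesis
    using eventually_gt_at_top[of 0]
  proof eventually_elim
    case (elim s)
    have 1: "1 \<in> {1..q}" using q by simp
    let ?E = "{\<omega> \<in> space M. Zs 1 \<omega> \<in> {z. s < N z}}"
    let ?EF = "\<lambda>j. {\<omega> \<in> space M. Zs 1 \<omega> \<in> {z. s < N z} \<and> Zs j \<omega> \<in> {z. ?a * s < N (\<Psi> j *v z)}}"
    have EF: "prob (?EF j) = H s * S j (?a * s)" if "j \<in> {2..q}" for j
      using prob_pair[OF 1, of j "{z. s < N z}" "{z. ?a * s < N (\<Psi> j *v z)}"] that sets_matrix_tail sets_tail(2) by simp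
    have EF_sets: "?EF j \<in> sets M" if "j \<in> {2..q}" for j
    proof -
      have "?EF j = (Zs 1 -` {z. s < N z} \<inter> space M) \<inter> (Zs j -` {z. ?a * s < N (\<Psi> j *v z)} \<inter> space M)"
        by auto
      moreover have "j \<in> {1..q}" using that by simp
      ultimately show ?thesis
        using measurable_sets[OF Zs[OF 1] sets_tail(2)] measurable_sets[OF Zs sets_matrix_tail] by (simp only: sets.Int)
    qed
    have "H s = prob ?E"
      using prob_Zs[OF 1 sets_tail(2), of s] by (simp add: vimage_def Int_def conj_commute)
    also have "\<dots> \<le> prob ({\<omega> \<in> space M. N (X \<omega>) > \<gamma> / 2 * s} \<union> (\<Union>j\<in>{2..q}. ?EF j))"
    proof (rule finite_measure_mono)
      show "?E \<subseteq> {\<omega> \<in> space M. N (X \<omega>) > \<gamma> / 2 * s} \<union> (\<Union>j\<in>{2..q}. ?EF j)"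
      proof
        fix \<omega> assume \<omega>: "\<omega> \<in> ?E"
        show "\<omega> \<in> {\<omega> \<in> space M. N (X \<omega>) > \<gamma> / 2 * s} \<union> (\<Union>j\<in>{2..q}. ?EF j)"
        proof (cases "\<exists>j\<in>{2..q}. ?a * s < N (\<Psi> j *v Zs j \<omega>)")
          case False
          have "{1..q} = insert 1 {2..q}" using q by auto
          then have "\<Psi> 1 *v Zs 1 \<omega> - X \<omega> = - (\<Sum>j=2..q. \<Psi> j *v Zs j \<omega>)"
            by (simp add: X_eq)
          then have "N (\<Psi> 1 *v Zs 1 \<omega> - X \<omega>) \<le> (\<Sum>j=2..q. N (\<Psi> j *v Zs j \<omega>))"
            using N_sum[of "{2..q}"] by simp
          also have "\<dots> \<le> card {2..q} * (?a * s)"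
            using False by (intro sum_bounded_above) (auto simp: not_less)
          also have "\<dots> \<le> q * (?a * s)"
            using \<gamma>_pos elim(2) by (intro mult_right_mono) auto
          also have "\<dots> = \<gamma> / 2 * s"
            using q by simp
          finally have "N (\<Psi> 1 *v Zs 1 \<omega>) \<le> N (X \<omega>) + \<gamma> / 2 * s"
            using N_triangle_diff[of "\<Psi> 1 *v Zs 1 \<omega>" "X \<omega>"] by simp
          moreover have "\<gamma> * s < \<gamma> * N (Zs 1 \<omega>)"
            using \<omega> \<gamma>_pos by simp
          moreover have "\<gamma> * N (Zs 1 \<omega>) \<le> N (\<Psi> 1 *v Zs 1 \<omega>)"
            by (rule N_matrix_ge)
          ultimately show ?thesis using \<omega> by (simp add: field_simps)
        qed (use \<omega> in auto)
      qed
      show "{\<omega> \<in> space M. N (X \<omega>) > \<gamma> / 2 * s} \<union> (\<Union>j\<in>{2..q}. ?EF j) \<in> sets M"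
        using EF_sets by (intro sets.Un sets.finite_UN) auto
    qed
    also have "\<dots> \<le> G (\<gamma> / 2 * s) + prob (\<Union>j\<in>{2..q}. ?EF j)"
      using EF_sets by (intro measure_Un_le sets.finite_UN) auto
    also have "prob (\<Union>j\<in>{2..q}. ?EF j) \<le> (\<Sum>j=2..q. prob (?EF j))"
      using EF_sets by (intro measure_UNION_le) auto
    also have "\<dots> = H s * (\<Sum>j=2..q. S j (?a * s))"
      unfolding sum_distrib_left by (rule sum.cong[OF refl EF])
    also have "\<dots> \<le> H s * (1 / 2)"
      using elim(1) by (intro mult_left_mono) auto
    finally show ?case by simp
  qed
qed

text \<open>The outer factor 2 is that of \<open>H_le_G\<close>; the rest is the bound of
  \<open>RV_survival_ratio\<close> at radius \<open>\<gamma> / 2\<close>.\<close>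

definition K :: real where
  "K = 2 * (2 powr \<alpha> * measure (finite_part \<mu>X) {x. 1 \<le> N x} * (\<gamma> / 2) powr - \<alpha>)"

lemma H_ratio:
  assumes t: "t > 0" and \<eta>: "\<eta> > 0"
  shows "\<forall>\<^sub>F s in at_top. H (t * s) / G s \<le> K * t powr - \<alpha> + \<eta>"
proof -
  have "filterlim (\<lambda>s. t * s) at_top at_top"
    by (rule filterlim_tendsto_pos_mult_at_top[OF tendsto_const t filterlim_ident])
  then have "\<forall>\<^sub>F s in at_top. H (t * s) \<le> 2 * G (\<gamma> / 2 * (t * s))"
    using H_le_G by (rule eventually_compose_filterlim[rotated])
  moreover have "\<forall>\<^sub>F s in at_top. G (\<gamma> / 2 * t * s) / G s \<le>
      2 powr \<alpha> * measure (finite_part \<mu>X) {x. 1 \<le> N x} * (\<gamma> / 2 * t) powr - \<alpha> + \<eta> / 2"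
    using \<gamma>_pos t \<eta> by (intro G_ratio) auto
  ultimately show ?thesis
  proof eventually_elim
    case (elim s)
    have "H (t * s) / G s \<le> 2 * (G (\<gamma> / 2 * t * s) / G s)"
      using divide_right_mono[OF elim(1), of "G s"] by (simp add: mult.assoc)
    also have "\<dots> \<le> 2 * (2 powr \<alpha> * measure (finite_part \<mu>X) {x. 1 \<le> N x} * (\<gamma> / 2 * t) powr - \<alpha> + \<eta> / 2)"
      using elim(2) by (rule mult_left_mono) simp
    also have "(\<gamma> / 2 * t) powr - \<alpha> = (\<gamma> / 2) powr - \<alpha> * t powr - \<alpha>"
      by (rule powr_mult)
    finally show ?case by (simp add: K_def algebra_simps)
  qed
qed

definition L :: "real \<Rightarrow> (real ^ 'd \<Rightarrow> real) \<Rightarrow> real" where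
  "L s f = (\<integral>\<omega>. f (inverse s *\<^sub>R Z \<omega>) \<partial>M) / G s"

lemma L_le:
  assumes f: "f \<in> borel_measurable borel" "\<And>x. \<bar>f x\<bar> \<le> B" "\<And>x. N x \<le> a \<Longrightarrow> f x = 0" and s: "s > 0"
  shows "\<bar>L s f\<bar> \<le> B * (H (a * s) / G s)"
proof -
  have [measurable]: "f \<in> borel_measurable borel" by (rule f(1))
  have B: "B \<ge> 0" using f(2)[of 0] by simp
  have "\<bar>\<integral>\<omega>. f (inverse s *\<^sub>R Z \<omega>) \<partial>M\<bar> \<le> (\<integral>\<omega>. \<bar>f (inverse s *\<^sub>R Z \<omega>)\<bar> \<partial>M)"
    by (rule integral_abs_bound)
  also have "\<dots> \<le> (\<integral>\<omega>. B * indicator {\<omega> \<in> space M. N (Z \<omega>) > a * s} \<omega> \<partial>M)"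
  proof (rule integral_mono)
    show "integrable M (\<lambda>\<omega>. \<bar>f (inverse s *\<^sub>R Z \<omega>)\<bar>)"
      by (rule integrable_const_bound[of _ B]) (use f(2) in auto)
    show "integrable M (\<lambda>\<omega>. B * indicator {\<omega> \<in> space M. N (Z \<omega>) > a * s} \<omega>)"
      by (intro integrable_mult_right integrable_real_indicator) (auto simp: emeasure_eq_measure)
    fix \<omega> assume "\<omega> \<in> space M"
    then show "\<bar>f (inverse s *\<^sub>R Z \<omega>)\<bar> \<le> B * indicator {\<omega> \<in> space M. N (Z \<omega>) > a * s} \<omega>"
      using f(2)[of "inverse s *\<^sub>R Z \<omega>"] f(3)[of "inverse s *\<^sub>R Z \<omega>"] s
      by (auto simp: indicator_def N_scaleR field_simps)
  qed
  also have "\<dots> = B * H (a * s)"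
    by simp
  finally show ?thesis
    using G_pos[of s] by (simp add: L_def abs_divide divide_right_mono)
qed

lemma L_bound:
  assumes f: "test_function B \<delta> f" and \<eta>: "\<eta> > 0"
  shows "\<forall>\<^sub>F s in at_top. \<bar>L s f\<bar> \<le> (K * 2 powr \<alpha>) * B * \<delta> powr - \<alpha> + \<eta>"
proof -
  note fD = test_functionD[OF f]
  have "\<forall>\<^sub>F s in at_top. H (\<delta> / 2 * s) / G s \<le> K * (\<delta> / 2) powr - \<alpha> + \<eta> / (B + 1)"
    using fD(3,5) \<eta> by (intro H_ratio) auto
  then show ?thesis
    using eventually_gt_at_top[of 0]
  proof eventually_elim
    case (elim s)
    \<comment> \<open>\<open>L_le\<close> asks for vanishing on a closed ball, while a test function
      vanishes on the open ball of radius \<open>\<delta>\<close>; halving the radius costs the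
      factor \<open>2 powr \<alpha>\<close>.\<close>
    have "\<bar>L s f\<bar> \<le> B * (H (\<delta> / 2 * s) / G s)"
      by (rule L_le[OF fD(1,2) fD(4) elim(2)]) (use fD(3) in auto)
    also have "\<dots> \<le> B * (K * (\<delta> / 2) powr - \<alpha> + \<eta> / (B + 1))"
      using elim(1) fD(5) by (rule mult_left_mono)
    also have "(\<delta> / 2) powr - \<alpha> = 2 powr \<alpha> * \<delta> powr - \<alpha>"
      using fD(3) by (simp add: powr_divide powr_minus field_simps)
    also have "B * (K * (2 powr \<alpha> * \<delta> powr - \<alpha>) + \<eta> / (B + 1)) =
        (K * 2 powr \<alpha>) * B * \<delta> powr - \<alpha> + B * \<eta> / (B + 1)"
      by (simp add: algebra_simps)
    \<comment> \<open>Dividing by \<open>B + 1\<close> rather than \<open>B\<close> keeps the error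
      meaningful for \<open>B = 0\<close>.\<close>
    also have "B * \<eta> / (B + 1) \<le> \<eta>"
      using fD(5) \<eta> by (simp add: field_simps)
    finally show ?case by simp
  qed
qed

lemma S_ratio_bounded:
  assumes t: "t > 0"
  obtains C where "C \<ge> 0" "\<forall>\<^sub>F s in at_top. \<forall>j\<in>{1..q}. S j (t * s) / G s \<le> C"
proof -
  \<comment> \<open>The sum of the operator norms is a common positive bound for all of
    them.\<close>
  define b where "b = (\<Sum>j=1..q. op_norm N (\<Psi> j))"
  have op: "op_norm N (\<Psi> j) > 0" if "j \<in> {1..q}" for j
    using op_norm_pos invertible that by blast
  have op_le: "op_norm N (\<Psi> j) \<le> b" if "j \<in> {1..q}" for j
    unfolding b_def using op that by (intro member_le_sum) (auto intro: less_imp_le)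
  have b: "b > 0"
    using op[of 1] op_le[of 1] q by simp
  have "\<forall>\<^sub>F s in at_top. H (t / b * s) / G s \<le> K * (t / b) powr - \<alpha> + 1"
    using t b by (intro H_ratio) auto
  then have "\<forall>\<^sub>F s in at_top. \<forall>j\<in>{1..q}. S j (t * s) / G s \<le> \<bar>K * (t / b) powr - \<alpha> + 1\<bar>"
  proof eventually_elim
    case (elim s)
    show ?case
    proof
      fix j assume j: "j \<in> {1..q}"
      have "N (\<Psi> j *v z) \<le> b * N z" for z
        using N_matrix_le[of "\<Psi> j" z] op_le[OF j] mult_right_mono[OF op_le[OF j] N_nonneg[of z]] by linarith
      then have "t / b * s < N z" if "t * s < N (\<Psi> j *v z)" for z
        using less_le_trans[OF that \<open>N (\<Psi> j *v z) \<le> b * N z\<close>] b by (simp add: field_simps)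
      then have "S j (t * s) \<le> H (t / b * s)"
        by (intro finite_measure_mono) auto
      then have "S j (t * s) / G s \<le> H (t / b * s) / G s"
        by (rule divide_right_mono) simp
      then show "S j (t * s) / G s \<le> \<bar>K * (t / b) powr - \<alpha> + 1\<bar>"
        using elim by linarith
    qed
  qed
  then show thesis
    by (rule that[rotated]) simp
qed

text \<open>The expectation of \<open>one_big_jump\<close> for the rescaled summands. Equality in
  law replaces each noise vector by \<open>Z\<close>, and independence factors the probability that
  two summands are large.\<close>

lemma expectation_sum_minus_sum_le:
  fixes B \<delta> \<eta> \<epsilon> :: real
  assumes f: "test_function B \<delta> f" and \<eta>: "\<eta> \<ge> 0" and \<epsilon>: "\<epsilon> > 0" "q * \<epsilon> \<le> \<delta> / 2"
    and uc: "\<And>x x'. N (x - x') \<le> q * \<epsilon> \<Longrightarrow> \<bar>f x - f x'\<bar> \<le> \<eta>" and s: "s > 0"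
  shows "\<bar>(\<integral>\<omega>. f (inverse s *\<^sub>R X \<omega>) \<partial>M) - (\<Sum>j=1..q. \<integral>\<omega>. f (\<Psi> j *v (inverse s *\<^sub>R Z \<omega>)) \<partial>M)\<bar> \<le>
    \<eta> * (\<Sum>j=1..q. S j (\<delta> / 4 * s)) + (q + 1) * B * (\<Sum>i=1..q. \<Sum>j\<in>{1..q} - {i}. S i (\<epsilon> * s) * S j (\<epsilon> * s))"
proof -
  note fD = test_functionD[OF f]
  have f_meas [measurable]: "f \<in> borel_measurable borel" by (rule fD(1))
  let ?y = "\<lambda>\<omega> j. \<Psi> j *v (inverse s *\<^sub>R Zs j \<omega>)"
  have y_sum: "inverse s *\<^sub>R X \<omega> = (\<Sum>j=1..q. ?y \<omega> j)" for \<omega>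
    by (simp add: X_eq scaleR_sum_right matrix_vector_mult_scaleR)
  have N_y: "c < N (?y \<omega> j) \<longleftrightarrow> Zs j \<omega> \<in> {z. c * s < N (\<Psi> j *v z)}" for c \<omega> j
    using s by (simp add: matrix_vector_mult_scaleR N_scaleR field_simps)
  have y_meas: "(\<lambda>\<omega>. ?y \<omega> j) \<in> borel_measurable M" if "j \<in> {1..q}" for j
    by (rule measurable_compose[OF _ borel_measurable_matrix]) (use Zs[OF that] in measurable)
  have int_f: "integrable M (\<lambda>\<omega>. f (Y \<omega>))" if "Y \<in> borel_measurable M" for Y
    by (rule integrable_const_bound[of _ B]) (use fD(2) that in auto)
  have set_A: "{\<omega> \<in> space M. c < N (?y \<omega> j)} \<in> sets M" if "j \<in> {1..q}" for j c
    using y_meas[OF that] by measurable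
  have int_A: "integrable M (\<lambda>\<omega>. of_bool (c < N (?y \<omega> j)) :: real)" "(\<integral>\<omega>. of_bool (c < N (?y \<omega> j)) \<partial>M) = S j (c * s)"
    if j: "j \<in> {1..q}" for j c
  proof -
    have eq: "(\<integral>\<omega>. of_bool (c < N (?y \<omega> j)) \<partial>M) = (\<integral>\<omega>. indicator {\<omega> \<in> space M. c < N (?y \<omega> j)} \<omega> \<partial>M :: real)"
      by (rule Bochner_Integration.integral_cong) (auto simp: indicator_def)
    have "integrable M (indicator {\<omega> \<in> space M. c < N (?y \<omega> j)} :: _ \<Rightarrow> real)"
      using set_A[OF j] by (intro integrable_real_indicator) (auto simp: emeasure_eq_measure)
    then show "integrable M (\<lambda>\<omega>. of_bool (c < N (?y \<omega> j)) :: real)"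
      by (rule Bochner_Integration.integrable_cong[THEN iffD1, rotated 2]) (auto simp: indicator_def)
    have "{\<omega> \<in> space M. c < N (?y \<omega> j)} = Zs j -` {z. c * s < N (\<Psi> j *v z)} \<inter> space M"
      unfolding N_y by auto
    then have "prob {\<omega> \<in> space M. c < N (?y \<omega> j)} = S j (c * s)"
      using prob_Zs[OF j sets_matrix_tail, of "c * s" "\<Psi> j"] by (simp add: vimage_def Int_def conj_commute)
    then show "(\<integral>\<omega>. of_bool (c < N (?y \<omega> j)) \<partial>M) = S j (c * s)"
      unfolding eq using set_A[OF j, of c] by simp
  qed
  let ?P = "\<lambda>i j \<omega>. of_bool (\<epsilon> < N (?y \<omega> i) \<and> \<epsilon> < N (?y \<omega> j)) :: real"
  have int_P: "integrable M (?P i j)" "(\<integral>\<omega>. ?P i j \<omega> \<partial>M) = S i (\<epsilon> * s) * S j (\<epsilon> * s)"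
    if ij: "i \<in> {1..q}" "j \<in> {1..q} - {i}" for i j
  proof -
    let ?I = "{\<omega> \<in> space M. \<epsilon> < N (?y \<omega> i) \<and> \<epsilon> < N (?y \<omega> j)}"
    have I: "?I \<in> sets M"
    proof -
      have "?I = {\<omega> \<in> space M. \<epsilon> < N (?y \<omega> i)} \<inter> {\<omega> \<in> space M. \<epsilon> < N (?y \<omega> j)}" by auto
      then show ?thesis using set_A ij by auto
    qed
    have eq: "(\<integral>\<omega>. ?P i j \<omega> \<partial>M) = (\<integral>\<omega>. indicator ?I \<omega> \<partial>M :: real)"
      by (rule Bochner_Integration.integral_cong) (auto simp: indicator_def)
    have "integrable M (indicator ?I :: _ \<Rightarrow> real)"
      using I by (intro integrable_real_indicator) (auto simp: emeasure_eq_measure)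
    then show "integrable M (?P i j)"
      by (rule Bochner_Integration.integrable_cong[THEN iffD1, rotated 2]) (auto simp: indicator_def)
    have "prob ?I = S i (\<epsilon> * s) * S j (\<epsilon> * s)"
      unfolding N_y using ij prob_pair[of i j, OF _ _ _ sets_matrix_tail sets_matrix_tail] by auto
    then show "(\<integral>\<omega>. ?P i j \<omega> \<partial>M) = S i (\<epsilon> * s) * S j (\<epsilon> * s)"
      unfolding eq using I by simp
  qed
  have A: "integrable M (\<lambda>\<omega>. \<Sum>j=1..q. of_bool (\<delta> / 4 < N (?y \<omega> j)) :: real)"
    by (intro Bochner_Integration.integrable_sum int_A)
  have P: "integrable M (\<lambda>\<omega>. \<Sum>i=1..q. \<Sum>j\<in>{1..q} - {i}. ?P i j \<omega>)"
    by (intro Bochner_Integration.integrable_sum int_P)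
  have "(\<integral>\<omega>. f (\<Psi> j *v (inverse s *\<^sub>R Z \<omega>)) \<partial>M) = (\<integral>\<omega>. f (?y \<omega> j) \<partial>M)" if "j \<in> {1..q}" for j
    by (rule expectation_Zs[OF that, of "\<lambda>z. f (\<Psi> j *v (inverse s *\<^sub>R z))", symmetric])
       (intro measurable_compose[OF _ f_meas] measurable_compose[OF _ borel_measurable_matrix], measurable)
  then have "(\<integral>\<omega>. f (inverse s *\<^sub>R X \<omega>) \<partial>M) - (\<Sum>j=1..q. \<integral>\<omega>. f (\<Psi> j *v (inverse s *\<^sub>R Z \<omega>)) \<partial>M) =
      (\<integral>\<omega>. f (inverse s *\<^sub>R X \<omega>) - (\<Sum>j=1..q. f (?y \<omega> j)) \<partial>M)"
    using int_f y_meas by (subst Bochner_Integration.integral_diff) (auto simp: Bochner_Integration.integral_sum)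
  also have "\<bar>\<dots>\<bar> \<le> (\<integral>\<omega>. \<bar>f (inverse s *\<^sub>R X \<omega>) - (\<Sum>j=1..q. f (?y \<omega> j))\<bar> \<partial>M)"
    by (rule integral_abs_bound)
  also have "\<dots> \<le> (\<integral>\<omega>. \<eta> * (\<Sum>j=1..q. of_bool (\<delta> / 4 < N (?y \<omega> j))) +
      (q + 1) * B * (\<Sum>i=1..q. \<Sum>j\<in>{1..q} - {i}. ?P i j \<omega>) \<partial>M)"
  proof (rule integral_mono)
    show "integrable M (\<lambda>\<omega>. \<bar>f (inverse s *\<^sub>R X \<omega>) - (\<Sum>j=1..q. f (?y \<omega> j))\<bar>)"
      using int_f y_meas by (intro integrable_abs Bochner_Integration.integrable_diff Bochner_Integration.integrable_sum) auto
    show "integrable M (\<lambda>\<omega>. \<eta> * (\<Sum>j=1..q. of_bool (\<delta> / 4 < N (?y \<omega> j))) +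
        (q + 1) * B * (\<Sum>i=1..q. \<Sum>j\<in>{1..q} - {i}. ?P i j \<omega>))"
      by (rule Bochner_Integration.integrable_add[OF integrable_mult_right[OF A] integrable_mult_right[OF P]])
    fix \<omega>
    show "\<bar>f (inverse s *\<^sub>R X \<omega>) - (\<Sum>j=1..q. f (?y \<omega> j))\<bar> \<le> \<eta> * (\<Sum>j=1..q. of_bool (\<delta> / 4 < N (?y \<omega> j))) +
        (q + 1) * B * (\<Sum>i=1..q. \<Sum>j\<in>{1..q} - {i}. ?P i j \<omega>)"
      using one_big_jump[OF f _ \<eta> \<epsilon>(1), of "{1..q}" "?y \<omega>"] \<epsilon>(2) uc unfolding y_sum by simp
  qed
  also have "\<dots> = \<eta> * (\<Sum>j=1..q. S j (\<delta> / 4 * s)) + (q + 1) * B * (\<Sum>i=1..q. \<Sum>j\<in>{1..q} - {i}. S i (\<epsilon> * s) * S j (\<epsilon> * s))"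
  proof -
    have "(\<integral>\<omega>. (\<Sum>j=1..q. of_bool (\<delta> / 4 < N (?y \<omega> j))) \<partial>M) = (\<Sum>j=1..q. \<integral>\<omega>. of_bool (\<delta> / 4 < N (?y \<omega> j)) \<partial>M :: real)"
      by (intro Bochner_Integration.integral_sum int_A)
    also have "\<dots> = (\<Sum>j=1..q. S j (\<delta> / 4 * s))"
      by (intro sum.cong refl int_A)
    finally have "(\<integral>\<omega>. (\<Sum>j=1..q. of_bool (\<delta> / 4 < N (?y \<omega> j))) \<partial>M) = (\<Sum>j=1..q. S j (\<delta> / 4 * s))" .
    moreover have "(\<integral>\<omega>. (\<Sum>i=1..q. \<Sum>j\<in>{1..q} - {i}. ?P i j \<omega>) \<partial>M) = (\<Sum>i=1..q. \<Sum>j\<in>{1..q} - {i}. S i (\<epsilon> * s) * S j (\<epsilon> * s))"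
    proof -
      have "(\<integral>\<omega>. (\<Sum>i=1..q. \<Sum>j\<in>{1..q} - {i}. ?P i j \<omega>) \<partial>M) = (\<Sum>i=1..q. \<integral>\<omega>. (\<Sum>j\<in>{1..q} - {i}. ?P i j \<omega>) \<partial>M)"
        by (intro Bochner_Integration.integral_sum Bochner_Integration.integrable_sum int_P)
      also have "\<dots> = (\<Sum>i=1..q. \<Sum>j\<in>{1..q} - {i}. \<integral>\<omega>. ?P i j \<omega> \<partial>M)"
        by (intro sum.cong refl Bochner_Integration.integral_sum int_P)
      also have "\<dots> = (\<Sum>i=1..q. \<Sum>j\<in>{1..q} - {i}. S i (\<epsilon> * s) * S j (\<epsilon> * s))"
        by (intro sum.cong refl int_P)
      finally show ?thesis .
    qed
    ultimately show ?thesis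
      by (simp only: Bochner_Integration.integral_add[OF integrable_mult_right[OF A] integrable_mult_right[OF P]]
          integral_mult_right_zero)
  qed
  finally show ?thesis .
qed

end

section \<open>Identification of the noise\<close>

lemma continuous_on_ext_scale: "continuous_on A (ext_scale t)"
  unfolding ext_scale_def continuous_on_def
  by (auto intro!: tendsto_vec_lambda tendsto_cmult_ereal tendsto_intros)

lemma ext_scale_eq_0_iff: "t \<noteq> 0 \<Longrightarrow> ext_scale t z = 0 \<longleftrightarrow> z = 0"
  by (simp add: ext_scale_def vec_eq_iff)

lemma ext_scale_image_eq_vimage:
  assumes "t > 0"
  shows "ext_scale t ` A = ext_scale (1 / t) -` A"
proof -
  have inv: "ext_scale a (ext_scale b z) = z" if "a * b = 1" for a b z
    using that by (simp add: ext_scale_def vec_eq_iff mult.assoc[symmetric] one_ereal_def[symmetric])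
  show ?thesis
  proof (intro set_eqI iffI)
    fix z assume "z \<in> ext_scale t ` A"
    then obtain y where y: "y \<in> A" "z = ext_scale t y" by blast
    have "ext_scale (1 / t) z = y"
      unfolding y(2) by (rule inv) (use assms in simp)
    then show "z \<in> ext_scale (1 / t) -` A" using y(1) by simp
  next
    fix z assume "z \<in> ext_scale (1 / t) -` A"
    moreover have "z = ext_scale t (ext_scale (1 / t) z)"
      by (rule inv[symmetric]) (use assms in simp)
    ultimately show "z \<in> ext_scale t ` A" by blast
  qed
qed

lemma emeasure_sum_measures:
  assumes "finite I" "\<And>j. j \<in> I \<Longrightarrow> sets (\<nu> j) = sets punctured" "B \<in> sets punctured"
  shows "emeasure (sum_measures I \<nu>) B = (\<Sum>j\<in>I. emeasure (\<nu> j) B)"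
  unfolding sum_measures_def
proof (rule emeasure_measure_of_sigma[OF sets.sigma_algebra_axioms _ _ assms(3)])
  show "positive (sets punctured) (\<lambda>B. \<Sum>j\<in>I. emeasure (\<nu> j) B)"
    by (simp add: positive_def)
  show "countably_additive (sets punctured) (\<lambda>B. \<Sum>j\<in>I. emeasure (\<nu> j) B)"
  proof (rule countably_additiveI)
    fix A :: "nat \<Rightarrow> (ereal ^ 'b) set"
    assume A: "range A \<subseteq> sets punctured" "disjoint_family A"
    have "(\<Sum>i. \<Sum>j\<in>I. emeasure (\<nu> j) (A i)) = (\<Sum>j\<in>I. \<Sum>i. emeasure (\<nu> j) (A i))"
      by (rule suminf_sum) simp
    also have "\<dots> = (\<Sum>j\<in>I. emeasure (\<nu> j) (\<Union>i. A i))"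
      using A assms(2) by (intro sum.cong refl suminf_emeasure) auto
    finally show "(\<Sum>i. \<Sum>j\<in>I. emeasure (\<nu> j) (A i)) = (\<Sum>j\<in>I. emeasure (\<nu> j) (\<Union>i. A i))" .
  qed
qed

lemma sets_sum_measures [simp]: "sets (sum_measures I \<nu>) = sets punctured"
  by (simp add: sum_measures_def)

context vector_norm
begin

lemma sets_pushforward [simp]: "sets (pushforward \<mu> A) = sets punctured"
  unfolding pushforward_def punctured_def by (intro sets_restrict_space_cong) simp

lemma emeasure_pushforward:
  fixes A :: "real ^ 'd ^ 'd"
  assumes \<mu>: "sets \<mu> = sets punctured" and B: "B \<in> sets punctured"
  shows "emeasure (pushforward \<mu> A) B = emeasure (finite_part \<mu>) ((*v) A -` ext -` B)"
proof -
  have eA: "(\<lambda>x. ext (A *v x)) \<in> borel_measurable borel"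
    by (rule measurable_compose[OF borel_measurable_matrix borel_measurable_ext])
  have "distr (restrict_space \<mu> (range ext)) borel (\<lambda>z. ext (A *v fin_part z)) =
      distr (finite_part \<mu>) borel (\<lambda>x. ext (A *v x))"
    unfolding finite_part_def using distr_distr[OF eA measurable_fin_part[OF \<mu>]] by (simp add: o_def)
  moreover have "emeasure (pushforward \<mu> A) B = emeasure (distr (restrict_space \<mu> (range ext)) borel (\<lambda>z. ext (A *v fin_part z))) B"
    unfolding pushforward_def using B sets_Compl_0 by (intro emeasure_restrict_space) (auto simp: sets_punctured)
  moreover have "emeasure (distr (finite_part \<mu>) borel (\<lambda>x. ext (A *v x))) B = emeasure (finite_part \<mu>) ((\<lambda>x. ext (A *v x)) -` B)"
    using B eA by (subst emeasure_distr) (simp_all add: sets_punctured finite_part_def)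
  moreover have "(\<lambda>x. ext (A *v x)) -` B = (*v) A -` ext -` B"
    by auto
  ultimately show ?thesis by simp
qed

text \<open>Seen from the finite points, a function in \<open>Cc0\<close> is bounded, continuous and
  0 near the origin, but its support may be unbounded, so it need not be a test function.
  \<open>L_tendsto\<close> bridges this difference.\<close>

lemma Cc0_restrict:
  assumes "f \<in> Cc0"
  defines "g \<equiv> \<lambda>x. if x = 0 then 0 else f (ext x)"
  obtains B \<delta> where "continuous_on UNIV g" "\<And>x. \<bar>g x\<bar> \<le> B" "\<delta> > 0" "\<And>x. N x < \<delta> \<Longrightarrow> g x = 0"
proof -
  obtain B \<delta> where B: "\<And>z. z \<noteq> 0 \<Longrightarrow> \<bar>f z\<bar> \<le> B" "\<delta> > 0" "\<And>x. x \<noteq> 0 \<Longrightarrow> N x < \<delta> \<Longrightarrow> f (ext x) = 0" "B \<ge> 0"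
    using Cc0_D[OF assms(1)] by blast
  have g0: "g x = 0" if "N x < \<delta>" for x
    using B(3)[of x] that by (simp add: g_def)
  have "continuous_on (- {0}) f"
    using assms(1) by (simp add: Cc0_def)
  then have "continuous_on (- {0}) (\<lambda>x. f (ext x))"
    by (rule continuous_on_compose2[OF _ continuous_on_ext]) auto
  then have 1: "continuous_on (- {0}) g"
    by (rule continuous_on_eq) (simp add: g_def)
  have 2: "continuous_on {x. N x < \<delta>} g"
    by (rule continuous_on_eq[OF continuous_on_const[of _ 0]]) (simp add: g0)
  have "open (- {0 :: real ^ 'd})" "open {x. N x < \<delta>}"
    by (auto intro!: open_Collect_less continuous_intros)
  from continuous_on_open_Un[OF this 1 2] have "continuous_on (- {0} \<union> {x. N x < \<delta>}) g" .
  moreover have "- {0} \<union> {x. N x < \<delta>} = UNIV"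
    using B(2) by auto
  ultimately have "continuous_on UNIV g" by simp
  moreover have "\<bar>g x\<bar> \<le> B" for x
    using B(1)[of "ext x"] B(4) by (simp add: g_def)
  ultimately show thesis
    using that[OF _ _ B(2) g0] by blast
qed

end

context linear_filter
begin

text \<open>The constants are chosen in a forced order: \<open>C1\<close> depends on
  \<open>\<delta>\<close> alone, then \<open>\<eta>\<close> is taken small against it, then
  \<open>\<epsilon>\<close> by uniform continuity for \<open>\<eta>\<close>, and \<open>C2\<close>
  depends on \<open>\<epsilon>\<close>. It may be large, since it is multiplied by probabilities
  tending to 0.\<close>

lemma sum_L_tendsto:
  assumes f: "test_function B \<delta> f"
  shows "((\<lambda>s. \<Sum>j=1..q. L s (\<lambda>x. f (\<Psi> j *v x))) \<longlongrightarrow> (\<integral>x. f x \<partial>finite_part \<mu>X)) at_top"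
proof -
  note fD = test_functionD[OF f]
  let ?A = "\<lambda>s. (\<integral>\<omega>. f (inverse s *\<^sub>R X \<omega>) \<partial>M) / G s"
  let ?L = "\<lambda>s. \<Sum>j=1..q. L s (\<lambda>x. f (\<Psi> j *v x))"
  have "((\<lambda>s. ?A s - ?L s) \<longlongrightarrow> 0) at_top"
  proof (rule tendstoI)
    fix e :: real assume e: "e > 0"
    have "\<delta> / 4 > 0" using fD(3) by simp
    then obtain C1 where C1: "C1 \<ge> 0" "\<forall>\<^sub>F s in at_top. \<forall>j\<in>{1..q}. S j (\<delta> / 4 * s) / G s \<le> C1"
      using S_ratio_bounded by blast
    \<comment> \<open>The summand 1 avoids division by 0 when \<open>C1 = 0\<close> and makes the
      inequality below strict.\<close>
    define \<eta> where "\<eta> = e / (2 * (q * C1 + 1))"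
    have \<eta>: "\<eta> > 0" "\<eta> * (q * C1) < e / 2"
    proof -
      have D: "q * C1 + 1 > 0" using C1(1) by (simp add: add_nonneg_pos)
      then show "\<eta> > 0" using e by (simp add: \<eta>_def)
      have "e * (q * C1) < e / 2 * (2 * (q * C1 + 1))"
        using e by (simp add: algebra_simps)
      then show "\<eta> * (q * C1) < e / 2"
        using D unfolding \<eta>_def times_divide_eq_left by (subst pos_divide_less_eq) auto
    qed
    obtain \<epsilon>0 where \<epsilon>0: "\<epsilon>0 > 0" "\<And>x y. N (x - y) \<le> \<epsilon>0 \<Longrightarrow> \<bar>f x - f y\<bar> \<le> \<eta>"
      using test_function_uniformly_continuous[OF f \<eta>(1)] by blast
    define \<epsilon> where "\<epsilon> = min \<epsilon>0 (\<delta> / 2) / q"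
    have \<epsilon>: "\<epsilon> > 0" "q * \<epsilon> \<le> \<delta> / 2" "q * \<epsilon> \<le> \<epsilon>0"
      using \<epsilon>0(1) fD(3) q by (simp_all add: \<epsilon>_def)
    obtain C2 where C2: "C2 \<ge> 0" "\<forall>\<^sub>F s in at_top. \<forall>j\<in>{1..q}. S j (\<epsilon> * s) / G s \<le> C2"
      using S_ratio_bounded[OF \<epsilon>(1)] by blast
    \<comment> \<open>In each product of two survival functions one factor absorbs the division by
      \<open>G s\<close> and stays bounded, while the other tends to 0.\<close>
    let ?R = "\<lambda>s. (q + 1) * B * (\<Sum>i=1..q. \<Sum>j\<in>{1..q} - {i}. C2 * S j (\<epsilon> * s))"
    have "(?R \<longlongrightarrow> (q + 1) * B * (\<Sum>i=1..q. \<Sum>j\<in>{1..q} - {i}. C2 * 0)) at_top"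
      by (intro tendsto_mult_left tendsto_sum S_tendsto_0 \<epsilon>(1))
    then have "\<forall>\<^sub>F s in at_top. ?R s < e / 2"
      using e by (intro order_tendstoD(2)) auto
    then show "\<forall>\<^sub>F s in at_top. dist (?A s - ?L s) 0 < e"
      using C1(2) C2(2) eventually_gt_at_top[of 0]
    proof eventually_elim
      case (elim s)
      let ?E = "(\<integral>\<omega>. f (inverse s *\<^sub>R X \<omega>) \<partial>M) - (\<Sum>j=1..q. \<integral>\<omega>. f (\<Psi> j *v (inverse s *\<^sub>R Z \<omega>)) \<partial>M)"
      have "?A s - ?L s = ?E / G s"
        by (simp add: L_def diff_divide_distrib sum_divide_distrib)
      then have "\<bar>?A s - ?L s\<bar> = \<bar>?E\<bar> / G s"
        using G_pos[of s] by (simp add: abs_divide)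
      also have "\<dots> \<le> (\<eta> * (\<Sum>j=1..q. S j (\<delta> / 4 * s)) +
          (q + 1) * B * (\<Sum>i=1..q. \<Sum>j\<in>{1..q} - {i}. S i (\<epsilon> * s) * S j (\<epsilon> * s))) / G s"
        using G_pos[of s] \<eta>(1) \<epsilon> \<epsilon>0(2) elim(4)
        by (intro divide_right_mono expectation_sum_minus_sum_le[OF f]) (auto intro: order_trans)
      also have "\<dots> = \<eta> * ((\<Sum>j=1..q. S j (\<delta> / 4 * s)) / G s) +
          (q + 1) * B * ((\<Sum>i=1..q. \<Sum>j\<in>{1..q} - {i}. S i (\<epsilon> * s) * S j (\<epsilon> * s)) / G s)"
        by (simp only: add_divide_distrib times_divide_eq_right)
      also have "\<dots> = \<eta> * (\<Sum>j=1..q. S j (\<delta> / 4 * s) / G s) +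
          (q + 1) * B * (\<Sum>i=1..q. \<Sum>j\<in>{1..q} - {i}. S i (\<epsilon> * s) / G s * S j (\<epsilon> * s))"
        by (simp only: sum_divide_distrib times_divide_eq_left)
      also have "\<dots> \<le> \<eta> * (q * C1) + ?R s"
      proof (intro add_mono mult_left_mono sum_mono mult_right_mono)
        show "(\<Sum>j=1..q. S j (\<delta> / 4 * s) / G s) \<le> q * C1"
          using sum_bounded_above[of "{1..q}" "\<lambda>j. S j (\<delta> / 4 * s) / G s" C1] elim(2) by simp
      qed (use \<eta>(1) fD(5) elim(3) in auto)
      also have "\<dots> < e" using \<eta>(2) elim(1) by linarith
      finally show ?case by (simp add: dist_real_def)
    qed
  qed
  then have "((\<lambda>s. ?A s - (?A s - ?L s)) \<longlongrightarrow> (\<integral>x. f x \<partial>finite_part \<mu>X) - 0) at_top"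
    by (intro tendsto_diff RV_test_limit[OF prob_space_axioms RV f])
  then show ?thesis by simp
qed

text \<open>Composing with the inverse \<open>P\<close> of \<open>\<Psi> 1\<close> turns the first
  matrix into the identity, as \<open>ex_limit_measure\<close> requires. The resulting equation is
  transported back by \<open>\<Psi> 1\<close>.\<close>

lemma ex_noise_tail_measure:
  obtains \<nu> where "tail_measure \<alpha> \<nu>"
    "\<And>B \<delta> f. test_function B \<delta> f \<Longrightarrow> ((\<lambda>s. L s f) \<longlongrightarrow> (\<integral>x. f x \<partial>\<nu>)) at_top"
    "\<And>A. A \<in> sets borel \<Longrightarrow> emeasure (finite_part \<mu>X) A = (\<Sum>j=1..q. emeasure \<nu> ((*v) (\<Psi> j) -` A))"
proof -
  have one: "1 \<in> {1..q}" using q by simp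
  obtain P where P: "\<Psi> 1 ** P = mat 1" "P ** \<Psi> 1 = mat 1"
    using invertible[OF one] by (auto simp: invertible_def)
  have invP: "invertible P"
    using P by (auto simp: invertible_def)
  define \<Phi> where "\<Phi> j = P ** \<Psi> j" for j
  have "\<exists>c>0. \<forall>x. c * N x \<le> N (\<Phi> j *v x)" if j: "j \<in> {2..q}" for j
  proof -
    have "invertible (\<Phi> j)"
      unfolding \<Phi>_def using invP invertible[of j] j by (intro invertible_mult) auto
    then show ?thesis by (metis invertible_expands)
  qed
  then obtain c where c: "\<And>j. j \<in> {2..q} \<Longrightarrow> c j > 0 \<and> (\<forall>x. c j * N x \<le> N (\<Phi> j *v x))"
    by metis
  interpret contraction N \<Phi> "{2..q}" "\<lambda>j. op_norm N (\<Psi> j) / \<gamma>" c \<alpha>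
  proof
    fix j x assume j: "j \<in> {2..q}"
    show "op_norm N (\<Psi> j) / \<gamma> > 0"
      using op_norm_pos[OF invertible[of j]] j \<gamma>_pos by simp
    show "0 < c j" "c j * N x \<le> N (\<Phi> j *v x)"
      using c[OF j] by auto
    \<comment> \<open>Estimating both sides, from below by \<open>\<gamma>\<close> and from above by
      the operator norm, gives the bound for \<open>\<Phi> j\<close> directly in the quantities of
      the dominance condition.\<close>
    have "\<Psi> 1 *v (\<Phi> j *v x) = \<Psi> j *v x"
      unfolding \<Phi>_def by (simp only: matrix_vector_mul_assoc matrix_mul_assoc P(1) matrix_mul_lid)
    then have "\<gamma> * N (\<Phi> j *v x) \<le> op_norm N (\<Psi> j) * N x"
      using N_matrix_ge[of "\<Psi> 1" "\<Phi> j *v x"] N_matrix_le[of "\<Psi> j" x] by simp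
    then show "N (\<Phi> j *v x) \<le> op_norm N (\<Psi> j) / \<gamma> * N x"
      using \<gamma>_pos by (simp add: field_simps)
  next
    have "(\<Sum>j=2..q. (op_norm N (\<Psi> j) / \<gamma>) powr \<alpha>) = (\<Sum>j=2..q. op_norm N (\<Psi> j) powr \<alpha>) / \<gamma> powr \<alpha>"
      unfolding sum_divide_distrib using \<gamma>_pos op_norm_pos[OF invertible]
      by (intro sum.cong refl powr_divide)
    also have "\<dots> < 1"
      using dominant \<gamma>_pos by simp
    finally show "(\<Sum>j=2..q. (op_norm N (\<Psi> j) / \<gamma>) powr \<alpha>) < 1" .
  qed simp
  let ?X = "finite_part \<mu>X"
  let ?\<mu> = "distr ?X borel ((*v) P)"
  have tX: "tail_measure \<alpha> ?X"
    by (rule RV_tail_measure[OF prob_space_axioms RV])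
  have sets_X: "sets ?X = sets borel"
    by (rule tail_measureD(1)[OF tX])
  have P_meas: "(*v) P \<in> measurable ?X borel"
    by (subst measurable_cong_sets[OF sets_X refl]) simp
  have insert: "insert 1 {2..q} = {1..q}" using q by auto
  have \<Phi>1: "\<Phi> 1 = mat 1" "1 \<notin> {2..q}"
    using P(2) by (simp_all add: \<Phi>_def)
  have rec: "((\<lambda>s. \<Sum>j\<in>insert 1 {2..q}. L s (\<lambda>x. f (\<Phi> j *v x))) \<longlongrightarrow> (\<integral>x. f x \<partial>?\<mu>)) at_top"
    if f: "test_function B \<delta> f" for B \<delta> f
  proof -
    obtain cP where cP: "cP > 0" "\<And>x. cP * N x \<le> N (P *v x)"
      using invertible_expands[OF invP] by blast
    have "test_function B (\<delta> / op_norm N P) (\<lambda>x. f (P *v x))"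
      by (rule test_function_compose[OF f op_norm_pos[OF invP] N_matrix_le cP])
    note sum_L_tendsto[OF this]
    moreover have "(\<integral>x. f (P *v x) \<partial>?X) = (\<integral>x. f x \<partial>?\<mu>)"
      by (rule integral_distr[OF P_meas test_functionD(1)[OF f], symmetric])
    ultimately show ?thesis
      unfolding insert by (simp add: \<Phi>_def matrix_vector_mul_assoc)
  qed
  have nonneg: "0 \<le> L s f" if "\<And>x. 0 \<le> f x" for f s
    unfolding L_def using that by (intro divide_nonneg_nonneg integral_nonneg) auto
  obtain \<nu> where \<nu>: "tail_measure \<alpha> \<nu>"
    "\<And>B \<delta> f. test_function B \<delta> f \<Longrightarrow> ((\<lambda>s. L s f) \<longlongrightarrow> (\<integral>x. f x \<partial>\<nu>)) at_top"
    "?\<mu> = matrix_sum (insert 1 {2..q}) \<Phi> \<nu>"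
    by (rule ex_limit_measure[where L = L, OF tail_measure_distr[OF tX invP] \<Phi>1(2,1), of "K * 2 powr \<alpha>"])
       (rule L_bound rec nonneg; assumption | blast)+
  have "emeasure ?X A = (\<Sum>j=1..q. emeasure \<nu> ((*v) (\<Psi> j) -` A))" if A: "A \<in> sets borel" for A
  proof -
    \<comment> \<open>The preimage of this set under \<open>P\<close> is \<open>A\<close>, which
      undoes the normalisation.\<close>
    let ?A = "(*v) (\<Psi> 1) -` A"
    have A': "?A \<in> sets borel"
      using measurable_sets[OF borel_measurable_matrix A, of "\<Psi> 1"] by simp
    have "\<Psi> 1 *v (P *v x) = x" for x
      by (simp only: matrix_vector_mul_assoc P(1) matrix_vector_mul_lid)
    then have "(*v) P -` ?A = A" by auto
    then have "emeasure ?X A = emeasure ?\<mu> ?A"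
      using emeasure_distr[OF P_meas A'] tail_measureD(5)[OF tX] by simp
    also have "\<dots> = (\<Sum>j=1..q. emeasure \<nu> ((*v) (\<Phi> j) -` ?A))"
      unfolding \<nu>(3) insert by (rule emeasure_matrix_sum[OF _ tail_measureD(1)[OF \<nu>(1)] A']) simp
    also have "\<dots> = (\<Sum>j=1..q. emeasure \<nu> ((*v) (\<Psi> j) -` A))"
    proof -
      have "(*v) (\<Phi> j) -` ?A = (*v) (\<Psi> j) -` A" for j
      proof -
        have "\<Psi> 1 *v (\<Phi> j *v x) = \<Psi> j *v x" for x
          unfolding \<Phi>_def by (simp only: matrix_vector_mul_assoc matrix_mul_assoc P(1) matrix_mul_lid)
        then show ?thesis by auto
      qed
      then show ?thesis by simp
    qed
    finally show ?thesis .
  qed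
  with \<nu>(1,2) show thesis by (rule that)
qed

text \<open>Tightness at infinity. The function is split by a cutoff at a large radius
  \<open>R\<close> into a test function \<open>h\<close> and a remainder \<open>k\<close>; both
  \<open>L s k\<close> and the integral of \<open>k\<close> are of order
  \<open>R powr - \<alpha>\<close>, the former by \<open>H_ratio\<close>.\<close>

lemma L_tendsto:
  assumes \<nu>: "tail_measure \<alpha> \<nu>"
    and lim: "\<And>B \<delta> f. test_function B \<delta> f \<Longrightarrow> ((\<lambda>s. L s f) \<longlongrightarrow> (\<integral>x. f x \<partial>\<nu>)) at_top"
    and g: "continuous_on UNIV g" "\<And>x. \<bar>g x\<bar> \<le> B" "\<delta> > 0" "\<And>x. N x < \<delta> \<Longrightarrow> g x = 0"
  shows "((\<lambda>s. L s g) \<longlongrightarrow> (\<integral>x. g x \<partial>\<nu>)) at_top"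
proof (rule tendstoI)
  fix e :: real assume e: "e > 0"
  have B: "B \<ge> 0" using g(2)[of 0] by simp
  define m where "m = measure \<nu> {x. 1 \<le> N x}"
  \<comment> \<open>\<open>R\<close> is fixed before s grows; positivity of \<open>\<alpha>\<close>
    is what makes both remainders small.\<close>
  have "((\<lambda>R. B * K * R powr - \<alpha> + B * m * R powr - \<alpha>) \<longlongrightarrow> B * K * 0 + B * m * 0) at_top"
    using RV_index[OF prob_space_axioms RV] by (intro tendsto_intros tendsto_neg_powr filterlim_ident) simp_all
  then have "\<forall>\<^sub>F R in at_top. B * K * R powr - \<alpha> + B * m * R powr - \<alpha> < e / 4"
    using e by (intro order_tendstoD(2)) auto
  then have "\<forall>\<^sub>F R in at_top. B * K * R powr - \<alpha> + B * m * R powr - \<alpha> < e / 4 \<and> R > 0"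
    by (intro eventually_conj eventually_gt_at_top)
  then obtain R where R: "B * K * R powr - \<alpha> + B * m * R powr - \<alpha> < e / 4" "R > 0"
    unfolding eventually_at_top_linorder by blast
  define \<psi> where "\<psi> x = max 0 (min 1 ((N x - R) / (2 * R - R)))" for x
  note ramp = ramp[of R "2 * R", folded \<psi>_def]
  have \<psi>: "continuous_on UNIV \<psi>" "0 \<le> \<psi> x" "\<psi> x \<le> 1" "N x \<le> R \<Longrightarrow> \<psi> x = 0" "2 * R \<le> N x \<Longrightarrow> \<psi> x = 1" for x
    using ramp R(2) by auto
  define h where "h x = g x * (1 - \<psi> x)" for x
  define k where "k x = g x * \<psi> x" for x
  have gh: "g x = h x + k x" for x
    by (simp add: h_def k_def algebra_simps)
  have h_le: "\<bar>h x\<bar> \<le> B" and k_le: "\<bar>k x\<bar> \<le> B" for x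
    unfolding h_def k_def abs_mult using g(2)[of x] \<psi>(2,3)[of x] B
    by (auto intro!: order_trans[OF mult_mono[of "\<bar>g x\<bar>" B _ 1]])
  have h: "test_function B \<delta> h"
    unfolding test_function_def
  proof (intro conjI allI impI exI[of _ "2 * R"])
    show "continuous_on UNIV h"
      unfolding h_def using g(1) \<psi>(1) by (intro continuous_intros)
  qed (use g(3,4) h_le \<psi>(5) in \<open>auto simp: h_def\<close>)
  have k_cont: "continuous_on UNIV k"
    unfolding k_def using g(1) \<psi>(1) by (intro continuous_intros)
  then have k_meas: "k \<in> borel_measurable borel"
    by (rule borel_measurable_continuous_onI)
  have k_zero: "N x \<le> R \<Longrightarrow> k x = 0" for x
    using \<psi>(4) by (simp add: k_def)
  have int_k: "integrable \<nu> k" "\<bar>\<integral>x. k x \<partial>\<nu>\<bar> \<le> B * measure \<nu> {x. R \<le> N x}"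
    by (rule integrable_away_from_0[OF \<nu> k_meas k_le R(2)] integral_away_from_0_le[OF \<nu> k_meas k_le R(2)], simp add: k_zero)+
  have "(\<integral>x. g x \<partial>\<nu>) = (\<integral>x. h x \<partial>\<nu>) + (\<integral>x. k x \<partial>\<nu>)"
    unfolding gh using test_function_integrable(1)[OF \<nu> h] int_k(1) by simp
  then have \<nu>_diff: "\<bar>(\<integral>x. g x \<partial>\<nu>) - (\<integral>x. h x \<partial>\<nu>)\<bar> \<le> B * m * R powr - \<alpha>"
    using int_k(2) measure_tail[OF \<nu> R(2)] by (simp add: m_def mult_ac)
  have L_diff: "L s g = L s h + L s k" for s
  proof -
    have "integrable M (\<lambda>\<omega>. f (inverse s *\<^sub>R Z \<omega>))" if "f \<in> borel_measurable borel" "\<And>x. \<bar>f x\<bar> \<le> B" for f :: "real ^ 'd \<Rightarrow> real"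
      by (rule integrable_const_bound[of _ B]) (use that in auto)
    from this[OF test_functionD(1)[OF h] h_le] this[OF k_meas k_le] show ?thesis
      unfolding gh L_def by (simp add: add_divide_distrib)
  qed
  have "\<forall>\<^sub>F s in at_top. H (R * s) / G s \<le> K * R powr - \<alpha> + e / (4 * (B + 1))"
    using R(2) e B by (intro H_ratio) auto
  moreover have "\<forall>\<^sub>F s in at_top. dist (L s h) (\<integral>x. h x \<partial>\<nu>) < e / 4"
    using e by (intro tendstoD[OF lim[OF h]]) simp
  ultimately show "\<forall>\<^sub>F s in at_top. dist (L s g) (\<integral>x. g x \<partial>\<nu>) < e"
    using eventually_gt_at_top[of 0]
  proof eventually_elim
    case (elim s)
    have "\<bar>L s k\<bar> \<le> B * (H (R * s) / G s)"
      by (rule L_le[OF k_meas k_le k_zero elim(3)])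
    also have "\<dots> \<le> B * (K * R powr - \<alpha> + e / (4 * (B + 1)))"
      using elim(1) B by (rule mult_left_mono)
    also have "\<dots> = B * K * R powr - \<alpha> + B * (e / (4 * (B + 1)))"
      by (simp add: algebra_simps)
    also have "B * (e / (4 * (B + 1))) \<le> e / 4"
      using B e by (simp add: field_simps)
    finally have "\<bar>L s k\<bar> \<le> B * K * R powr - \<alpha> + e / 4" by simp
    then show ?case
      using elim(2) \<nu>_diff R(1) e unfolding L_diff dist_real_def by linarith
  qed
qed

end

section \<open>Return to the compactified space\<close>

context vector_norm
begin

text \<open>The opposite of \<open>finite_part\<close>: the measure is placed on the finite points
  and the origin is removed, so infinite points get no mass.\<close>

definition extend_measure0 :: "(real ^ 'd) measure \<Rightarrow> (ereal ^ 'd) measure" where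
  "extend_measure0 \<nu> = restrict_space (distr \<nu> borel ext) (- {0})"

lemma sets_extend_measure0 [simp]: "sets (extend_measure0 \<nu>) = sets punctured"
  unfolding extend_measure0_def punctured_def by (intro sets_restrict_space_cong) simp

context
  fixes \<nu> :: "(real ^ 'd) measure"
  assumes sets_\<nu>: "sets \<nu> = sets borel"
begin

lemma measurable_ext: "ext \<in> measurable \<nu> borel"
  by (subst measurable_cong_sets[OF sets_\<nu> refl]) (rule borel_measurable_ext)

lemma emeasure_extend_measure0:
  assumes "B \<in> sets punctured"
  shows "emeasure (extend_measure0 \<nu>) B = emeasure \<nu> (ext -` B)"
proof -
  have "emeasure (extend_measure0 \<nu>) B = emeasure (distr \<nu> borel ext) B"
    unfolding extend_measure0_def using assms sets_Compl_0 by (intro emeasure_restrict_space) (auto simp: sets_punctured)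
  also have "\<dots> = emeasure \<nu> (ext -` B \<inter> space \<nu>)"
    using assms by (intro emeasure_distr measurable_ext) (simp add: sets_punctured)
  finally show ?thesis
    using sets_eq_imp_space_eq[OF sets_\<nu>] by simp
qed

lemma integral_extend_measure0:
  fixes f :: "ereal ^ 'd \<Rightarrow> real"
  assumes "continuous_on (- {0}) f"
  shows "(\<integral>z. f z \<partial>extend_measure0 \<nu>) = (\<integral>x. (if x = 0 then 0 else f (ext x)) \<partial>\<nu>)"
proof -
  have "(\<integral>z. f z \<partial>extend_measure0 \<nu>) = (\<integral>z. indicator (- {0}) z *\<^sub>R f z \<partial>distr \<nu> borel ext)"
    unfolding extend_measure0_def using sets_Compl_0 by (intro integral_restrict_space) simp
  also have "\<dots> = (\<integral>x. indicator (- {0}) (ext x) *\<^sub>R f (ext x) \<partial>\<nu>)"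
    by (rule integral_distr[OF measurable_ext borel_measurable_continuous_on_indicator[OF sets_Compl_0 assms]])
  also have "\<dots> = (\<integral>x. (if x = 0 then 0 else f (ext x)) \<partial>\<nu>)"
    by (rule Bochner_Integration.integral_cong) auto
  finally show ?thesis .
qed

lemma finite_part_extend_measure0:
  assumes "emeasure \<nu> {0} = 0"
  shows "finite_part (extend_measure0 \<nu>) = \<nu>"
proof (rule measure_eqI)
  show "sets (finite_part (extend_measure0 \<nu>)) = sets \<nu>"
    by (simp add: finite_part_def sets_\<nu>)
  fix A assume "A \<in> sets (finite_part (extend_measure0 \<nu>))"
  then have A: "A \<in> sets borel" by (simp add: finite_part_def)
  have "emeasure (finite_part (extend_measure0 \<nu>)) A = emeasure (extend_measure0 \<nu>) (ext ` (A - {0}))"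
    by (rule emeasure_finite_part[OF sets_extend_measure0 A])
  also have "\<dots> = emeasure \<nu> (ext -` ext ` (A - {0}))"
    using ext_image_borel[of "A - {0}"] A by (intro emeasure_extend_measure0) (auto simp: sets_punctured)
  also have "ext -` ext ` (A - {0}) = A - {0}"
    by auto
  also have "emeasure \<nu> (A - {0}) = emeasure \<nu> A"
    using assms A sets_\<nu> by (intro emeasure_Diff_null_set) auto
  finally show "emeasure (finite_part (extend_measure0 \<nu>)) A = emeasure \<nu> A" .
qed

end

lemma tail_measure_scale:
  assumes "tail_measure \<alpha> \<nu>"
  shows "tail_measure \<alpha> (scale_measure (ennreal a) \<nu>)"
  unfolding tail_measure_def using tail_measureD[OF assms]
  by (auto simp: ennreal_mult_less_top mult.left_commute)

lemma RV_extend_measure0: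
  assumes \<nu>: "tail_measure \<alpha> \<nu>" "emeasure \<nu> UNIV \<noteq> 0" and \<alpha>: "\<alpha> > 0"
    and X: "X \<in> borel_measurable M" "vague_conv0 (normalized_law M N X X) (extend_measure0 \<nu>)"
  shows "RV M N X \<alpha> (extend_measure0 \<nu>)"
  unfolding RV_def regularly_varying_def
proof (intro conjI allI impI ballI X \<alpha>)
  note D = tail_measureD[OF \<nu>(1)]
  note e = emeasure_extend_measure0[OF D(1)]
  show "Radon0 N (extend_measure0 \<nu>)"
    unfolding Radon0_def
  proof (intro conjI allI impI)
    fix r :: real assume r: "r > 0"
    have "open {x. N x < r}"
      by (intro open_Collect_less continuous_intros)
    then have "ext ` {x. N x < r} \<in> sets borel"
      by (intro borel_open open_ext_image)
    moreover have "0 \<in> ext ` {x. N x < r}"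
      using r by (intro image_eqI[of _ _ 0]) auto
    ultimately have "- ext ` {x. N x < r} \<in> sets punctured"
      by (simp add: sets_punctured borel_comp)
    moreover have "ext -` (- ext ` {x. N x < r}) = {x. r \<le> N x}"
      by (auto simp: image_iff not_less)
    ultimately show "emeasure (extend_measure0 \<nu>) (- ext ` {x. N x < r}) < \<infinity>"
      using e emeasure_tail_finite[OF \<nu>(1) r] by simp
  qed simp
  have "- {0} \<in> sets (punctured :: (ereal ^ 'd) measure)"
    using sets_Compl_0 by (simp add: sets_punctured)
  moreover have "space (extend_measure0 \<nu>) = - {0}"
    using sets_eq_imp_space_eq[OF sets_extend_measure0, of \<nu>] by (simp add: space_punctured)
  moreover have "ext -` (- {0}) = UNIV - {0 :: real ^ 'd}"
    by auto
  moreover have "emeasure \<nu> (UNIV - {0}) = emeasure \<nu> UNIV"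
    using D(1,2) by (intro emeasure_Diff_null_set) auto
  ultimately show "emeasure (extend_measure0 \<nu>) (space (extend_measure0 \<nu>)) \<noteq> 0"
    using e[of "- {0}"] \<nu>(2) by simp
  have "- range ext \<in> sets (punctured :: (ereal ^ 'd) measure)"
    unfolding sets_punctured using sets_range_ext rangeI[of ext 0] by simp
  moreover have "ext -` (- range ext) = ({} :: (real ^ 'd) set)"
    by auto
  ultimately show "emeasure (extend_measure0 \<nu>) (- range ext) = 0"
    using e[of "- range ext"] by simp
  fix t :: real and A assume t: "t > 0" and "A \<in> sets (extend_measure0 \<nu>)"
  then have A: "A \<in> sets borel" "0 \<notin> A" by (simp_all add: sets_punctured)
  have img: "ext_scale t ` A = ext_scale (1 / t) -` A"
    by (rule ext_scale_image_eq_vimage[OF t])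
  have "ext_scale (1 / t) \<in> borel_measurable borel"
    by (rule borel_measurable_continuous_onI[OF continuous_on_ext_scale])
  then have "ext_scale t ` A \<in> sets punctured"
    unfolding img sets_punctured using measurable_sets[of "ext_scale (1 / t)" borel borel A] A t
    by (simp add: ext_scale_eq_0_iff[of "1 / t" 0, THEN iffD2])
  then have "emeasure (extend_measure0 \<nu>) (ext_scale t ` A) = emeasure \<nu> (ext -` ext_scale t ` A)"
    by (rule e)
  also have "ext -` ext_scale t ` A = (\<lambda>x. (1 / t) *\<^sub>R x) -` (ext -` A)"
    unfolding img by (auto simp: ext_scale_def ext_def)
  also have "emeasure \<nu> \<dots> = ennreal ((1 / t) powr \<alpha>) * emeasure \<nu> (ext -` A)"
    using t A(1) measurable_sets[OF borel_measurable_ext A(1)] by (intro D(4)) auto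
  also have "(1 / t) powr \<alpha> = t powr - \<alpha>"
    using t by (simp add: powr_divide powr_minus_divide)
  also have "emeasure \<nu> (ext -` A) = emeasure (extend_measure0 \<nu>) A"
    using e[of A] A by (simp add: sets_punctured)
  finally show "emeasure (extend_measure0 \<nu>) (ext_scale t ` A) = ennreal (t powr - \<alpha>) * emeasure (extend_measure0 \<nu>) A" .
qed

text \<open>If the mass outside the unit ball were 0, homogeneity would make it 0 outside every ball
  and the measure would be null. The number is later used as a divisor.\<close>

lemma tail_measure_nonzero:
  assumes \<nu>: "tail_measure \<alpha> \<nu>" and ne: "emeasure \<nu> UNIV \<noteq> 0"
  shows "measure \<nu> {x. 1 \<le> N x} > 0"
proof (rule ccontr)
  assume "\<not> measure \<nu> {x. 1 \<le> N x} > 0"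
  then have "emeasure \<nu> {x. 1 \<le> N x} = 0"
    using tail_measureD(3)[OF \<nu>] by (simp add: emeasure_eq_ennreal_measure less_top zero_less_measure_iff)
  then have "emeasure \<nu> {x. r \<le> N x} = 0" if "r > 0" for r
    using emeasure_tail[OF \<nu> that] by simp
  then have "emeasure \<nu> (UNIV \<inter> {x. 1 / Suc n \<le> N x}) = 0" for n
    by simp
  then show False
    using emeasure_SUP_away_from_0[OF tail_measureD(1,2)[OF \<nu>], of UNIV] ne by simp
qed

end

section \<open>Ratio of the two survival functions and the two limits\<close>

context linear_filter
begin

text \<open>The indicator of the exterior of the unit ball is not continuous, so it is sandwiched
  between ramps over \<open>[1, v]\<close> and \<open>[u, 1]\<close>. By homogeneity their integrals
  are at least \<open>v powr - \<alpha> * c\<close> and at most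
  \<open>u powr - \<alpha> * c\<close>, which both tend to \<open>c\<close> as \<open>v\<close> and
  \<open>u\<close> approach 1: the unit sphere carries no mass.\<close>

lemma H_G_tendsto:
  assumes \<nu>: "tail_measure \<alpha> \<nu>"
    and lim: "\<And>B \<delta> f. test_function B \<delta> f \<Longrightarrow> ((\<lambda>s. L s f) \<longlongrightarrow> (\<integral>x. f x \<partial>\<nu>)) at_top"
  shows "((\<lambda>s. H s / G s) \<longlongrightarrow> measure \<nu> {x. 1 \<le> N x}) at_top"
proof -
  define c where "c = measure \<nu> {x. 1 \<le> N x}"
  define g where "g a b x = max 0 (min 1 ((N x - a) / (b - a)))" for a b and x :: "real ^ 'd"
  have g: "continuous_on UNIV (g a b)" "0 \<le> g a b x" "g a b x \<le> 1" "N x \<le> a \<Longrightarrow> g a b x = 0" "b \<le> N x \<Longrightarrow> g a b x = 1"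
    if "0 < a" "a < b" for a b x
    using ramp[OF that] by (auto simp: g_def)
  have g_meas: "g a b \<in> borel_measurable borel" if "0 < a" "a < b" for a b
    using g(1)[OF that] by (rule borel_measurable_continuous_onI)
  have lim_g: "((\<lambda>s. L s (g a b)) \<longlongrightarrow> (\<integral>x. g a b x \<partial>\<nu>)) at_top" if "0 < a" "a < b" for a b
    by (rule L_tendsto[OF \<nu> lim g(1)[OF that], where B = 1 and \<delta> = a]) (use g(2,3,4)[OF that] that in \<open>auto simp: abs_le_iff intro: order_trans[of _ 0]\<close>)
  have sets: "{x. r \<le> N x} \<in> sets \<nu>" for r
    using tail_measureD(1)[OF \<nu>] sets_tail(1) by simp
  have int_tail: "integrable \<nu> (indicator {x. r \<le> N x} :: _ \<Rightarrow> real)" "(\<integral>x. indicator {x. r \<le> N x} x \<partial>\<nu>) = r powr - \<alpha> * c" if "r > 0" for r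
    using emeasure_tail_finite[OF \<nu> that] measure_tail[OF \<nu> that] tail_measureD(5)[OF \<nu>] sets[of r]
    by (simp_all add: c_def)
  have int_g: "integrable \<nu> (g a b)" if "0 < a" "a < b" for a b
    by (rule integrable_away_from_0[OF \<nu> g_meas[OF that], where B = 1 and \<delta> = a]) (use g(2,3,4)[OF that] that in \<open>auto simp: abs_le_iff intro: order_trans[of _ 0]\<close>)
  have int_M: "integrable M (\<lambda>\<omega>. g a b (inverse s *\<^sub>R Z \<omega>))" if "0 < a" "a < b" for a b s
    by (rule integrable_const_bound[of _ 1]) (use g(2,3)[OF that] g_meas[OF that] in auto)
  have int_H: "integrable M (indicator {\<omega> \<in> space M. s < N (Z \<omega>)} :: _ \<Rightarrow> real)" for s
    by (intro integrable_real_indicator) (auto simp: emeasure_eq_measure)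
  have scale: "N (inverse s *\<^sub>R z) = N z / s" if "s > 0" for s z
    using that by (simp add: N_scaleR divide_inverse mult.commute)
  have upper: "H s / G s \<le> L s (g u 1)" if u: "0 < u" "u < 1" and s: "s > 0" for u s
  proof -
    have "(\<integral>\<omega>. indicator {\<omega> \<in> space M. s < N (Z \<omega>)} \<omega> \<partial>M) \<le> (\<integral>\<omega>. g u 1 (inverse s *\<^sub>R Z \<omega>) \<partial>M)"
    proof (rule integral_mono[OF int_H int_M[OF u]])
      fix \<omega> show "indicator {\<omega> \<in> space M. s < N (Z \<omega>)} \<omega> \<le> g u 1 (inverse s *\<^sub>R Z \<omega>)"
        using g(2)[OF u] g(5)[OF u, of "inverse s *\<^sub>R Z \<omega>"] s by (auto simp: indicator_def scale)
    qed
    then show ?thesis by (simp add: L_def divide_right_mono)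
  qed
  have lower: "L s (g 1 v) \<le> H s / G s" if v: "1 < v" and s: "s > 0" for v s
  proof -
    have v': "0 < (1::real)" "1 < v" using v by auto
    have "(\<integral>\<omega>. g 1 v (inverse s *\<^sub>R Z \<omega>) \<partial>M) \<le> (\<integral>\<omega>. indicator {\<omega> \<in> space M. s < N (Z \<omega>)} \<omega> \<partial>M)"
    proof (rule integral_mono[OF int_M[OF v'] int_H])
      fix \<omega> assume "\<omega> \<in> space M"
      then show "g 1 v (inverse s *\<^sub>R Z \<omega>) \<le> indicator {\<omega> \<in> space M. s < N (Z \<omega>)} \<omega>"
        using g(3)[OF v'] g(4)[OF v', of "inverse s *\<^sub>R Z \<omega>"] s by (auto simp: indicator_def scale)
    qed
    then show ?thesis by (simp add: L_def divide_right_mono)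
  qed
  have cont: "((\<lambda>u. u powr - \<alpha> * c) \<longlongrightarrow> c) (at 1 within A)" for A
  proof -
    have "((\<lambda>u. u powr - \<alpha> * c) \<longlongrightarrow> 1 powr - \<alpha> * c) (at 1 within A)"
      by (intro tendsto_intros) simp
    then show ?thesis by simp
  qed
  have "((\<lambda>s. H s / G s) \<longlongrightarrow> c) at_top"
  proof (rule order_tendstoI)
    fix l assume l: "l < c"
    have "\<forall>\<^sub>F v in at_right 1. l < v powr - \<alpha> * c \<and> 1 < v"
      by (intro eventually_conj order_tendstoD(1)[OF cont l] eventually_at_right_less)
    then obtain v where v: "l < v powr - \<alpha> * c" "1 < v"
      using eventually_happens'[OF trivial_limit_at_right_real] by blast
    have v': "0 < (1::real)" "1 < v" using v by auto
    have "v powr - \<alpha> * c \<le> (\<integral>x. g 1 v x \<partial>\<nu>)"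
      unfolding int_tail(2)[of v, symmetric, OF order_less_trans[OF zero_less_one v(2)]]
    proof (rule integral_mono[OF int_tail(1) int_g[OF v']])
      show "indicator {x. v \<le> N x} x \<le> g 1 v x" for x
        using g(2,5)[OF v'] by (auto simp: indicator_def)
    qed (use v in simp)
    then have "\<forall>\<^sub>F s in at_top. l < L s (g 1 v)"
      using v by (intro order_tendstoD(1)[OF lim_g[OF v']]) simp
    then show "\<forall>\<^sub>F s in at_top. l < H s / G s"
      using eventually_gt_at_top[of 0] by eventually_elim (use lower[OF v(2)] in \<open>blast intro: less_le_trans\<close>)
  next
    fix l assume l: "c < l"
    have "\<forall>\<^sub>F u in at_left 1. u powr - \<alpha> * c < l \<and> u < 1 \<and> 0 < u"
    proof (intro eventually_conj order_tendstoD(2)[OF cont l])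
      show "\<forall>\<^sub>F u in at_left (1::real). u < 1"
        by (simp add: eventually_at_filter)
      show "\<forall>\<^sub>F u in at_left (1::real). 0 < u"
        by (rule eventually_mono[OF eventually_at_left_real[of 0 1]]) auto
    qed
    then obtain u where u: "u powr - \<alpha> * c < l" "u < 1" "0 < u"
      using eventually_happens'[OF trivial_limit_at_left_real] by blast
    have "(\<integral>x. g u 1 x \<partial>\<nu>) \<le> u powr - \<alpha> * c"
      unfolding int_tail(2)[OF u(3), symmetric]
    proof (rule integral_mono[OF int_g[OF u(3,2)] int_tail(1)[OF u(3)]])
      show "g u 1 x \<le> indicator {x. u \<le> N x} x" for x
        using g(3,4)[OF u(3,2)] by (auto simp: indicator_def)
    qed
    then have "\<forall>\<^sub>F s in at_top. L s (g u 1) < l"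
      using u by (intro order_tendstoD(2)[OF lim_g[OF u(3,2)]]) simp
    then show "\<forall>\<^sub>F s in at_top. H s / G s < l"
      using eventually_gt_at_top[of 0] by eventually_elim (use upper[OF u(3,2)] in \<open>blast intro: le_less_trans\<close>)
  qed
  then show ?thesis by (simp add: c_def)
qed

text \<open>Both limits arise from those under the normalisation by \<open>G\<close> on multiplying
  by \<open>G s / H s\<close>, which tends to \<open>1 / c\<close>. The second limit thus comes out
  as \<open>\<mu>X\<close> divided by \<open>c\<close>, and the identity between
  \<open>\<mu>X\<close> and the images of \<open>\<nu>\<close> rewrites it as the required
  sum.\<close>

lemma ex_noise_RV:
  "\<exists>\<mu>Z. RV M N Z \<alpha> \<mu>Z \<and>
    vague_conv0 (normalized_law M N X Z) (sum_measures {1..q} (\<lambda>j. pushforward \<mu>Z (\<Psi> j)))"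
proof -
  obtain \<nu> where \<nu>: "tail_measure \<alpha> \<nu>"
    "\<And>B \<delta> f. test_function B \<delta> f \<Longrightarrow> ((\<lambda>s. L s f) \<longlongrightarrow> (\<integral>x. f x \<partial>\<nu>)) at_top"
    "\<And>A. A \<in> sets borel \<Longrightarrow> emeasure (finite_part \<mu>X) A = (\<Sum>j=1..q. emeasure \<nu> ((*v) (\<Psi> j) -` A))"
    using ex_noise_tail_measure by blast
  note D = tail_measureD[OF \<nu>(1)]
  note sets_\<mu>X = RV_sets[OF prob_space_axioms RV]
  \<comment> \<open>A null \<open>\<nu>\<close> would make the finite part of \<open>\<mu>X\<close>
    null.\<close>
  have ne: "emeasure \<nu> UNIV \<noteq> 0"
    using \<nu>(3)[of UNIV] RV_finite_part_nonzero[OF prob_space_axioms RV] by auto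
  define c where "c = measure \<nu> {x. 1 \<le> N x}"
  have c: "c > 0"
    unfolding c_def by (rule tail_measure_nonzero[OF \<nu>(1) ne])
  have "((\<lambda>s. inverse (H s / G s)) \<longlongrightarrow> inverse c) at_top"
    using H_G_tendsto[OF \<nu>(1,2)] c by (intro tendsto_inverse) (auto simp: c_def)
  then have G_H: "((\<lambda>s. G s / H s) \<longlongrightarrow> 1 / c) at_top"
    by (simp add: inverse_eq_divide)
  define \<nu>' where "\<nu>' = scale_measure (ennreal (1 / c)) \<nu>"
  define \<mu>Z where "\<mu>Z = extend_measure0 \<nu>'"
  have \<nu>': "tail_measure \<alpha> \<nu>'"
    unfolding \<nu>'_def by (rule tail_measure_scale[OF \<nu>(1)])
  have ne': "emeasure \<nu>' UNIV \<noteq> 0"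
    using ne c by (simp add: \<nu>'_def ennreal_eq_0_iff not_le)
  have sets_\<mu>Z: "sets \<mu>Z = sets punctured"
    by (simp add: \<mu>Z_def)
  have fin: "finite_part \<mu>Z = \<nu>'"
    unfolding \<mu>Z_def by (rule finite_part_extend_measure0[OF tail_measureD(1,2)[OF \<nu>']])
  have "vague_conv0 (normalized_law M N Z Z) \<mu>Z"
    unfolding vague_conv0_def
  proof
    fix f :: "ereal ^ 'd \<Rightarrow> real" assume f: "f \<in> Cc0"
    let ?g = "\<lambda>x. if x = 0 then 0 else f (ext x)"
    have cont: "continuous_on (- {0}) f" using f by (simp add: Cc0_def)
    obtain B \<delta> where g: "continuous_on UNIV ?g" "\<And>x. \<bar>?g x\<bar> \<le> B" "\<delta> > 0" "\<And>x. N x < \<delta> \<Longrightarrow> ?g x = 0"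
      using Cc0_restrict[OF f] by blast
    have "((\<lambda>s. L s ?g * (G s / H s)) \<longlongrightarrow> (\<integral>x. ?g x \<partial>\<nu>) * (1 / c)) at_top"
      by (intro tendsto_mult G_H L_tendsto[OF \<nu>(1,2) g])
    \<comment> \<open>This holds for every \<open>s\<close>: where \<open>H s = 0\<close> both sides
      are 0, and \<open>G s\<close> cancels because it is positive.\<close>
    moreover have "L s ?g * (G s / H s) = (\<integral>z. f z \<partial>normalized_law M N Z Z s)" for s
    proof -
      have "(\<integral>\<omega>. ?g (inverse s *\<^sub>R Z \<omega>) \<partial>M) = (\<integral>\<omega>. (if Z \<omega> = 0 \<or> s = 0 then 0 else f (ext (inverse s *\<^sub>R Z \<omega>))) \<partial>M)"
        by (rule Bochner_Integration.integral_cong) auto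
      then show ?thesis
        unfolding integral_normalized_law[OF Z cont] L_def using G_pos[of s] by simp
    qed
    moreover have "(\<integral>x. ?g x \<partial>\<nu>) * (1 / c) = (\<integral>z. f z \<partial>\<mu>Z)"
    proof -
      have "?g \<in> borel_measurable \<nu>"
        by (subst measurable_cong_sets[OF D(1) refl]) (rule borel_measurable_continuous_onI[OF g(1)])
      then have "(\<integral>x. ?g x \<partial>\<nu>') = (1 / c) * (\<integral>x. ?g x \<partial>\<nu>)"
        unfolding \<nu>'_def using c by (intro integral_scale_measure) auto
      moreover have "(\<integral>z. f z \<partial>\<mu>Z) = (\<integral>x. ?g x \<partial>\<nu>')"
        unfolding \<mu>Z_def by (rule integral_extend_measure0[OF tail_measureD(1)[OF \<nu>'] cont])
      ultimately show ?thesis by simp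
    qed
    ultimately show "((\<lambda>s. \<integral>z. f z \<partial>normalized_law M N Z Z s) \<longlongrightarrow> (\<integral>z. f z \<partial>\<mu>Z)) at_top"
      by simp
  qed
  then have "RV M N Z \<alpha> \<mu>Z"
    unfolding \<mu>Z_def by (rule RV_extend_measure0[OF \<nu>' ne' RV_index[OF prob_space_axioms RV] Z])
  moreover have "sum_measures {1..q} (\<lambda>j. pushforward \<mu>Z (\<Psi> j)) = scale_measure (ennreal (1 / c)) \<mu>X"
  proof (rule measure_eqI)
    show "sets (sum_measures {1..q} (\<lambda>j. pushforward \<mu>Z (\<Psi> j))) = sets (scale_measure (ennreal (1 / c)) \<mu>X)"
      by (simp add: sets_\<mu>X)
    fix A assume "A \<in> sets (sum_measures {1..q} (\<lambda>j. pushforward \<mu>Z (\<Psi> j)))"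
    then have A: "A \<in> sets punctured" by simp
    then have A': "A \<in> sets borel" "0 \<notin> A" by (simp_all add: sets_punctured)
    have vA: "ext -` A \<in> sets borel"
      using measurable_sets[OF borel_measurable_ext A'(1)] by simp
    have "emeasure (sum_measures {1..q} (\<lambda>j. pushforward \<mu>Z (\<Psi> j))) A = (\<Sum>j=1..q. emeasure (pushforward \<mu>Z (\<Psi> j)) A)"
      by (rule emeasure_sum_measures) (simp_all add: A)
    also have "\<dots> = (\<Sum>j=1..q. ennreal (1 / c) * emeasure \<nu> ((*v) (\<Psi> j) -` ext -` A))"
      unfolding emeasure_pushforward[OF sets_\<mu>Z A] fin \<nu>'_def by simp
    also have "\<dots> = ennreal (1 / c) * emeasure (finite_part \<mu>X) (ext -` A)"
      unfolding \<nu>(3)[OF vA] by (rule sum_distrib_left[symmetric])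
    also have "emeasure (finite_part \<mu>X) (ext -` A) = emeasure \<mu>X (ext ` (ext -` A - {0}))"
      by (rule emeasure_finite_part[OF sets_\<mu>X vA])
    \<comment> \<open>The identity obtained for \<open>\<nu>\<close> sees only the finite points of
      \<open>A\<close>; the others are null for \<open>\<mu>X\<close> by regular variation.\<close>
    also have "ext ` (ext -` A - {0}) = A - (- range ext)"
      using A'(2) by auto
    also have "emeasure \<mu>X (A - (- range ext)) = emeasure \<mu>X A"
      using RV_infinite_null[OF prob_space_axioms RV] A sets_\<mu>X by (intro emeasure_Diff_null_set) auto
    finally show "emeasure (sum_measures {1..q} (\<lambda>j. pushforward \<mu>Z (\<Psi> j))) A = emeasure (scale_measure (ennreal (1 / c)) \<mu>X) A"
      by simp
  qed
  moreover have "vague_conv0 (normalized_law M N X Z) (scale_measure (ennreal (1 / c)) \<mu>X)"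
    unfolding vague_conv0_def
  proof
    fix f :: "ereal ^ 'd \<Rightarrow> real" assume f: "f \<in> Cc0"
    have cont: "continuous_on (- {0}) f" using f by (simp add: Cc0_def)
    have "((\<lambda>s. (\<integral>z. f z \<partial>normalized_law M N X X s) * (G s / H s)) \<longlongrightarrow> (\<integral>z. f z \<partial>\<mu>X) * (1 / c)) at_top"
      using RV_vague[OF prob_space_axioms RV] f by (intro tendsto_mult G_H) (auto simp: vague_conv0_def)
    moreover have "(\<integral>z. f z \<partial>normalized_law M N X X s) * (G s / H s) = (\<integral>z. f z \<partial>normalized_law M N X Z s)" for s
      unfolding integral_normalized_law[OF X cont] using G_pos[of s] by simp
    moreover have "(\<integral>z. f z \<partial>\<mu>X) * (1 / c) = (\<integral>z. f z \<partial>scale_measure (ennreal (1 / c)) \<mu>X)"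
    proof -
      have "f \<in> borel_measurable \<mu>X"
        using borel_measurable_continuous_on_restrict[OF cont]
        by (subst measurable_cong_sets[OF sets_\<mu>X refl]) (simp add: punctured_def)
      then show ?thesis
        using c by (subst integral_scale_measure) auto
    qed
    ultimately show "((\<lambda>s. \<integral>z. f z \<partial>normalized_law M N X Z s) \<longlongrightarrow> (\<integral>z. f z \<partial>scale_measure (ennreal (1 / c)) \<mu>X)) at_top"
      by simp
  qed
  ultimately show ?thesis by auto
qed

end

theorem theorem5p1:
  fixes M :: "'w measure"
    and N :: "real ^ 'd \<Rightarrow> real"
    and q :: nat
    and \<Psi> :: "nat \<Rightarrow> real ^ 'd ^ 'd"
    and Zs :: "nat \<Rightarrow> 'w \<Rightarrow> real ^ 'd"
    and Z X :: "'w \<Rightarrow> real ^ 'd"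
    and \<alpha> :: real
    and \<mu>X :: "(ereal ^ 'd) measure"
  assumes "prob_space M"
    and "is_norm N"
    and "q \<ge> 1"
    and "prob_space.indep_vars M (\<lambda>_. borel) Zs {1..q}"
    and "Z \<in> borel_measurable M"
    and "\<And>j. j \<in> {1..q} \<Longrightarrow> distr M borel (Zs j) = distr M borel Z"
    and "X = (\<lambda>\<omega>. \<Sum>j=1..q. \<Psi> j *v Zs j \<omega>)"
    and "\<alpha> > 0"
    and "RV M N X \<alpha> \<mu>X"
    and "\<And>j. j \<in> {1..q} \<Longrightarrow> invertible (\<Psi> j)"
    and "(min_stretch N (\<Psi> 1)) powr \<alpha> > (\<Sum>j=2..q. (op_norm N (\<Psi> j)) powr \<alpha>)"
  shows "\<exists>\<mu>Z. RV M N Z \<alpha> \<mu>Z \<and>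
           vague_conv0 (normalized_law M N X Z)
             (sum_measures {1..q} (\<lambda>j. pushforward \<mu>Z (\<Psi> j)))"
proof -
  interpret prob_space M by (rule assms(1))
  interpret linear_filter N M q \<Psi> Zs Z X \<alpha> \<mu>X
    by unfold_locales (fact assms)+
  show ?thesis by (rule ex_noise_RV)
qed

end
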